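(* Let $V$ be a $2n$-dimensional $\mathbb Q_p$-vector space with non-degenerate alternating form $\langle\,,\rangle$, and let $\Lambda$ be a $\mathbb Z_p$-lattice on $V$ of level dividing $p$ which is the orthogonal sum of $a$ unimodular and $b$ $p$-modular hyperbolic planes ($a+b=n$). (i) Let $L,L'$ be $p$-elementary lattices on $V$ which are isometric, each an orthogonal sum of $a'$ unimodular and $b'$ $p$-modular hyperbolic planes. Then $L$ and $L'$ lie in the same $Sp(\Lambda)$-orbit if and only if they have the same elementary divisors with respect to $\Lambda$ and the same elementary divisors with respect to $\Lambda^\#$. (ii) Let $e_1,\dots,e_n,f_1,\dots,f_n$ be a basis of $\Lambda$ with $\langle e_i,e_j\rangle=\langle f_i,f_j\rangle=0$, $\langle e_i,f_j\rangle=\delta_{ij}$ for $1\le i\le a$ and $\langle e_i,f_j\rangle=p\delta_{ij}$ for $a<i\le n$. Then a set of representatives of the $Sp(\Lambda)$-orbits in (i) is given by the lattices $L(r_+,r_-,\mu_1,\dots,\mu_n)$ spanned by the vectors $p^{\mu_i}e_i,\,p^{-\mu_i+1}f_i$ for $1\le i\le r_-$; $p^{\mu_i}e_i,\,p^{-\mu_i}f_i$ for $r_-<i\le a$; $p^{\mu_i}e_i,\,p^{-\mu_i-1}f_i$ for $a<i\le a+r_+$; $p^{\mu_i}e_i,\,p^{-\mu_i}f_i$ for $a+r_+<i\le n$; where $0\le r_-\le\min(a,b')$, $0\le r_+\le\min(a',b)$, $b'=b-r_++r_-$, $a'=a-r_-+r_+$, $1\le\mu_1\le\dots\le\mu_{r_-}$,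 $0\le\mu_{r_-+1}\le\dots\le\mu_a$, $0\le\mu_{a+1}\le\dots\le\mu_{a+r_+}$, $0\le\mu_{a+r_++1}\le\dots\le\mu_n$. (iii) For nonnegative integers $a,b$ with $a+b=n$ let $\Gamma_{a,b}=Sp_n(\mathbb Q_p)\cap\begin{pmatrix}1_n&0\\0&T_{a,b}\end{pmatrix}M_{2n}(\mathbb Z_p)\begin{pmatrix}1_n&0\\0&T_{a,b}^{-1}\end{pmatrix}$ with $T_{a,b}=\operatorname{diag}(1_a,p1_b)$. Then, for $a',b'$ with $a'+b'=n$, a set of representatives of the double cosets $\Gamma_{a,b}\,\alpha\,\Gamma_{a',b'}$ with $\alpha\in Sp_n(\mathbb Q_p)$ is given by the block diagonal matrices $D(r_-,r_+,\mu_1,\dots,\mu_n)=\begin{pmatrix}B&0_n\\0_n&{}^tB^{-1}\end{pmatrix}$, with $r_\pm,\mu_i$ as in (ii), where $B=B(r_-,r_+,\mu_1,\dots,\mu_n)$ is the $n\times n$ block matrix $$B=\begin{pmatrix}0&0&\Delta_1&0\\0&\Delta_2&0&0\\\Delta_3&0&0&0\\0&0&0&\Delta_4\end{pmatrix}$$ with row blocks of sizes $r_-,\,a-r_-,\,r_+,\,b-r_+$ and column blocks of sizes $r_+,\,a-r_-,\,r_-,\,b-r_+$, and $\Delta_1=\operatorname{diag}(p^{\mu_1},\dots,p^{\mu_{r_-}})$, $\Delta_2=\operatorname{diag}(p^{\mu_{r_-+1}},\dots,p^{\mu_a})$, $\Delta_3=\operatorname{diag}(p^{\mu_{a+1}},\dots,p^{\mu_{a+r_+}})$,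 $\Delta_4=\operatorname{diag}(p^{\mu_{a+r_++1}},\dots,p^{\mu_n})$.
   Context: For a $\mathbb Z_p$-lattice $L$ on $V$, $L^\#=\{v:\langle v,L\rangle\subseteq\mathbb Z_p\}$. A lattice $L$ is $p$-elementary (has level dividing $p$) if $\langle L,L\rangle\subseteq\mathbb Z_p$ and $pL^\#\subseteq L$. A unimodular (resp. $p$-modular) hyperbolic plane is a rank 2 lattice with basis $e,f$, $\langle e,f\rangle=1$ (resp. $p$). $Sp(\Lambda)$ is the group of isometries of $V$ preserving $\Lambda$. The elementary divisors of $L$ with respect to a lattice $M$ are the $p$-powers $p^{c_1},\dots,p^{c_{2n}}$ such that $M$ has a basis $(x_i)$ with $(p^{c_i}x_i)$ a basis of $L$. $Sp_n(\mathbb Q_p)=\{g\in GL_{2n}(\mathbb Q_p):{}^tgJg=J\}$ with $J=\begin{pmatrix}0&1_n\\-1_n&0\end{pmatrix}$. *)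

theory Defs
  imports
    "HOL-Computational_Algebra.Polynomial_Factorial"
    "Berlekamp_Zassenhaus.Finite_Field"
    "Jordan_Normal_Form.Gauss_Jordan_Elimination"
begin

section \<open>The p-adic integers and the p-adic numbers\<close>

text \<open>
  The prime is p = CARD('p) for a type 'p of class prime_card; a type variable 'p therefore ranges
  over all primes. The ring of p-adic integers is the inverse limit of the rings Z/p^k, an element
  being given by its compatible sequence of least non-negative residues.
\<close>

definition compatible :: "int \<Rightarrow> (nat \<Rightarrow> int) \<Rightarrow> bool"
  where "compatible q x \<longleftrightarrow> (\<forall>k. x k = x (Suc k) mod q ^ k)"

lemma compatibleD: "compatible q x \<Longrightarrow> x k = x (Suc k) mod q ^ k"
  unfolding compatible_def by (rule spec)

lemma compatible_reduced: "compatible q x \<Longrightarrow> x k mod q ^ k = x k"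
  by (subst (1 2) compatibleD[of q x k]) (assumption, rule mod_mod_trivial)

lemma mod_pow_Suc: "z mod q ^ Suc k mod q ^ k = z mod (q::int) ^ k"
  by (rule mod_mod_cancel) simp

lemma compatible_0: "compatible q (\<lambda>_. 0)"
  unfolding compatible_def by simp

lemma compatible_1: "compatible q (\<lambda>k. 1 mod q ^ k)"
  unfolding compatible_def mod_pow_Suc by simp

lemma compatible_add:
  assumes x: "compatible q x" and y: "compatible q y"
  shows "compatible q (\<lambda>k. (x k + y k) mod q ^ k)"
  unfolding compatible_def mod_pow_Suc
  by (rule allI, subst compatibleD[OF x], subst compatibleD[OF y], rule mod_add_eq)

lemma compatible_diff:
  assumes x: "compatible q x" and y: "compatible q y"
  shows "compatible q (\<lambda>k. (x k - y k) mod q ^ k)"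
  unfolding compatible_def mod_pow_Suc
  by (rule allI, subst compatibleD[OF x], subst compatibleD[OF y], rule mod_diff_eq)

lemma compatible_mult:
  assumes x: "compatible q x" and y: "compatible q y"
  shows "compatible q (\<lambda>k. (x k * y k) mod q ^ k)"
  unfolding compatible_def mod_pow_Suc
  by (rule allI, subst compatibleD[OF x], subst compatibleD[OF y], rule mod_mult_eq)

lemma compatible_minus:
  assumes x: "compatible q x"
  shows "compatible q (\<lambda>k. (- x k) mod q ^ k)"
  using compatible_diff[OF compatible_0 x] by simp

typedef 'p padic_int = "{x. compatible (int CARD('p::prime_card)) x}"
  using compatible_0 by blast

setup_lifting type_definition_padic_int

instantiation padic_int :: (prime_card) comm_ring_1
begin

lift_definition zero_padic_int :: "'a padic_int" is "\<lambda>_. 0" by (rule compatible_0)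

lift_definition one_padic_int :: "'a padic_int" is "\<lambda>k. 1 mod int CARD('a) ^ k"
  by (rule compatible_1)

lift_definition plus_padic_int :: "'a padic_int \<Rightarrow> 'a padic_int \<Rightarrow> 'a padic_int"
  is "\<lambda>x y k. (x k + y k) mod int CARD('a) ^ k"
  by (rule compatible_add)

lift_definition uminus_padic_int :: "'a padic_int \<Rightarrow> 'a padic_int"
  is "\<lambda>x k. (- x k) mod int CARD('a) ^ k"
  by (rule compatible_minus)

lift_definition minus_padic_int :: "'a padic_int \<Rightarrow> 'a padic_int \<Rightarrow> 'a padic_int"
  is "\<lambda>x y k. (x k - y k) mod int CARD('a) ^ k"
  by (rule compatible_diff)

lift_definition times_padic_int :: "'a padic_int \<Rightarrow> 'a padic_int \<Rightarrow> 'a padic_int"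
  is "\<lambda>x y k. (x k * y k) mod int CARD('a) ^ k"
  by (rule compatible_mult)

instance
proof
  fix x y z :: "'a padic_int"
  show "x * y * z = x * (y * z)"
    by transfer (rule ext, simp only: mod_mult_left_eq mod_mult_right_eq mult.assoc)
  show "x * y = y * x"
    by transfer (rule ext, simp only: mult.commute)
  show "1 * x = x"
    by transfer (rule ext, simp only: mod_mult_left_eq mult_1 compatible_reduced)
  show "x + y + z = x + (y + z)"
    by transfer (rule ext, simp only: mod_add_left_eq mod_add_right_eq add.assoc)
  show "x + y = y + x"
    by transfer (rule ext, simp only: add.commute)
  show "0 + x = x"
    by transfer (rule ext, simp only: add_0 compatible_reduced)
  show "- x + x = 0"
    by transfer (rule ext, simp only: mod_add_left_eq left_minus mod_0)
  show "x - y = x + - y"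
    by transfer (rule ext, simp only: mod_add_right_eq diff_conv_add_uminus)
  show "(x + y) * z = x * z + y * z"
    by transfer (rule ext, simp only: mod_mult_left_eq mod_add_eq distrib_right)
  show "(0 :: 'a padic_int) \<noteq> 1"
  proof transfer
    have "(1::int) mod int CARD('a) ^ 1 = 1"
      using prime_gt_1_nat[OF prime_card[where 'a='a]] by simp
    then show "(\<lambda>_. 0) \<noteq> (\<lambda>k. 1 mod int CARD('a) ^ k)"
      unfolding fun_eq_iff by (metis zero_neq_one)
  qed
qed

end

lemma compatible_mod:
  assumes x: "compatible q x"
  shows "x (m + j) mod q ^ m = x m"
proof (induction j)
  case 0
  show ?case unfolding add_0_right by (rule compatible_reduced[OF x])
next
  case (Suc j)
  have "x (m + Suc j) mod q ^ m = (x (Suc (m + j)) mod q ^ (m + j)) mod q ^ m"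
    unfolding add_Suc_right by (rule mod_mod_cancel[symmetric], rule le_imp_power_dvd) simp
  also have "\<dots> = x m" unfolding compatibleD[OF x, symmetric] by (rule Suc)
  finally show ?case .
qed

instance padic_int :: (prime_card) idom
proof
  fix x y :: "'a padic_int"
  assume "x \<noteq> 0" "y \<noteq> 0"
  then show "x * y \<noteq> 0"
  proof transfer
    fix x y :: "nat \<Rightarrow> int"
    let ?p = "int CARD('a)"
    assume x: "compatible ?p x" and y: "compatible ?p y"
    assume "x \<noteq> (\<lambda>_. 0)" "y \<noteq> (\<lambda>_. 0)"
    then obtain m k where m: "x m \<noteq> 0" and k: "y k \<noteq> 0" unfolding fun_eq_iff by blast
    have nx: "\<not> ?p ^ m dvd x (m + k)"
      unfolding dvd_eq_mod_eq_0 compatible_mod[OF x] by (rule m)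
    have ny: "\<not> ?p ^ k dvd y (m + k)"
      unfolding dvd_eq_mod_eq_0 add.commute[of m k] compatible_mod[OF y] by (rule k)
    have x0: "x (m + k) \<noteq> 0" and y0: "y (m + k) \<noteq> 0"
      by (rule notI, use nx ny in simp)+
    have pr: "prime_elem ?p" by (rule prime_imp_prime_elem) (rule prime_card_int)
    have nu: "\<not> is_unit ?p" by (rule prime_elem_not_unit) (rule pr)
    have "multiplicity ?p (x (m + k)) < m" "multiplicity ?p (y (m + k)) < k"
      using nx ny unfolding power_dvd_iff_le_multiplicity[OF x0 nu]
        power_dvd_iff_le_multiplicity[OF y0 nu] by simp_all
    then have "multiplicity ?p (x (m + k) * y (m + k)) < m + k"
      unfolding prime_elem_multiplicity_mult_distrib[OF pr x0 y0] by (rule add_strict_mono)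
    moreover have "x (m + k) * y (m + k) \<noteq> 0" using x0 y0 by simp
    ultimately have "\<not> ?p ^ (m + k) dvd x (m + k) * y (m + k)"
      using nu power_dvd_iff_le_multiplicity by (metis not_le)
    then show "(\<lambda>k. (x k * y k) mod ?p ^ k) \<noteq> (\<lambda>_. 0)"
      unfolding dvd_eq_mod_eq_0 fun_eq_iff by blast
  qed
qed

type_synonym 'p padic = "'p padic_int fract"

definition Zp :: "'p::prime_card padic set"
  where "Zp = range to_fract"

text \<open>The prime p as an element of the field of p-adic numbers.\<close>

definition pp :: "'p::prime_card padic"
  where "pp = of_nat CARD('p)"


section \<open>Symplectic spaces\<close>

locale symplectic_space = vector_space scale
  for scale :: "'p::prime_card padic \<Rightarrow> 'v::ab_group_add \<Rightarrow> 'v" +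
  fixes form :: "'v \<Rightarrow> 'v \<Rightarrow> 'p padic" and n :: nat
  assumes linear_left: "Vector_Spaces.linear scale (*) (\<lambda>u. form u v)"
    and linear_right: "Vector_Spaces.linear scale (*) (form u)"
    and alternating: "form v v = 0"
    and nondegenerate: "(\<And>v. form u v = 0) \<Longrightarrow> u = 0"
    and dimension: "\<exists>X. finite X \<and> independent X \<and> span X = UNIV \<and> card X = 2 * n"

definition isometries ::
    "('p::prime_card padic \<Rightarrow> 'v::ab_group_add \<Rightarrow> 'v) \<Rightarrow> ('v \<Rightarrow> 'v \<Rightarrow> 'p padic) \<Rightarrow> ('v \<Rightarrow> 'v) set"
  where "isometries scale form =
    {g. Vector_Spaces.linear scale scale g \<and> bij g \<and> (\<forall>u v. form (g u) (g v) = form u v)}"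


section \<open>Lattices\<close>

definition zp_scale ::
    "('p::prime_card padic \<Rightarrow> 'v::ab_group_add \<Rightarrow> 'v) \<Rightarrow> 'p padic_int \<Rightarrow> 'v \<Rightarrow> 'v"
  where "zp_scale scale c = scale (to_fract c)"

lemma module_zp_scale:
  assumes "vector_space scale"
  shows "Modules.module (zp_scale scale)"
proof -
  interpret vector_space scale by fact
  show ?thesis
    by unfold_locales
      (simp_all add: zp_scale_def scale_right_distrib scale_left_distrib)
qed

definition zp_span ::
    "('p::prime_card padic \<Rightarrow> 'v::ab_group_add \<Rightarrow> 'v) \<Rightarrow> 'v set \<Rightarrow> 'v set"
  where "zp_span scale = Modules.module.span (zp_scale scale)"

definition zp_basis ::
    "('p::prime_card padic \<Rightarrow> 'v::ab_group_add \<Rightarrow> 'v) \<Rightarrow> 'v list \<Rightarrow> 'v set \<Rightarrow> bool"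
  where "zp_basis scale xs L \<longleftrightarrow>
    distinct xs \<and> \<not> Modules.module.dependent (zp_scale scale) (set xs) \<and> L = zp_span scale (set xs)"

text \<open>Lattices on the whole space, i.e. of full rank.\<close>

definition lattice_on ::
    "('p::prime_card padic \<Rightarrow> 'v::ab_group_add \<Rightarrow> 'v) \<Rightarrow> 'v set \<Rightarrow> bool"
  where "lattice_on scale L \<longleftrightarrow>
    (\<exists>xs. zp_basis scale xs L \<and> Modules.module.span scale (set xs) = UNIV)"

definition dual_lattice :: "('v \<Rightarrow> 'v \<Rightarrow> 'p::prime_card padic) \<Rightarrow> 'v set \<Rightarrow> 'v set"
  where "dual_lattice form L = {v. \<forall>w\<in>L. form v w \<in> Zp}"

definition p_elementary ::
    "('p::prime_card padic \<Rightarrow> 'v::ab_group_add \<Rightarrow> 'v) \<Rightarrow> ('v \<Rightarrow> 'v \<Rightarrow> 'p padic) \<Rightarrow> 'v set \<Rightarrow> bool"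
  where "p_elementary scale form L \<longleftrightarrow>
    (\<forall>u\<in>L. \<forall>v\<in>L. form u v \<in> Zp) \<and> scale pp ` dual_lattice form L \<subseteq> L"

definition hyperbolic_plane ::
    "('p::prime_card padic \<Rightarrow> 'v::ab_group_add \<Rightarrow> 'v) \<Rightarrow> ('v \<Rightarrow> 'v \<Rightarrow> 'p padic) \<Rightarrow> 'p padic
      \<Rightarrow> 'v set \<Rightarrow> bool"
  where "hyperbolic_plane scale form c P \<longleftrightarrow>
    (\<exists>e f. zp_basis scale [e, f] P \<and> form e f = c)"

text \<open>
  Orthogonal sum of a unimodular and b p-modular hyperbolic planes. The sum is automatically direct,
  since the summands are mutually orthogonal and non-degenerate.
\<close>

definition hyperbolic_sum ::
    "('p::prime_card padic \<Rightarrow> 'v::ab_group_add \<Rightarrow> 'v) \<Rightarrow> ('v \<Rightarrow> 'v \<Rightarrow> 'p padic) \<Rightarrow> nat \<Rightarrow> nat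
      \<Rightarrow> 'v set \<Rightarrow> bool"
  where "hyperbolic_sum scale form a b L \<longleftrightarrow>
    (\<exists>P. (\<forall>i<a. hyperbolic_plane scale form 1 (P i)) \<and>
         (\<forall>i. a \<le> i \<and> i < a + b \<longrightarrow> hyperbolic_plane scale form pp (P i)) \<and>
         (\<forall>i<a + b. \<forall>j<a + b. i \<noteq> j \<longrightarrow> (\<forall>u\<in>P i. \<forall>v\<in>P j. form u v = 0)) \<and>
         L = zp_span scale (\<Union>i<a + b. P i))"

text \<open>An isometry between two lattices on V extends uniquely to an isometry of V.\<close>

definition isometric ::
    "('p::prime_card padic \<Rightarrow> 'v::ab_group_add \<Rightarrow> 'v) \<Rightarrow> ('v \<Rightarrow> 'v \<Rightarrow> 'p padic) \<Rightarrow> 'v set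
      \<Rightarrow> 'v set \<Rightarrow> bool"
  where "isometric scale form L L' \<longleftrightarrow> (\<exists>g\<in>isometries scale form. g ` L = L')"

definition Sp_lattice ::
    "('p::prime_card padic \<Rightarrow> 'v::ab_group_add \<Rightarrow> 'v) \<Rightarrow> ('v \<Rightarrow> 'v \<Rightarrow> 'p padic) \<Rightarrow> 'v set
      \<Rightarrow> ('v \<Rightarrow> 'v) set"
  where "Sp_lattice scale form \<Lambda> = {g \<in> isometries scale form. g ` \<Lambda> = \<Lambda>}"

definition Sp_orbit ::
    "('p::prime_card padic \<Rightarrow> 'v::ab_group_add \<Rightarrow> 'v) \<Rightarrow> ('v \<Rightarrow> 'v \<Rightarrow> 'p padic) \<Rightarrow> 'v set
      \<Rightarrow> 'v set \<Rightarrow> 'v set set"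
  where "Sp_orbit scale form \<Lambda> L = {g ` L |g. g \<in> Sp_lattice scale form \<Lambda>}"

text \<open>
  The multiset of elementary divisors of L with respect to M; for lattices L and M on the same
  space it exists and is unique by the elementary divisor theorem.
\<close>

definition has_elementary_divisors ::
    "('p::prime_card padic \<Rightarrow> 'v::ab_group_add \<Rightarrow> 'v) \<Rightarrow> 'v set \<Rightarrow> 'v set
      \<Rightarrow> 'p padic multiset \<Rightarrow> bool"
  where "has_elementary_divisors scale L M D \<longleftrightarrow>
    (\<exists>xs (cs :: int list). length cs = length xs \<and> zp_basis scale xs M \<and>
       zp_basis scale (map2 (\<lambda>c x. scale (pp powi c) x) cs xs) L \<and>
       D = mset (map (\<lambda>c. pp powi c) cs))"

definition elementary_divisors ::
    "('p::prime_card padic \<Rightarrow> 'v::ab_group_add \<Rightarrow> 'v) \<Rightarrow> 'v set \<Rightarrow> 'v set \<Rightarrow> 'p padic multiset"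
  where "elementary_divisors scale L M = (THE D. has_elementary_divisors scale L M D)"


section \<open>Representatives\<close>

text \<open>
  The family y, indexed by T, is a set of representatives of the classes cls x (x in X): the
  members are pairwise distinct elements of X, exactly one in each class.
\<close>

definition representatives :: "('t \<Rightarrow> 'x) \<Rightarrow> 't set \<Rightarrow> 'x set \<Rightarrow> ('x \<Rightarrow> 'x set) \<Rightarrow> bool"
  where "representatives y T X cls \<longleftrightarrow>
    inj_on y T \<and> y ` T \<subseteq> X \<and> (\<forall>x\<in>X. \<exists>!r. r \<in> y ` T \<and> cls r = cls x)"

definition ascending_from :: "int \<Rightarrow> int list \<Rightarrow> nat \<Rightarrow> nat \<Rightarrow> bool"
  where "ascending_from c \<mu> l h \<longleftrightarrow> (\<forall>i\<in>{l..<h}. c \<le> \<mu> ! i) \<and> mono_on {l..<h} ((!) \<mu>)"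

text \<open>
  Parameters (r_-, r_+, [\<mu>_1, ..., \<mu>_n]). From here on, indices run from 0 to n - 1, so the
  list entry number i is \<mu>_(i+1). The equations for a' and b' are stated without subtraction.
\<close>

definition params :: "nat \<Rightarrow> nat \<Rightarrow> nat \<Rightarrow> nat \<Rightarrow> nat \<Rightarrow> (nat \<times> nat \<times> int list) set"
  where "params n a b a' b' =
    {(rm, rp, \<mu>). rm \<le> min a b' \<and> rp \<le> min a' b \<and> b' + rp = b + rm \<and> a' + rm = a + rp \<and>
       length \<mu> = n \<and>
       ascending_from 1 \<mu> 0 rm \<and> ascending_from 0 \<mu> rm a \<and>
       ascending_from 0 \<mu> a (a + rp) \<and> ascending_from 0 \<mu> (a + rp) n}"

definition rep_lattice ::
    "('p::prime_card padic \<Rightarrow> 'v::ab_group_add \<Rightarrow> 'v) \<Rightarrow> (nat \<Rightarrow> 'v) \<Rightarrow> (nat \<Rightarrow> 'v) \<Rightarrow> nat \<Rightarrow> nat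
      \<Rightarrow> nat \<times> nat \<times> int list \<Rightarrow> 'v set"
  where "rep_lattice scale e f n a = (\<lambda>(rm, rp, \<mu>).
    zp_span scale
      ((\<lambda>i. scale (pp powi (\<mu> ! i)) (e i)) ` {..<n} \<union>
       (\<lambda>i. scale (pp powi (if i < rm then - \<mu> ! i + 1
                           else if i < a then - \<mu> ! i
                           else if i < a + rp then - \<mu> ! i - 1
                           else - \<mu> ! i)) (f i)) ` {..<n}))"


section \<open>Matrix groups\<close>

definition minv :: "'k::field mat \<Rightarrow> 'k mat"
  where "minv A = the (mat_inverse A)"

definition J_mat :: "nat \<Rightarrow> 'p::prime_card padic mat"
  where "J_mat n = four_block_mat (0\<^sub>m n n) (1\<^sub>m n) (- 1\<^sub>m n) (0\<^sub>m n n)"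

definition Sp_mat :: "nat \<Rightarrow> 'p::prime_card padic mat set"
  where "Sp_mat n =
    {g \<in> carrier_mat (2 * n) (2 * n). invertible_mat g \<and> transpose_mat g * J_mat n * g = J_mat n}"

definition T_mat :: "nat \<Rightarrow> nat \<Rightarrow> 'p::prime_card padic mat"
  where "T_mat a b = mat_diag (a + b) (\<lambda>i. if i < a then 1 else pp)"

definition Gamma :: "nat \<Rightarrow> nat \<Rightarrow> 'p::prime_card padic mat set"
  where "Gamma a b = (let n = a + b in
    Sp_mat n \<inter>
    {four_block_mat (1\<^sub>m n) (0\<^sub>m n n) (0\<^sub>m n n) (T_mat a b) * M *
       four_block_mat (1\<^sub>m n) (0\<^sub>m n n) (0\<^sub>m n n) (minv (T_mat a b))
     |M. M \<in> carrier_mat (2 * n) (2 * n) \<and> elements_mat M \<subseteq> Zp})"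

definition double_coset :: "'p::prime_card padic mat set \<Rightarrow> 'p padic mat set \<Rightarrow> 'p padic mat
    \<Rightarrow> 'p padic mat set"
  where "double_coset G H \<alpha> = {g * \<alpha> * h |g h. g \<in> G \<and> h \<in> H}"

definition B_mat :: "nat \<Rightarrow> nat \<Rightarrow> nat \<times> nat \<times> int list \<Rightarrow> 'p::prime_card padic mat"
  where "B_mat a b = (\<lambda>(rm, rp, \<mu>).
    let \<Delta>1 = mat_diag rm (\<lambda>i. pp powi (\<mu> ! i));
        \<Delta>2 = mat_diag (a - rm) (\<lambda>i. pp powi (\<mu> ! (rm + i)));
        \<Delta>3 = mat_diag rp (\<lambda>i. pp powi (\<mu> ! (a + i)));
        \<Delta>4 = mat_diag (b - rp) (\<lambda>i. pp powi (\<mu> ! (a + rp + i)))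
    in four_block_mat
      (four_block_mat (0\<^sub>m rm rp) (0\<^sub>m rm (a - rm))
                      (0\<^sub>m (a - rm) rp) \<Delta>2)
      (four_block_mat \<Delta>1 (0\<^sub>m rm (b - rp))
                      (0\<^sub>m (a - rm) rm) (0\<^sub>m (a - rm) (b - rp)))
      (four_block_mat \<Delta>3 (0\<^sub>m rp (a - rm))
                      (0\<^sub>m (b - rp) rp) (0\<^sub>m (b - rp) (a - rm)))
      (four_block_mat (0\<^sub>m rp rm) (0\<^sub>m rp (b - rp))
                      (0\<^sub>m (b - rp) rm) \<Delta>4))"

definition D_mat :: "nat \<Rightarrow> nat \<Rightarrow> nat \<times> nat \<times> int list \<Rightarrow> 'p::prime_card padic mat"
  where "D_mat a b t = four_block_mat (B_mat a b t) (0\<^sub>m (a + b) (a + b))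
    (0\<^sub>m (a + b) (a + b)) (minv (transpose_mat (B_mat a b t)))"

end

theory Submission
  imports Defs "Jordan_Normal_Form.Determinant"
begin

text \<open>
  A lattice that is an orthogonal sum of unimodular and p-modular hyperbolic planes is the unit ball
  of a norm which is self-dual with respect to the alternating form. Given two self-dual norms
  \<alpha> and \<beta>, choose x maximizing \<beta> - \<alpha> and y dual to x with respect to \<alpha>; then y is also dual to x with
  respect to \<beta>, so the plane spanned by x and y splits off for both norms. By induction the two
  lattices have a common symplectic basis up to powers of p (they lie in a common apartment), and
  swapping and reordering the basis vectors gives the normal form L(r_+, r_-, \<mu>).

  For the uniqueness let X and Y be the multisets of exponents belonging to the unimodular and to the
  p-modular planes of \<Lambda>. The elementary divisors with respect to \<Lambda> and its dual are X + Y and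
  X + (Y shifted by 1), which determine X and Y; within X the pairs {k, -k} and {k, 1 - k} are told
  apart by the differences of the multiplicities of k and -k, and similarly within Y.

  Part (iii) is part (ii) for the column space, since the groups \<Gamma> are the stabilizers of lattices
  and D maps the standard lattice of type (a', b') to L(r_+, r_-, \<mu>).
\<close>

section \<open>The valuation of the p-adic numbers\<close>

text \<open>The elementary divisor theorem gives a basis adapted to two lattices but ignores the
  form, and splitting a plane off one lattice need not split the other. The norm attached to a
  lattice L makes both tractable because it records L together with its dual. With doubled values,
  basis vectors of unimodular planes have norm 0 and those of p-modular planes have norm 1; then L
  is the ball {\<alpha> \<ge> 0} and L^# is the ball {\<alpha> \<ge> -1}. In this language the two
  kinds of planes are treated alike, and self-duality is inherited by the orthogonal complement of
  every dual pair, which is what the induction needs. A maximum of \<beta> - \<alpha> exists because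
  the values are integers and the difference of two such norms on a finite-dimensional space is
  bounded above. The groups in (iii) are defined by integrality, which yields only an inclusion g L
  \<subseteq> L. That a sublattice of the same type and span is the whole lattice is read off from
  the common basis as well, without comparing volumes.\<close>

lemma compatible_Rep_padic_int:
  "compatible (int CARD('p)) (Rep_padic_int (x :: 'p::prime_card padic_int))"
  using Rep_padic_int by blast

lemma Rep_padic_int_of_nat:
  "Rep_padic_int (of_nat m :: 'p::prime_card padic_int) k = int m mod int CARD('p) ^ k"
  by (induction m) (simp_all add: zero_padic_int.rep_eq plus_padic_int.rep_eq
      one_padic_int.rep_eq mod_add_eq)

text \<open>A nonzero residue modulo p makes every residue coprime to p. Inverses modulo p^k are
  unique, so inverses chosen independently at each level fit together to a p-adic integer.\<close>

lemma padic_int_dvd_one: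
  fixes x :: "'p::prime_card padic_int"
  assumes "Rep_padic_int x 1 \<noteq> 0"
  shows "x dvd 1"
proof -
  define q r where "q = int CARD('p)" and "r = Rep_padic_int x"
  have r: "compatible q r" unfolding q_def r_def by (rule compatible_Rep_padic_int)
  have pq: "prime q" unfolding q_def by (rule prime_card_int)
  have q0: "q \<noteq> 0" using pq by auto
  have r1: "r 1 \<noteq> 0" using assms by (simp add: r_def)
  have cop: "coprime (r k) (q ^ k)" for k
  proof (cases k)
    case (Suc j)
    have "r k mod q = r 1" using compatible_mod[OF r, of 1 j] Suc by simp
    with r1 have "\<not> q dvd r k" by auto
    with pq have "coprime q (r k)" by (rule prime_imp_coprime)
    then show ?thesis by (simp add: coprime_commute)
  qed simp
  \<comment> \<open>The outer reduction makes the chosen inverse a least non-negative residue, as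
    \<open>compatible\<close> demands.\<close>
  define y where "y k = (SOME y. [r k * y = 1] (mod q ^ k)) mod q ^ k" for k
  have y: "[r k * y k = 1] (mod q ^ k)" for k
  proof -
    have "\<exists>y. [r k * y = 1] (mod q ^ k)"
      using cong_solve_coprime_int[OF cop] by blast
    from someI_ex[OF this] show ?thesis unfolding y_def cong_def by (simp add: mod_mult_right_eq)
  qed
  have cy: "compatible q y"
    unfolding compatible_def
  proof
    fix k
    have "[r (Suc k) = r k] (mod q ^ k)"
      using compatibleD[OF r, of k] by (simp add: cong_def)
    moreover have "[r (Suc k) * y (Suc k) = 1] (mod q ^ k)"
      using y[of "Suc k"] by (rule cong_dvd_modulus) simp
    ultimately have "[r k * y (Suc k) = r k * y k] (mod q ^ k)"
      using y[of k] by (metis cong_scalar_right cong_sym cong_trans)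
    then have "[y (Suc k) = y k] (mod q ^ k)"
      using cong_mult_lcancel[OF cop] by blast
    then show "y k = y (Suc k) mod q ^ k" by (simp add: cong_def y_def)
  qed
  have "x * Abs_padic_int y = 1"
  proof (rule Rep_padic_int_inject[THEN iffD1], rule ext)
    fix k
    have "Rep_padic_int (Abs_padic_int y :: 'p padic_int) = y"
      using cy by (intro Abs_padic_int_inverse) (simp add: q_def)
    then show "Rep_padic_int (x * Abs_padic_int y) k = Rep_padic_int (1 :: 'p padic_int) k"
      using y[of k] by (simp add: times_padic_int.rep_eq one_padic_int.rep_eq cong_def
          r_def q_def)
  qed
  then show ?thesis by (metis dvdI)
qed

lemma padic_int_p_dvd:
  fixes x :: "'p::prime_card padic_int"
  assumes "Rep_padic_int x 1 = 0"
  shows "of_nat CARD('p) dvd x"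
proof -
  define q r where "q = int CARD('p)" and "r = Rep_padic_int x"
  have r: "compatible q r" unfolding q_def r_def by (rule compatible_Rep_padic_int)
  have q0: "q > 0" unfolding q_def by simp
  have dvd: "q dvd r (Suc k)" for k
    using compatible_mod[OF r, of 1 k] assms by (auto simp: r_def)
  \<comment> \<open>Division by p costs one digit, so level k of the quotient is read off at level k
    + 1.\<close>
  define y where "y k = r (Suc k) div q" for k
  have cy: "compatible q y"
    unfolding compatible_def
  proof
    fix k
    have "r (Suc k) = r (Suc (Suc k)) mod (q * q ^ k)"
      using compatibleD[OF r, of "Suc k"] by simp
    also have "\<dots> = q * (r (Suc (Suc k)) div q mod q ^ k) + r (Suc (Suc k)) mod q"
      using q0 by (simp add: zmod_zmult2_eq)
    finally show "y k = y (Suc k) mod q ^ k"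
      using q0 dvd[of "Suc k"] by (simp add: y_def)
  qed
  have "of_nat CARD('p) * Abs_padic_int y = x"
  proof (rule Rep_padic_int_inject[THEN iffD1], rule ext)
    fix k
    have "Rep_padic_int (Abs_padic_int y :: 'p padic_int) = y"
      using cy by (intro Abs_padic_int_inverse) (simp add: q_def)
    then have "Rep_padic_int (of_nat CARD('p) * Abs_padic_int y :: 'p padic_int) k
        = (q * y k) mod q ^ k"
      by (simp add: times_padic_int.rep_eq Rep_padic_int_of_nat q_def mod_mult_left_eq)
    also have "\<dots> = r k"
      using compatibleD[OF r, of k] dvd[of k] by (simp add: y_def)
    finally show "Rep_padic_int (of_nat CARD('p) * Abs_padic_int y :: 'p padic_int) k
        = Rep_padic_int x k"
      by (simp add: r_def)
  qed
  then show ?thesis by (metis dvdI)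
qed

text \<open>Induction on a level k at which the residue of x is nonzero: either x is a unit, or x =
  p * y and y has a nonzero residue already at level k - 1. At level 0 all residues are 0, so the
  induction starts vacuously.\<close>

lemma padic_int_decomposition:
  fixes x :: "'p::prime_card padic_int"
  assumes "x \<noteq> 0"
  obtains m u where "x = of_nat CARD('p) ^ m * u" "u dvd 1"
proof -
  obtain k where "Rep_padic_int x k \<noteq> 0"
    using assms Rep_padic_int_inject[of x 0] by (auto simp: zero_padic_int.rep_eq)
  then have "\<exists>m u. x = of_nat CARD('p) ^ m * u \<and> u dvd 1"
  proof (induction k arbitrary: x)
    case 0
    then show ?case
      using compatible_reduced[OF compatible_Rep_padic_int[of x], of 0] by simp
  next
    case (Suc k)
    show ?case
    proof (cases "Rep_padic_int x 1 = 0")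
      case False
      then have "x dvd 1" by (rule padic_int_dvd_one)
      then show ?thesis by (intro exI[of _ 0] exI[of _ x]) simp
    next
      case True
      then obtain y where y: "x = of_nat CARD('p) * y"
        using padic_int_p_dvd[OF True] by (auto elim: dvdE)
      have "Rep_padic_int y k \<noteq> 0"
      proof
        assume 0: "Rep_padic_int y k = 0"
        have "int CARD('p) ^ k dvd Rep_padic_int y (Suc k)"
          using compatibleD[OF compatible_Rep_padic_int[of y], of k] 0 by auto
        then have "int CARD('p) ^ Suc k dvd int CARD('p) * Rep_padic_int y (Suc k)"
          by simp
        then have "Rep_padic_int x (Suc k) = 0"
          unfolding y times_padic_int.rep_eq Rep_padic_int_of_nat mod_mult_left_eq by simp
        with Suc.prems show False by simp
      qed
      from Suc.IH[OF this] obtain m u where "y = of_nat CARD('p) ^ m * u" "u dvd 1" by blast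
      then show ?thesis unfolding y by (intro exI[of _ "Suc m"] exI[of _ u]) simp
    qed
  qed
  then show thesis using that by blast
qed

section \<open>Integrality, units and valuation in the field of p-adic numbers\<close>

lemma Zp_closed [intro, simp]:
  "0 \<in> Zp" "1 \<in> Zp" "x \<in> Zp \<Longrightarrow> y \<in> Zp \<Longrightarrow> x + y \<in> Zp" "x \<in> Zp \<Longrightarrow> y \<in> Zp \<Longrightarrow> x * y \<in> Zp"
  "x \<in> Zp \<Longrightarrow> - x \<in> Zp" "x \<in> Zp \<Longrightarrow> y \<in> Zp \<Longrightarrow> x - y \<in> Zp"
  unfolding Zp_def
  by (auto simp: image_iff) (metis to_fract_0 to_fract_1 to_fract_add to_fract_mult
      to_fract_uminus to_fract_diff)+

lemma Zp_power [intro, simp]: "x \<in> Zp \<Longrightarrow> x ^ k \<in> Zp"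
  by (induction k) auto

lemma pp_eq: "(pp :: 'p::prime_card padic) = to_fract (of_nat CARD('p))"
proof -
  have "of_nat k = to_fract (of_nat k :: 'p padic_int)" for k by (induction k) auto
  then show ?thesis unfolding pp_def by blast
qed

lemma pp_in_Zp [intro, simp]: "pp \<in> Zp"
  unfolding pp_eq Zp_def by blast

text \<open>Seen in the residue modulo p. The uniqueness of the valuation rests on this
  fact.\<close>

lemma pp_mult_neq_one:
  fixes z :: "'p::prime_card padic"
  assumes "z \<in> Zp"
  shows "pp * z \<noteq> 1"
proof
  assume *: "pp * z = 1"
  obtain x :: "'p padic_int" where "z = to_fract x" using assms unfolding Zp_def by blast
  with * have "to_fract (of_nat CARD('p) * x) = to_fract 1" unfolding pp_eq by simp
  then have "of_nat CARD('p) * x = 1" by (simp only: to_fract_eq_iff)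
  then have "Rep_padic_int (of_nat CARD('p) * x) 1 = Rep_padic_int (1 :: 'p padic_int) 1" by simp
  then have "1 mod int CARD('p) = 0"
    unfolding times_padic_int.rep_eq Rep_padic_int_of_nat one_padic_int.rep_eq by simp
  moreover have "int CARD('p) > 1" using prime_gt_1_int[OF prime_card_int[where 'a='p]] .
  ultimately show False by simp
qed

text \<open>The clause \<open>u \<noteq> 0\<close> excludes 0, whose inverse is 0 and therefore lies
  in \<open>Zp\<close>.\<close>

definition Zp_unit :: "'p::prime_card padic \<Rightarrow> bool"
  where "Zp_unit u \<longleftrightarrow> u \<noteq> 0 \<and> u \<in> Zp \<and> inverse u \<in> Zp"

lemma Zp_unit_one [simp]: "Zp_unit 1"
  by (simp add: Zp_unit_def)

lemma Zp_unit_mult: "Zp_unit u \<Longrightarrow> Zp_unit v \<Longrightarrow> Zp_unit (u * v)"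
  by (simp add: Zp_unit_def)

lemma Zp_unit_inverse: "Zp_unit u \<Longrightarrow> Zp_unit (inverse u)"
  by (simp add: Zp_unit_def)

lemma pp_neq_0 [simp]: "(pp :: 'p::prime_card padic) \<noteq> 0"
  unfolding pp_eq to_fract_eq_0_iff
proof
  assume 0: "(of_nat CARD('p) :: 'p padic_int) = 0"
  have "Rep_padic_int (of_nat CARD('p) :: 'p padic_int) 2 = int CARD('p)"
    unfolding Rep_padic_int_of_nat
    using prime_gt_1_int[OF prime_card_int[where 'a='p]]
    by (intro mod_pos_pos_trivial) (simp_all add: power2_eq_square)
  with 0 show False by (simp add: zero_padic_int.rep_eq)
qed

lemma padic_decomposition:
  fixes c :: "'p::prime_card padic"
  assumes "c \<noteq> 0"
  obtains k u where "c = pp powi k * u" "Zp_unit u"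
proof -
  have unit: "Zp_unit (to_fract u)" if "u dvd 1" for u :: "'p padic_int"
  proof -
    obtain v where "1 = u * v" using \<open>u dvd 1\<close> unfolding dvd_def by blast
    then have *: "to_fract u * to_fract v = 1" by (metis to_fract_mult to_fract_1)
    then have "inverse (to_fract u) = to_fract v" by (rule inverse_unique)
    with * show ?thesis unfolding Zp_unit_def Zp_def by auto
  qed
  have dec: "\<exists>m u. to_fract x = pp ^ m * u \<and> Zp_unit u" if "x \<noteq> 0" for x :: "'p padic_int"
  proof -
    obtain m u where mu: "x = of_nat CARD('p) ^ m * u" "u dvd 1"
      using padic_int_decomposition[OF \<open>x \<noteq> 0\<close>] .
    have "to_fract (y ^ m) = to_fract y ^ m" for y :: "'p padic_int" by (induction m) auto
    then show ?thesis
      using mu unit[OF mu(2)] by (intro exI[of _ m] exI[of _ "to_fract u"]) (simp add: pp_eq)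
  qed
  obtain x y :: "'p padic_int" where c: "c = to_fract x / to_fract y" "y \<noteq> 0"
    by (cases c) (auto simp: Fract_conv_to_fract)
  with assms have "x \<noteq> 0" by auto
  obtain m u where mu: "to_fract x = pp ^ m * u" "Zp_unit u" using dec[OF \<open>x \<noteq> 0\<close>] by blast
  obtain l v where lv: "to_fract y = pp ^ l * v" "Zp_unit v" using dec[OF \<open>y \<noteq> 0\<close>] by blast
  show thesis
  proof (rule that)
    show "Zp_unit (u * inverse v)" using mu lv by (intro Zp_unit_mult Zp_unit_inverse)
    show "c = pp powi (int m - int l) * (u * inverse v)"
      unfolding c mu lv by (simp add: power_int_diff field_simps)
  qed
qed

text \<open>For k < 0, dividing by u and multiplying by p^(-k-1) would put p^(-1) into
  \<open>Zp\<close>.\<close>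

lemma Zp_unit_powi_pp:
  fixes u :: "'p::prime_card padic"
  assumes "pp powi k * u \<in> Zp" "Zp_unit u"
  shows "k \<ge> 0"
proof (rule ccontr)
  assume k: "\<not> k \<ge> 0"
  have "(pp powi k :: 'p padic) \<in> Zp"
  proof -
    have "pp powi k * u * inverse u \<in> Zp"
      by (rule Zp_closed(4)) (use assms in \<open>simp_all add: Zp_unit_def\<close>)
    moreover have "pp powi k * u * inverse u = pp powi k"
      using assms(2) by (simp add: Zp_unit_def)
    ultimately show ?thesis by simp
  qed
  moreover have "(pp ^ nat (- k - 1) :: 'p padic) \<in> Zp" by auto
  ultimately have "(pp powi k * pp ^ nat (- k - 1) :: 'p padic) \<in> Zp" by auto
  also have "(pp powi k * pp ^ nat (- k - 1) :: 'p padic) = pp powi (k + int (nat (- k - 1)))"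
    unfolding power_int_add[OF disjI1[OF pp_neq_0]] power_int_of_nat ..
  also have "k + int (nat (- k - 1)) = - 1" using k by simp
  finally show False using pp_mult_neq_one[of "pp powi (-1) :: 'p padic"] by (simp add: power_int_minus)
qed

text \<open>The valuation of 0 is left unspecified.\<close>

definition ord :: "'p::prime_card padic \<Rightarrow> int"
  where "ord c = (THE k. \<exists>u. Zp_unit u \<and> c = pp powi k * u)"

lemma ord_eqI:
  assumes "Zp_unit u"
  shows "ord (pp powi k * u) = k"
  unfolding ord_def
proof (rule the_equality)
  show "\<exists>v. Zp_unit v \<and> pp powi k * u = pp powi k * v" using assms by blast
next
  fix l assume "\<exists>v. Zp_unit v \<and> pp powi k * u = pp powi l * v"
  then obtain v where v: "Zp_unit v" and eq: "pp powi k * u = pp powi l * v" by blast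
  have "u \<noteq> 0" "v \<noteq> 0" using v assms by (auto simp: Zp_unit_def)
  then have 1: "pp powi (k - l) * (u * inverse v) = 1"
    and 2: "pp powi (l - k) * (v * inverse u) = 1"
    using eq by (simp_all add: power_int_diff field_simps)
  have "k - l \<ge> 0" "l - k \<ge> 0"
    using Zp_unit_powi_pp[of "k - l" "u * inverse v"] Zp_unit_powi_pp[of "l - k" "v * inverse u"]
      assms v by (simp_all only: 1 2 Zp_unit_mult Zp_unit_inverse Zp_closed)
  then show "l = k" by simp
qed

lemma ord_decomposition:
  assumes "c \<noteq> 0"
  obtains u where "c = pp powi ord c * u" "Zp_unit u"
  using padic_decomposition[OF assms] ord_eqI by metis

lemma ord_powi_pp [simp]: "ord (pp powi k) = k"
  using ord_eqI[of 1 k] by simp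

lemma ord_one [simp]: "ord 1 = 0"
  using ord_powi_pp[of 0] by simp

lemma ord_mult: "c \<noteq> 0 \<Longrightarrow> d \<noteq> 0 \<Longrightarrow> ord (c * d) = ord c + ord d"
proof -
  assume "c \<noteq> 0" "d \<noteq> 0"
  then obtain u v where uv: "c = pp powi ord c * u" "Zp_unit u" "d = pp powi ord d * v" "Zp_unit v"
    using ord_decomposition by metis
  have "c * d = pp powi (ord c + ord d) * (u * v)"
    by (subst uv(1), subst uv(3)) (simp add: power_int_add)
  then show ?thesis using ord_eqI[OF Zp_unit_mult[OF uv(2,4)]] by metis
qed

lemma ord_inverse: "c \<noteq> 0 \<Longrightarrow> ord (inverse c) = - ord c"
  using ord_mult[of c "inverse c"] by simp

lemma ord_divide: "c \<noteq> 0 \<Longrightarrow> d \<noteq> 0 \<Longrightarrow> ord (c / d) = ord c - ord d"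
  by (simp add: divide_inverse ord_mult ord_inverse)

lemma ord_uminus [simp]: "ord (- c) = ord c"
proof (cases "c = 0")
  case False
  have u: "Zp_unit (- 1)" unfolding Zp_unit_def by simp
  have "ord (- 1) = 0" using ord_eqI[OF u, of 0] by simp
  then show ?thesis using ord_mult[of "- 1" c] False by simp
qed simp

lemma powi_pp_in_Zp: "k \<ge> 0 \<Longrightarrow> pp powi k \<in> Zp"
  by (simp add: power_int_def)

lemma Zp_iff_ord: "c \<in> Zp \<longleftrightarrow> c = 0 \<or> ord c \<ge> 0"
proof (cases "c = 0")
  case False
  obtain u where u: "c = pp powi ord c * u" "Zp_unit u" using ord_decomposition[OF False] .
  show ?thesis
  proof
    assume "c \<in> Zp"
    then show "c = 0 \<or> ord c \<ge> 0" using u Zp_unit_powi_pp by metis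
  next
    assume "c = 0 \<or> ord c \<ge> 0"
    then have "pp powi ord c * u \<in> Zp"
      using u(2) False by (intro Zp_closed(4)) (auto simp: Zp_unit_def powi_pp_in_Zp)
    then show "c \<in> Zp" using u(1) by simp
  qed
qed simp

text \<open>
  Twice the valuation is used, because the norms attached to p-elementary lattices below take
  half-integral values.
\<close>

definition vge :: "int \<Rightarrow> 'p::prime_card padic \<Rightarrow> bool"
  where "vge m c \<longleftrightarrow> c = 0 \<or> m \<le> 2 * ord c"

lemma vge_zero [simp]: "vge m 0"
  by (simp add: vge_def)

lemma Zp_iff_vge: "c \<in> Zp \<longleftrightarrow> vge 0 c"
  by (auto simp: Zp_iff_ord vge_def)

lemma vge_mult: "vge m c \<Longrightarrow> vge l d \<Longrightarrow> vge (m + l) (c * d)"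
  by (cases "c = 0 \<or> d = 0") (auto simp: vge_def ord_mult)

lemma vge_mult_powi: "vge m (pp powi k * c) \<longleftrightarrow> vge (m - 2 * k) c"
  by (cases "c = 0") (auto simp: vge_def ord_mult)

lemma vge_mult_powi_right: "vge m (c * pp powi k) \<longleftrightarrow> vge (m - 2 * k) c"
  by (simp add: mult.commute[of c] vge_mult_powi)

lemma vge_mono: "vge m c \<Longrightarrow> l \<le> m \<Longrightarrow> vge l c"
  by (auto simp: vge_def)

lemma vge_add: "vge m c \<Longrightarrow> vge m d \<Longrightarrow> vge m (c + d)"
proof -
  assume "vge m c" "vge m d"
  \<comment> \<open>This is m / 2 rounded up: \<open>vge m x\<close> says that p^(-k) x is integral,
    and the ultrametric inequality becomes the closure of \<open>Zp\<close> under addition.\<close>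
  define k where "k = (m + 1) div 2"
  have iff: "vge m x \<longleftrightarrow> pp powi (- k) * x \<in> Zp" for x
    unfolding Zp_iff_vge vge_mult_powi by (auto simp: vge_def k_def)
  from \<open>vge m c\<close> \<open>vge m d\<close> show ?thesis unfolding iff distrib_left by auto
qed

lemma vge_uminus: "vge m (- c) \<longleftrightarrow> vge m c"
  by (simp add: vge_def)

lemma vge_diff: "vge m c \<Longrightarrow> vge m d \<Longrightarrow> vge m (c - d)"
  using vge_add[of m c "- d"] by (simp add: vge_uminus)

lemma vge_sum: "(\<And>i. i \<in> I \<Longrightarrow> vge m (c i)) \<Longrightarrow> vge m (sum c I)"
  by (induction I rule: infinite_finite_induct) (auto intro: vge_add)

lemma Zp_sum [intro]: "(\<And>i. i \<in> I \<Longrightarrow> c i \<in> Zp) \<Longrightarrow> sum c I \<in> Zp"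
  unfolding Zp_iff_vge by (rule vge_sum)

lemma common_denominator:
  fixes c :: "'i \<Rightarrow> 'p::prime_card padic"
  assumes "finite I"
  obtains m where "\<And>i. i \<in> I \<Longrightarrow> pp powi m * c i \<in> Zp"
proof -
  have "\<exists>m\<ge>0. \<forall>i\<in>I. pp powi m * c i \<in> Zp"
    using assms
  proof (induction I)
    case (insert j I)
    then obtain m where m: "m \<ge> 0" "\<forall>i\<in>I. pp powi m * c i \<in> Zp" by blast
    define l where "l = max m (- ord (c j))"
    have "pp powi l * c i \<in> Zp" if "i \<in> insert j I" for i
      using that m unfolding Zp_iff_vge vge_mult_powi
      by (fastforce simp: vge_def l_def)
    moreover have "l \<ge> 0" using m by (simp add: l_def)
    ultimately show ?case by blast
  qed (auto intro: exI[of _ 0])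
  then show thesis using that by blast
qed

section \<open>The parameters are determined by the elementary divisors\<close>

text \<open>The multiplicity of k is the difference of the counting functions at k and k - 1. These
  counting functions are what the comparison of elementary divisors bounds.\<close>

lemma mset_eqI_card_le:
  fixes cs ds :: "int list"
  assumes "\<And>k. card {i. i < length cs \<and> cs ! i \<le> k} = card {i. i < length ds \<and> ds ! i \<le> k}"
  shows "mset cs = mset ds"
proof (rule multiset_eqI)
  fix k
  have "count (mset xs) k + card {i. i < length xs \<and> xs ! i \<le> k - 1} = card {i. i < length xs \<and> xs ! i \<le> k}"
    for xs :: "int list"
  proof -
    have "count (mset xs) k = card {i. i < length xs \<and> xs ! i = k}"
      by (simp add: count_mset count_list_eq_length_filter length_filter_conv_card eq_commute)
    moreover have "{i. i < length xs \<and> xs ! i \<le> k} =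
        {i. i < length xs \<and> xs ! i = k} \<union> {i. i < length xs \<and> xs ! i \<le> k - 1}"
      by auto
    moreover have "card ({i. i < length xs \<and> xs ! i = k} \<union> {i. i < length xs \<and> xs ! i \<le> k - 1}) =
        card {i. i < length xs \<and> xs ! i = k} + card {i. i < length xs \<and> xs ! i \<le> k - 1}"
      by (rule card_Un_disjoint) auto
    ultimately show ?thesis by simp
  qed
  from this[of cs] this[of ds] assms[of k] assms[of "k - 1"] show "count (mset cs) k = count (mset ds) k"
    by simp
qed

lemma count_image_mset_inv:
  assumes "\<And>x. g (h x) = x" "\<And>x. h (g x) = x"
  shows "count (image_mset g M) k = count M (h k)"
proof -
  have "g -` {k} = {h k}" using assms by auto
  then show ?thesis by (cases "h k \<in># M") (auto simp: count_image_mset not_in_iff)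
qed

lemma ex_int_fresh:
  fixes M :: "int multiset"
  shows "\<exists>k\<ge>l. \<forall>j\<ge>k. count M j = 0"
proof (intro exI conjI allI impI)
  show "max l (Max (insert 0 (set_mset M)) + 1) \<ge> l" by simp
  fix j assume j: "j \<ge> max l (Max (insert 0 (set_mset M)) + 1)"
  show "count M j = 0"
  proof (rule ccontr)
    assume "count M j \<noteq> 0"
    then have "j \<in># M" by (simp add: not_in_iff[symmetric])
    then have "j \<le> Max (insert 0 (set_mset M))" by (intro Max_ge) auto
    with j show False by simp
  qed
qed

lemma int_constant_from:
  fixes h :: "int \<Rightarrow> 'a"
  assumes "\<And>k. k \<ge> l \<Longrightarrow> h k = h (k + 1)" "l \<le> i" "i \<le> j"
  shows "h i = h j"
  using assms(3)
proof (induction j rule: int_ge_induct)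
  case (step j)
  then show ?case using assms(1)[of j] assms(2) by simp
qed simp

text \<open>Let h be the difference of the multiplicities in \<open>Y\<close> and \<open>Y'\<close>.
  At k + 1 the two equations express the same difference of \<open>X'\<close> and \<open>X\<close>,
  once as h (k + 1) and once as h k. So h is constant, and it vanishes far out because multisets are
  finite.\<close>

lemma mset_eq_if_shift_eq:
  fixes X Y X' Y' :: "int multiset"
  assumes 1: "X + Y = X' + Y'"
    and 2: "X + image_mset (\<lambda>k. k + 1) Y = X' + image_mset (\<lambda>k. k + 1) Y'"
  shows "X = X'" "Y = Y'"
proof -
  have sh: "count (image_mset (\<lambda>k. k + 1) M) k = count M (k - 1)" for M :: "int multiset" and k
    by (rule count_image_mset_inv) simp_all
  define h where "h k = int (count Y k) - int (count Y' k)" for k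
  have h: "h k = h (k + 1)" for k
    using arg_cong[OF 1, of "\<lambda>M. count M (k + 1)"] arg_cong[OF 2, of "\<lambda>M. count M (k + 1)"]
    by (simp add: h_def sh)
  show "Y = Y'"
  proof (rule multiset_eqI)
    fix k
    obtain j where "j \<ge> k" and j: "count (Y + Y') j = 0" using ex_int_fresh[of k "Y + Y'"] by blast
    from j have "h j = 0" by (simp add: h_def)
    with int_constant_from[of k h, OF h order_refl \<open>j \<ge> k\<close>] have "h k = 0" by simp
    then show "count Y k = count Y' k" by (simp add: h_def)
  qed
  with 1 show "X = X'" by simp
qed

text \<open>For k \<ge> 1 the left side has at k the multiplicity of k in \<open>A\<close> plus that
  of k in \<open>B\<close>, and at -k that of k in \<open>A\<close> plus that of k + 1 in
  \<open>B\<close>. Subtracting removes \<open>A\<close>, so the difference between \<open>B\<close>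
  and \<open>B'\<close> is constant from 1 on and hence 0. The lower bounds 0 and 1 single out one
  member of each pair.\<close>

lemma mset_eq_if_pairs_eq:
  fixes A B A' B' :: "int multiset"
  assumes eq: "A + B + image_mset uminus A + image_mset (\<lambda>k. 1 - k) B =
      A' + B' + image_mset uminus A' + image_mset (\<lambda>k. 1 - k) B'"
    and A: "\<forall>k\<in>#A. 0 \<le> k" "\<forall>k\<in>#A'. 0 \<le> k" and B: "\<forall>k\<in>#B. 1 \<le> k" "\<forall>k\<in>#B'. 1 \<le> k"
  shows "A = A'" "B = B'"
proof -
  have neg: "count (image_mset uminus M) k = count M (- k)" for M :: "int multiset" and k
    by (rule count_image_mset_inv) simp_all
  have rev: "count (image_mset (\<lambda>k. 1 - k) M) k = count M (1 - k)" for M :: "int multiset" and k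
    by (rule count_image_mset_inv) simp_all
  have A0: "count A k = 0" "count A' k = 0" if "k < 0" for k
    using A that by (auto simp: not_in_iff[symmetric])
  have B0: "count B k = 0" "count B' k = 0" if "k < 1" for k
    using B that by (auto simp: not_in_iff[symmetric])
  have count: "count A k + count B k + count A (- k) + count B (1 - k) =
      count A' k + count B' k + count A' (- k) + count B' (1 - k)" for k
    using arg_cong[OF eq, of "\<lambda>M. count M k"] by (simp add: neg rev)
  define h where "h k = int (count B k) - int (count B' k)" for k
  have h: "h k = h (k + 1)" if "k \<ge> 1" for k
    using count[of k] count[of "- k"] that by (simp add: h_def A0 B0 add.commute[of 1 k])
  have hB: "count B k = count B' k" for k
  proof (cases "k \<ge> 1")
    case True
    obtain j where "j \<ge> k" and j: "count (B + B') j = 0" using ex_int_fresh[of k "B + B'"] by blast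
    from j have "h j = 0" by (simp add: h_def)
    with int_constant_from[of 1 h, OF h True \<open>j \<ge> k\<close>] have "h k = 0" by simp
    then show ?thesis by (simp add: h_def)
  qed (simp add: B0)
  then show "B = B'" by (rule multiset_eqI)
  show "A = A'"
  proof (rule multiset_eqI)
    fix k
    show "count A k = count A' k"
      using count[of k] hB by (cases "k = 0"; cases "k > 0") (simp_all add: A0 B0)
  qed
qed

text \<open>The exponents of the \<open>f i\<close> in \<open>rep_lattice\<close>, those of the
  \<open>e i\<close> being the entries of \<mu>. The sum of \<open>std a i\<close>, \<mu>_i and
  \<open>nu\<close> is the type of the i-th plane in L: 0 if unimodular, 1 if p-modular.\<close>

definition nu :: "nat \<Rightarrow> nat \<times> nat \<times> int list \<Rightarrow> nat \<Rightarrow> int"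
  where "nu a = (\<lambda>(rm, rp, \<mu>) i. if i < rm then - \<mu> ! i + 1 else if i < a then - \<mu> ! i
    else if i < a + rp then - \<mu> ! i - 1 else - \<mu> ! i)"

text \<open>The exponent of p in the pairing of the i-th basis pair of a lattice with a unimodular
  planes followed by p-modular ones.\<close>

definition std :: "nat \<Rightarrow> nat \<Rightarrow> int"
  where "std a i = (if i < a then 0 else 1)"

text \<open>
  The four blocks: \<Lambda> unimodular and L p-modular, both unimodular, \<Lambda> p-modular and
  L unimodular, both p-modular.
\<close>

definition blocks :: "int list \<Rightarrow> int list \<Rightarrow> int list \<Rightarrow> int list \<Rightarrow> nat \<times> nat \<times> int list"
  where "blocks mB mA mC mE = (length mB, length mC, mB @ mA @ mC @ mE)"

definition sorted_ge :: "int \<Rightarrow> int list \<Rightarrow> bool"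
  where "sorted_ge c xs \<longleftrightarrow> sorted xs \<and> (\<forall>x\<in>set xs. c \<le> x)"

lemma sorted_ge_unique:
  "sorted_ge c xs \<Longrightarrow> sorted_ge c ys \<Longrightarrow> mset xs = mset ys \<Longrightarrow> xs = ys"
  unfolding sorted_ge_def by (metis properties_for_sort)

lemma ascending_from_iff_sorted_ge:
  assumes "l + length ys = h" "\<And>i. i < length ys \<Longrightarrow> \<mu> ! (l + i) = ys ! i"
  shows "ascending_from c \<mu> l h \<longleftrightarrow> sorted_ge c ys"
proof -
  have img: "{l..<h} = (+) l ` {..<length ys}"
    using assms(1) by (simp add: lessThan_atLeast0 add.commute)
  have "(\<forall>i\<in>{l..<h}. c \<le> \<mu> ! i) \<longleftrightarrow> (\<forall>x\<in>set ys. c \<le> x)"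
    unfolding img by (auto simp: assms(2) all_set_conv_all_nth)
  moreover have "mono_on {l..<h} ((!) \<mu>) \<longleftrightarrow> sorted ys"
  proof -
    have "mono_on {l..<h} ((!) \<mu>) \<longleftrightarrow> (\<forall>i<length ys. \<forall>j<length ys. i \<le> j \<longrightarrow> ys ! i \<le> ys ! j)"
      unfolding img monotone_on_def by (auto simp: assms(2))
    also have "\<dots> \<longleftrightarrow> sorted ys"
      unfolding sorted_iff_nth_mono by (meson le_less_trans)
    finally show ?thesis .
  qed
  ultimately show ?thesis unfolding ascending_from_def sorted_ge_def by blast
qed

text \<open>The conditions on r_+ and r_- become the row and column sums of a 2 x 2 table of block
  lengths: rows for the type of a plane in \<Lambda>, columns for its type in L.\<close>

lemma params_iff_blocks:
  assumes "a + b = n"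
  shows "t \<in> params n a b a' b' \<longleftrightarrow> (\<exists>mB mA mC mE. t = blocks mB mA mC mE \<and>
    length mB + length mA = a \<and> length mC + length mE = b \<and>
    length mA + length mC = a' \<and> length mB + length mE = b' \<and>
    sorted_ge 1 mB \<and> sorted_ge 0 mA \<and> sorted_ge 0 mC \<and> sorted_ge 0 mE)" (is "_ \<longleftrightarrow> ?rhs")
proof -
  have asc: "ascending_from 1 (mB @ mA @ mC @ mE) 0 (length mB) \<longleftrightarrow> sorted_ge 1 mB"
    "ascending_from 0 (mB @ mA @ mC @ mE) (length mB) a \<longleftrightarrow> sorted_ge 0 mA"
    "ascending_from 0 (mB @ mA @ mC @ mE) a (a + length mC) \<longleftrightarrow> sorted_ge 0 mC"
    "ascending_from 0 (mB @ mA @ mC @ mE) (a + length mC) n \<longleftrightarrow> sorted_ge 0 mE"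
    if "length mB + length mA = a" "length mC + length mE = b" for mB mA mC mE
    by (rule ascending_from_iff_sorted_ge; use that assms in \<open>auto simp: nth_append\<close>)+
  show ?thesis
  proof
    assume t: "t \<in> params n a b a' b'"
    obtain rm rp \<mu> where t_eq: "t = (rm, rp, \<mu>)" by (cases t)
    have len: "length \<mu> = n" and rm: "rm \<le> a" and rp: "rp \<le> b"
      and a': "b' + rp = b + rm" "a' + rm = a + rp"
      and asc': "ascending_from 1 \<mu> 0 rm" "ascending_from 0 \<mu> rm a"
        "ascending_from 0 \<mu> a (a + rp)" "ascending_from 0 \<mu> (a + rp) n"
      using t unfolding t_eq params_def by auto
    define mB mA mC mE where "mB = take rm \<mu>" and "mA = take (a - rm) (drop rm \<mu>)"
      and "mC = take rp (drop a \<mu>)" and "mE = drop (a + rp) \<mu>"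
    have l: "length mB = rm" "length mA = a - rm" "length mC = rp" "length mE = b - rp"
      using len rm rp assms by (auto simp: mB_def mA_def mC_def mE_def)
    have \<mu>: "\<mu> = mB @ mA @ mC @ mE"
    proof -
      have "mC @ mE = drop a \<mu>"
        unfolding mC_def mE_def by (metis add.commute append_take_drop_id drop_drop)
      moreover have "mA @ drop a \<mu> = drop rm \<mu>"
        unfolding mA_def using rm by (metis append_take_drop_id drop_drop le_add_diff_inverse2)
      ultimately show ?thesis unfolding mB_def by simp
    qed
    have l2: "length mB + length mA = a" "length mC + length mE = b" using l rm rp by auto
    have l3: "length mA + length mC = a'" "length mB + length mE = b'" using l a' rm rp by arith+
    have "t = blocks mB mA mC mE \<and> length mB + length mA = a \<and> length mC + length mE = b \<and>
        length mA + length mC = a' \<and> length mB + length mE = b' \<and>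
        sorted_ge 1 mB \<and> sorted_ge 0 mA \<and> sorted_ge 0 mC \<and> sorted_ge 0 mE"
      using asc'[unfolded \<mu> l(1,3)[symmetric]] asc[OF l2] l(1,3) l2 l3 t_eq \<mu>
      by (simp add: blocks_def)
    then show ?rhs by blast
  next
    assume ?rhs
    then obtain mB mA mC mE where t: "t = blocks mB mA mC mE"
      and l: "length mB + length mA = a" "length mC + length mE = b"
        "length mA + length mC = a'" "length mB + length mE = b'"
      and s: "sorted_ge 1 mB" "sorted_ge 0 mA" "sorted_ge 0 mC" "sorted_ge 0 mE" by blast
    show "t \<in> params n a b a' b'"
      unfolding t blocks_def params_def using asc[OF l(1,2)] l s assms by simp
  qed
qed

lemma nu_blocks:
  assumes "length mB + length mA = a" "length mC + length mE = b" "a + b = n"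
  shows "map (nu a (blocks mB mA mC mE)) [0..<n] =
      map (\<lambda>k. 1 - k) mB @ map uminus mA @ map (\<lambda>k. - 1 - k) mC @ map uminus mE"
    and "map (\<lambda>i. (mB @ mA @ mC @ mE) ! i) [0..<n] = mB @ mA @ mC @ mE"
    and "map (\<lambda>i. nu a (blocks mB mA mC mE) i + std a i) [0..<n] =
      map (\<lambda>k. 1 - k) mB @ map uminus mA @ map uminus mC @ map (\<lambda>k. 1 - k) mE"
    and "map (\<lambda>i. (mB @ mA @ mC @ mE) ! i + std a i) [0..<n] = mB @ mA @ map (\<lambda>k. k + 1) mC @ map (\<lambda>k. k + 1) mE"
  using assms
  by (auto intro!: nth_equalityI simp: nth_append nu_def blocks_def std_def)

definition exponents :: "nat \<Rightarrow> nat \<Rightarrow> nat \<times> nat \<times> int list \<Rightarrow> int list"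
  where "exponents n a t = map ((!) (snd (snd t))) [0..<n] @ map (nu a t) [0..<n]"

text \<open>The dual of \<Lambda> has the basis of \<Lambda> scaled by p^(-\<open>std a i\<close>),
  so relative to it every exponent grows by \<open>std a i\<close>.\<close>

definition dual_exponents :: "nat \<Rightarrow> nat \<Rightarrow> nat \<times> nat \<times> int list \<Rightarrow> int list"
  where "dual_exponents n a t =
    map (\<lambda>i. snd (snd t) ! i + std a i) [0..<n] @ map (\<lambda>i. nu a t i + std a i) [0..<n]"

theorem params_unique:
  assumes "a + b = n" "t \<in> params n a b a' b'" "t' \<in> params n a b c' d'"
    and 1: "mset (exponents n a t) = mset (exponents n a t')"
    and 2: "mset (dual_exponents n a t) = mset (dual_exponents n a t')"
  shows "t = t'"
proof -
  obtain mB mA mC mE where t: "t = blocks mB mA mC mE"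
    and l: "length mB + length mA = a" "length mC + length mE = b"
    and s: "sorted_ge 1 mB" "sorted_ge 0 mA" "sorted_ge 0 mC" "sorted_ge 0 mE"
    using assms(2) unfolding params_iff_blocks[OF assms(1)] by blast
  obtain mB' mA' mC' mE' where t': "t' = blocks mB' mA' mC' mE'"
    and l': "length mB' + length mA' = a" "length mC' + length mE' = b"
    and s': "sorted_ge 1 mB'" "sorted_ge 0 mA'" "sorted_ge 0 mC'" "sorted_ge 0 mE'"
    using assms(3) unfolding params_iff_blocks[OF assms(1)] by blast
  have snd: "snd (snd (blocks xs ys zs ws)) = xs @ ys @ zs @ ws" for xs ys zs ws
    by (simp add: blocks_def)
  define X where "X A B = mset A + mset B + image_mset uminus (mset A) + image_mset (\<lambda>k. 1 - k) (mset B)"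
    for A B :: "int list"
  define Y where "Y C E = mset C + mset E + image_mset uminus (mset E) + image_mset (\<lambda>k. - 1 - k) (mset C)"
    for C E :: "int list"
  have "X mA mB + Y mC mE = X mA' mB' + Y mC' mE'"
    using 1 unfolding exponents_def t t' snd nu_blocks[OF l assms(1)] nu_blocks[OF l' assms(1)] X_def Y_def
    by (simp add: ac_simps)
  moreover have "X mA mB + image_mset (\<lambda>k. k + 1) (Y mC mE) = X mA' mB' + image_mset (\<lambda>k. k + 1) (Y mC' mE')"
    using 2 unfolding dual_exponents_def t t' snd nu_blocks[OF l assms(1)] nu_blocks[OF l' assms(1)] X_def Y_def
    by (simp add: ac_simps multiset.map_comp o_def)
  ultimately have XX: "X mA mB = X mA' mB'" and YY: "Y mC mE = Y mC' mE'"
    by (rule mset_eq_if_shift_eq)+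
  have AB: "mset mA = mset mA'" "mset mB = mset mB'"
    using s s' by (auto intro!: mset_eq_if_pairs_eq[OF XX[unfolded X_def]] simp: sorted_ge_def)
  let ?s = "image_mset (\<lambda>k::int. k + 1)"
  \<comment> \<open>\<open>Y\<close> consists of pairs {k, -k} from \<open>E\<close> and {k, -1 - k}
    from \<open>C\<close>. Negation turns the latter into {k + 1, 1 - (k + 1)}, so after the shift
    of \<open>C\<close> the lemma on pairs applies with bounds 0 and 1.\<close>
  have neg_Y: "image_mset uminus (Y C E) = mset E + ?s (mset C) + image_mset uminus (mset E) +
      image_mset (\<lambda>k. 1 - k) (?s (mset C))" for C E
    by (simp add: Y_def multiset.map_comp o_def ac_simps)
  have "mset mE = mset mE'" "?s (mset mC) = ?s (mset mC')"
    using s s' by (auto intro!: mset_eq_if_pairs_eq[OF arg_cong[OF YY, of "image_mset uminus", unfolded neg_Y]]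
        simp: sorted_ge_def)
  moreover have "mset C = mset C'" if "?s (mset C) = ?s (mset C')" for C C'
    using arg_cong[OF that, of "image_mset (\<lambda>k. k - 1)"] by (simp add: multiset.map_comp o_def)
  ultimately have "mset mE = mset mE'" "mset mC = mset mC'" by blast+
  with AB s s' have "mA = mA'" "mB = mB'" "mC = mC'" "mE = mE'" by (metis sorted_ge_unique)+
  then show ?thesis unfolding t t' by simp
qed

section \<open>Symplectic frames and the lattices they span\<close>

text \<open>Weaker than \<open>symplectic_space\<close>, so as to cover also the polynomials that
  later model the column space and on which the form is degenerate. Where non-degeneracy matters,
  the span of a frame stands in for the whole space.\<close>

locale alternating_space = vector_space scale
  for scale :: "'p::prime_card padic \<Rightarrow> 'v::ab_group_add \<Rightarrow> 'v" +
  fixes form :: "'v \<Rightarrow> 'v \<Rightarrow> 'p padic"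
  assumes form_add_left: "form (u + v) w = form u w + form v w"
    and form_add_right: "form u (v + w) = form u v + form u w"
    and form_scale_left: "form (scale c u) v = c * form u v"
    and form_scale_right: "form u (scale c v) = c * form u v"
    and form_self [simp]: "form v v = 0"
begin

lemma form_swap: "form v u = - form u v"
proof -
  have "form (u + v) (u + v) = form u v + form v u"
    unfolding form_add_left form_add_right by simp
  then show ?thesis by (simp add: eq_neg_iff_add_eq_0 add.commute)
qed

lemma form_zero [simp]: "form 0 v = 0" "form v 0 = 0"
  using form_scale_left[of 0 0 v] form_scale_right[of v 0 0] by simp_all

lemma form_uminus: "form (- u) v = - form u v" "form u (- v) = - form u v"
  using form_scale_left[of "- 1" u v] form_scale_right[of u "- 1" v] by simp_all

lemma form_diff: "form (u - v) w = form u w - form v w" "form w (u - v) = form w u - form w v"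
  using form_add_left[of u "- v" w] form_add_right[of w u "- v"] by (simp_all add: form_uminus)

lemma form_sum: "form (sum g I) v = (\<Sum>i\<in>I. form (g i) v)" "form v (sum g I) = (\<Sum>i\<in>I. form v (g i))"
  by (induction I rule: infinite_finite_induct) (simp_all add: form_add_left form_add_right)

abbreviation scaled :: "(nat \<Rightarrow> int) \<Rightarrow> (nat \<Rightarrow> 'v) \<Rightarrow> nat \<Rightarrow> 'v"
  where "scaled \<mu> e \<equiv> \<lambda>i. scale (pp powi \<mu> i) (e i)"

text \<open>A symplectic basis up to powers of p; its linear independence follows from the Gram
  matrix.\<close>

definition frame :: "nat \<Rightarrow> (nat \<Rightarrow> 'v) \<Rightarrow> (nat \<Rightarrow> 'v) \<Rightarrow> (nat \<Rightarrow> int) \<Rightarrow> bool"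
  where "frame n e f \<epsilon> \<longleftrightarrow> (\<forall>i<n. \<forall>j<n. form (e i) (e j) = 0 \<and> form (f i) (f j) = 0 \<and>
    form (e i) (f j) = (if i = j then pp powi \<epsilon> i else 0))"

definition comb :: "nat \<Rightarrow> (nat \<Rightarrow> 'v) \<Rightarrow> (nat \<Rightarrow> 'v) \<Rightarrow> (nat \<Rightarrow> 'p padic) \<Rightarrow> (nat \<Rightarrow> 'p padic) \<Rightarrow> 'v"
  where "comb n e f c d = (\<Sum>i<n. scale (c i) (e i) + scale (d i) (f i))"

definition Qspan :: "nat \<Rightarrow> (nat \<Rightarrow> 'v) \<Rightarrow> (nat \<Rightarrow> 'v) \<Rightarrow> 'v set"
  where "Qspan n e f = {comb n e f c d |c d. True}"

definition Zspan :: "nat \<Rightarrow> (nat \<Rightarrow> 'v) \<Rightarrow> (nat \<Rightarrow> 'v) \<Rightarrow> 'v set"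
  where "Zspan n e f = {comb n e f c d |c d. \<forall>i<n. c i \<in> Zp \<and> d i \<in> Zp}"

lemma comb_cong:
  "(\<And>i. i < n \<Longrightarrow> scale (c i) (e i) = scale (c' i) (e' i)) \<Longrightarrow>
   (\<And>i. i < n \<Longrightarrow> scale (d i) (f i) = scale (d' i) (f' i)) \<Longrightarrow>
   comb n e f c d = comb n e' f' c' d'"
  unfolding comb_def by (rule sum.cong) auto

lemma comb_add: "comb n e f c d + comb n e f c' d' = comb n e f (\<lambda>i. c i + c' i) (\<lambda>i. d i + d' i)"
  unfolding comb_def sum.distrib[symmetric] by (simp add: scale_left_distrib algebra_simps)

lemma comb_scale: "scale k (comb n e f c d) = comb n e f (\<lambda>i. k * c i) (\<lambda>i. k * d i)"
  unfolding comb_def scale_sum_right by (simp add: scale_right_distrib)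

lemma comb_zero: "comb n e f (\<lambda>_. 0) (\<lambda>_. 0) = 0"
  unfolding comb_def by simp

lemma comb_unit:
  assumes "j < n"
  shows "comb n e f (\<lambda>i. if i = j then 1 else 0) (\<lambda>_. 0) = e j"
    and "comb n e f (\<lambda>_. 0) (\<lambda>i. if i = j then 1 else 0) = f j"
proof -
  have 1: "scale (if i = j then 1 else 0) x = (if i = j then x else 0)" for i x by simp
  show "comb n e f (\<lambda>i. if i = j then 1 else 0) (\<lambda>_. 0) = e j"
    "comb n e f (\<lambda>_. 0) (\<lambda>i. if i = j then 1 else 0) = f j"
    unfolding comb_def 1 using assms by (simp_all add: sum.delta)
qed

lemma comb_in_Qspan [intro, simp]: "comb n e f c d \<in> Qspan n e f"
  unfolding Qspan_def by blast

lemma QspanE: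
  assumes "v \<in> Qspan n e f"
  obtains c d where "v = comb n e f c d"
  using assms unfolding Qspan_def by blast

lemma comb_in_Zspan: "(\<And>i. i < n \<Longrightarrow> c i \<in> Zp) \<Longrightarrow> (\<And>i. i < n \<Longrightarrow> d i \<in> Zp) \<Longrightarrow> comb n e f c d \<in> Zspan n e f"
  unfolding Zspan_def by blast

lemma ZspanE:
  assumes "v \<in> Zspan n e f"
  obtains c d where "v = comb n e f c d" "\<And>i. i < n \<Longrightarrow> c i \<in> Zp" "\<And>i. i < n \<Longrightarrow> d i \<in> Zp"
  using assms unfolding Zspan_def by blast

lemma subspace_Qspan: "subspace (Qspan n e f)"
proof (rule subspaceI)
  show "0 \<in> Qspan n e f" by (subst comb_zero[symmetric]) (rule comb_in_Qspan)
  show "u + v \<in> Qspan n e f" if "u \<in> Qspan n e f" "v \<in> Qspan n e f" for u v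
    using that by (elim QspanE) (simp add: comb_add)
  show "scale c v \<in> Qspan n e f" if "v \<in> Qspan n e f" for c v
    using that by (elim QspanE) (simp add: comb_scale)
qed

lemma basis_in_Qspan: "i < n \<Longrightarrow> e i \<in> Qspan n e f" "i < n \<Longrightarrow> f i \<in> Qspan n e f"
  using comb_unit[of i n e f] comb_in_Qspan[of n e f] by metis+

lemma basis_in_Zspan: "i < n \<Longrightarrow> e i \<in> Zspan n e f" "i < n \<Longrightarrow> f i \<in> Zspan n e f"
proof -
  assume "i < n"
  show "e i \<in> Zspan n e f" "f i \<in> Zspan n e f"
    by (subst comb_unit[OF \<open>i < n\<close>, symmetric], rule comb_in_Zspan; simp)+
qed

lemma Zspan_subset_Qspan: "Zspan n e f \<subseteq> Qspan n e f"
  unfolding Zspan_def Qspan_def by blast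

lemma Zspan_scale: "c \<in> Zp \<Longrightarrow> v \<in> Zspan n e f \<Longrightarrow> scale c v \<in> Zspan n e f"
  by (elim ZspanE) (simp add: comb_scale comb_in_Zspan)

lemma Zspan_add: "u \<in> Zspan n e f \<Longrightarrow> v \<in> Zspan n e f \<Longrightarrow> u + v \<in> Zspan n e f"
  by (elim ZspanE) (simp add: comb_add comb_in_Zspan)

lemma Zspan_zero [simp]: "0 \<in> Zspan n e f"
  by (subst comb_zero[symmetric]) (rule comb_in_Zspan; simp)

lemma Zspan_sum: "(\<And>i. i \<in> I \<Longrightarrow> g i \<in> Zspan n e f) \<Longrightarrow> sum g I \<in> Zspan n e f"
  by (induction I rule: infinite_finite_induct) (auto intro: Zspan_add)

lemma Zspan_subset:
  assumes "\<And>i. i < k \<Longrightarrow> x i \<in> Zspan n e f" "\<And>i. i < k \<Longrightarrow> y i \<in> Zspan n e f"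
  shows "Zspan k x y \<subseteq> Zspan n e f"
proof
  fix v assume "v \<in> Zspan k x y"
  then obtain c d where "v = comb k x y c d" "\<forall>i<k. c i \<in> Zp \<and> d i \<in> Zp"
    unfolding Zspan_def by blast
  then show "v \<in> Zspan n e f"
    unfolding comb_def by (auto intro!: Zspan_sum Zspan_add Zspan_scale assms)
qed

lemma Qspan_subset:
  assumes "subspace W" "\<And>i. i < n \<Longrightarrow> e i \<in> W" "\<And>i. i < n \<Longrightarrow> f i \<in> W"
  shows "Qspan n e f \<subseteq> W"
  unfolding Qspan_def comb_def using assms
  by (auto intro!: subspace_sum subspace_add subspace_scale)

lemma Qspan_scale:
  assumes "\<And>i. i < n \<Longrightarrow> c i \<noteq> 0" "\<And>i. i < n \<Longrightarrow> d i \<noteq> 0"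
  shows "Qspan n (\<lambda>i. scale (c i) (e i)) (\<lambda>i. scale (d i) (f i)) = Qspan n e f"
proof
  show "Qspan n (\<lambda>i. scale (c i) (e i)) (\<lambda>i. scale (d i) (f i)) \<subseteq> Qspan n e f"
    by (intro Qspan_subset subspace_Qspan subspace_scale[OF subspace_Qspan] basis_in_Qspan)
  have *: "x \<in> S" if "scale a x \<in> S" "subspace S" "a \<noteq> 0" for a x S
    using subspace_scale[OF that(2,1), of "inverse a"] that(3) by simp
  show "Qspan n e f \<subseteq> Qspan n (\<lambda>i. scale (c i) (e i)) (\<lambda>i. scale (d i) (f i))"
  proof (intro Qspan_subset subspace_Qspan)
    fix i assume i: "i < n"
    show "e i \<in> Qspan n (\<lambda>i. scale (c i) (e i)) (\<lambda>i. scale (d i) (f i))"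
      by (rule *[OF basis_in_Qspan(1)[OF i] subspace_Qspan]) (use assms i in blast)
    show "f i \<in> Qspan n (\<lambda>i. scale (c i) (e i)) (\<lambda>i. scale (d i) (f i))"
      by (rule *[OF basis_in_Qspan(2)[OF i] subspace_Qspan]) (use assms i in blast)
  qed
qed

lemma frameD:
  assumes "frame n e f \<epsilon>" "i < n" "j < n"
  shows "form (e i) (e j) = 0" "form (f i) (f j) = 0"
    "form (e i) (f j) = (if i = j then pp powi \<epsilon> i else 0)"
    "form (f i) (e j) = (if i = j then - (pp powi \<epsilon> i) else 0)"
  using assms form_swap[of "f i" "e j"] unfolding frame_def by auto

lemma frame_scale:
  assumes "frame n e f \<epsilon>"
  shows "frame n (scaled \<mu> e) (scaled \<nu> f)
    (\<lambda>i. \<epsilon> i + \<mu> i + \<nu> i)"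
  unfolding frame_def
proof (intro allI impI conjI)
  fix i j assume "i < n" "j < n"
  then show "form (scale (pp powi \<mu> i) (e i)) (scale (pp powi \<nu> j) (f j)) =
      (if i = j then pp powi (\<epsilon> i + \<mu> i + \<nu> i) else 0)"
    by (simp add: form_scale_left form_scale_right frameD[OF assms] power_int_add)
qed (simp_all add: form_scale_left form_scale_right frameD[OF assms])

lemma form_comb:
  assumes fr: "frame n e f \<epsilon>"
  shows "j < n \<Longrightarrow> form (comb n e f c d) (f j) = c j * pp powi \<epsilon> j"
    and "j < n \<Longrightarrow> form (e j) (comb n e f c d) = d j * pp powi \<epsilon> j"
    and "form (comb n e f c d) (comb n e f c' d') =
      (\<Sum>i<n. (c i * d' i - d i * c' i) * pp powi \<epsilon> i)"
proof -
  have e: "form (e j) (comb n e f c d) = d j * pp powi \<epsilon> j" if "j < n" for c d j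
  proof -
    have "form (e j) (comb n e f c d) = (\<Sum>i<n. if i = j then d i * pp powi \<epsilon> i else 0)"
      unfolding comb_def form_sum
      by (rule sum.cong) (auto simp: form_add_right form_scale_right frameD[OF fr] that)
    then show ?thesis using that by (simp add: sum.delta')
  qed
  have f: "form (f j) (comb n e f c d) = - c j * pp powi \<epsilon> j" if "j < n" for c d j
  proof -
    have "form (f j) (comb n e f c d) = (\<Sum>i<n. if i = j then - c i * pp powi \<epsilon> i else 0)"
      unfolding comb_def form_sum
      by (rule sum.cong) (auto simp: form_add_right form_scale_right frameD[OF fr] that)
    then show ?thesis using that by (simp add: sum.delta')
  qed
  show "j < n \<Longrightarrow> form (e j) (comb n e f c d) = d j * pp powi \<epsilon> j" by (rule e)
  show "j < n \<Longrightarrow> form (comb n e f c d) (f j) = c j * pp powi \<epsilon> j"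
    using f[of j c d] form_swap[of "comb n e f c d" "f j"] by simp
  have "form (comb n e f c d) (comb n e f c' d') =
      (\<Sum>i<n. c i * form (e i) (comb n e f c' d') + d i * form (f i) (comb n e f c' d'))"
    by (subst comb_def) (simp add: form_sum form_add_left form_scale_left)
  also have "\<dots> = (\<Sum>i<n. (c i * d' i - d i * c' i) * pp powi \<epsilon> i)"
    by (intro sum.cong refl) (simp add: e f left_diff_distrib mult.assoc)
  finally show "form (comb n e f c d) (comb n e f c' d') =
      (\<Sum>i<n. (c i * d' i - d i * c' i) * pp powi \<epsilon> i)" .
qed

lemma comb_coordinates:
  assumes "frame n e f \<epsilon>" "v \<in> Qspan n e f"
  shows "v = comb n e f (\<lambda>i. form v (f i) * pp powi (- \<epsilon> i)) (\<lambda>i. form (e i) v * pp powi (- \<epsilon> i))"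
proof -
  obtain c d where v: "v = comb n e f c d" using assms(2) unfolding Qspan_def by blast
  have *: "x * pp powi \<epsilon> i * pp powi (- \<epsilon> i) = x" for x i
    by (simp add: power_int_minus)
  show ?thesis
    unfolding v by (intro comb_cong) (simp_all only: form_comb[OF assms(1)] *)
qed

lemma comb_eqD:
  assumes "frame n e f \<epsilon>" "comb n e f c d = comb n e f c' d'" "i < n"
  shows "c i = c' i" "d i = d' i"
proof -
  have "c i * pp powi \<epsilon> i = c' i * pp powi \<epsilon> i" "d i * pp powi \<epsilon> i = d' i * pp powi \<epsilon> i"
    using form_comb(1,2)[OF assms(1,3), of c d] form_comb(1,2)[OF assms(1,3), of c' d']
    unfolding assms(2) by metis+
  then show "c i = c' i" "d i = d' i" by simp_all
qed

lemma comb_in_Zspan_iff: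
  assumes "frame n e f \<epsilon>"
  shows "comb n e f c d \<in> Zspan n e f \<longleftrightarrow> (\<forall>i<n. c i \<in> Zp \<and> d i \<in> Zp)"
proof
  assume "comb n e f c d \<in> Zspan n e f"
  then show "\<forall>i<n. c i \<in> Zp \<and> d i \<in> Zp"
    using comb_eqD[OF assms] by (metis ZspanE)
qed (simp add: comb_in_Zspan)

section \<open>Self-dual norms\<close>

text \<open>The last two clauses say that \<alpha> x is the minimum of 2 ord <x,y> - \<alpha> y over
  y, that is, \<alpha> equals its dual norm. The ultrametric inequality is a consequence.\<close>

definition selfdual :: "'v set \<Rightarrow> ('v \<Rightarrow> int) \<Rightarrow> bool"
  where "selfdual W \<alpha> \<longleftrightarrow>
    (\<forall>x\<in>W. \<forall>c. x \<noteq> 0 \<longrightarrow> c \<noteq> 0 \<longrightarrow> \<alpha> (scale c x) = 2 * ord c + \<alpha> x) \<and>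
    (\<forall>x\<in>W. \<forall>y\<in>W. vge (\<alpha> x + \<alpha> y) (form x y)) \<and>
    (\<forall>x\<in>W. x \<noteq> 0 \<longrightarrow> (\<exists>y\<in>W. form x y \<noteq> 0 \<and> 2 * ord (form x y) = \<alpha> x + \<alpha> y))"

text \<open>The value of a norm at 0 is junk; it stands for infinity.\<close>

definition nge :: "('v \<Rightarrow> int) \<Rightarrow> int \<Rightarrow> 'v \<Rightarrow> bool"
  where "nge \<alpha> m x \<longleftrightarrow> x = 0 \<or> m \<le> \<alpha> x"

lemma selfdual_scale: "selfdual W \<alpha> \<Longrightarrow> x \<in> W \<Longrightarrow> x \<noteq> 0 \<Longrightarrow> c \<noteq> 0 \<Longrightarrow> \<alpha> (scale c x) = 2 * ord c + \<alpha> x"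
  unfolding selfdual_def by blast

lemma selfdual_vge: "selfdual W \<alpha> \<Longrightarrow> x \<in> W \<Longrightarrow> y \<in> W \<Longrightarrow> vge (\<alpha> x + \<alpha> y) (form x y)"
  unfolding selfdual_def by blast

lemma selfdual_attained:
  assumes "selfdual W \<alpha>" "x \<in> W" "x \<noteq> 0"
  obtains y where "y \<in> W" "form x y \<noteq> 0" "2 * ord (form x y) = \<alpha> x + \<alpha> y"
  using assms unfolding selfdual_def by blast

text \<open>Balls of a self-dual norm are cut out by conditions linear in x. This is the source of
  the ultrametric inequality \<open>nge_add\<close>.\<close>

lemma nge_iff:
  assumes "selfdual W \<alpha>" "x \<in> W"
  shows "nge \<alpha> m x \<longleftrightarrow> (\<forall>y\<in>W. vge (m + \<alpha> y) (form x y))"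
proof
  assume "nge \<alpha> m x"
  then show "\<forall>y\<in>W. vge (m + \<alpha> y) (form x y)"
    using selfdual_vge[OF assms] vge_mono[of "\<alpha> x + \<alpha> _"] unfolding nge_def by fastforce
next
  assume *: "\<forall>y\<in>W. vge (m + \<alpha> y) (form x y)"
  show "nge \<alpha> m x"
  proof (cases "x = 0")
    case False
    obtain y where "y \<in> W" "form x y \<noteq> 0" "2 * ord (form x y) = \<alpha> x + \<alpha> y"
      using selfdual_attained[OF assms False] .
    with * show ?thesis by (force simp: vge_def nge_def)
  qed (simp add: nge_def)
qed

lemma nge_add:
  assumes "selfdual W \<alpha>" "subspace W" "x \<in> W" "y \<in> W" "nge \<alpha> m x" "nge \<alpha> m y"
  shows "nge \<alpha> m (x + y)"
  using assms subspace_add[OF assms(2-4)] by (simp add: nge_iff[OF assms(1)] form_add_left vge_add)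

lemma nge_scale:
  assumes "selfdual W \<alpha>" "x \<in> W" "nge \<alpha> m x" "vge k c"
  shows "nge \<alpha> (k + m) (scale c x)"
  using assms by (cases "c = 0 \<or> x = 0") (auto simp: nge_def vge_def selfdual_scale[OF assms(1)])

lemma nge_sum:
  assumes "selfdual W \<alpha>" "subspace W" "\<And>i. i \<in> I \<Longrightarrow> g i \<in> W \<and> nge \<alpha> m (g i)"
  shows "nge \<alpha> m (sum g I)"
  using assms(3)
proof (induction I rule: infinite_finite_induct)
  case (insert i I)
  then show ?case
    by (simp, intro nge_add[OF assms(1,2)]) (auto intro!: subspace_sum[OF assms(2)])
qed (auto simp: nge_def)

text \<open>Coordinates are pairings with the basis divided by p^\<epsilon>, and self-duality
  describes the ball by bounds on just such pairings. A lattice is thus recovered from its norm,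
  whichever frame computes it.\<close>

lemma Zspan_eq_ball:
  assumes sd: "selfdual (Qspan n e f) \<alpha>" and fr: "frame n e f \<epsilon>"
    and \<epsilon>: "\<And>i. i < n \<Longrightarrow> \<alpha> (e i) = \<epsilon> i \<and> \<alpha> (f i) = \<epsilon> i \<and> \<epsilon> i \<in> {0, 1}"
  shows "Zspan n e f = {v \<in> Qspan n e f. nge \<alpha> 0 v}"
proof (intro equalityI subsetI CollectI conjI)
  fix v assume v: "v \<in> Zspan n e f"
  then show "v \<in> Qspan n e f" using Zspan_subset_Qspan by blast
  obtain c d where v: "v = comb n e f c d" and cd: "\<forall>i<n. c i \<in> Zp \<and> d i \<in> Zp"
    using v unfolding Zspan_def by blast
  have *: "scale c x \<in> Qspan n e f \<and> nge \<alpha> 0 (scale c x)"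
    if "x \<in> Qspan n e f" "0 \<le> \<alpha> x" "c \<in> Zp" for c x
    using nge_scale[OF sd that(1), of 0 0 c] that subspace_scale[OF subspace_Qspan that(1)]
    by (auto simp: nge_def Zp_iff_vge)
  show "nge \<alpha> 0 v"
    unfolding v comb_def
  proof (rule nge_sum[OF sd subspace_Qspan])
    fix i assume "i \<in> {..<n}"
    then have i: "i < n" by simp
    show "scale (c i) (e i) + scale (d i) (f i) \<in> Qspan n e f \<and>
        nge \<alpha> 0 (scale (c i) (e i) + scale (d i) (f i))"
      using *[OF basis_in_Qspan(1)[OF i], of "c i"] *[OF basis_in_Qspan(2)[OF i], of "d i"]
        \<epsilon>[OF i] cd i
      by (auto intro!: nge_add[OF sd subspace_Qspan] subspace_add[OF subspace_Qspan])
  qed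
next
  fix v assume "v \<in> {v \<in> Qspan n e f. nge \<alpha> 0 v}"
  then have v: "v \<in> Qspan n e f" "nge \<alpha> 0 v" by auto
  have "form v (f i) * pp powi (- \<epsilon> i) \<in> Zp \<and> form (e i) v * pp powi (- \<epsilon> i) \<in> Zp" if i: "i < n" for i
  proof -
    have "vge (\<epsilon> i) (form v (e i))" "vge (\<epsilon> i) (form v (f i))"
      using bspec[OF v(2)[unfolded nge_iff[OF sd v(1)]] basis_in_Qspan(1)[OF i]]
        bspec[OF v(2)[unfolded nge_iff[OF sd v(1)]] basis_in_Qspan(2)[OF i]] \<epsilon>[OF i] by simp_all
    \<comment> \<open>Doubled valuations are even, so for \<epsilon> i = 1 the bound 1 improves to
      2.\<close>
    then have "vge (2 * \<epsilon> i) (form v (e i))" "vge (2 * \<epsilon> i) (form v (f i))"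
      using \<epsilon>[OF i] by (auto simp: vge_def)
    then show ?thesis
      using form_swap[of "e i" v]
      by (simp add: Zp_iff_vge vge_mult_powi_right vge_uminus)
  qed
  then have "comb n e f (\<lambda>i. form v (f i) * pp powi (- \<epsilon> i)) (\<lambda>i. form (e i) v * pp powi (- \<epsilon> i))
      \<in> Zspan n e f"
    by (intro comb_in_Zspan) simp_all
  then show "v \<in> Zspan n e f" unfolding comb_coordinates[OF fr v(1), symmetric] .
qed

text \<open>For v with coordinates c i, d i this is the minimum of all 2 ord (c i) + \<epsilon> i
  and 2 ord (d i) + \<epsilon> i, written through the form: \<open>form v (f i)\<close> is c i *
  p^\<epsilon>, and \<open>form v (e i)\<close> is -d i * p^\<epsilon>. Vanishing pairings count as
  infinity; for v = 0 nothing remains and the value is junk.\<close>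

definition frame_norm :: "nat \<Rightarrow> (nat \<Rightarrow> 'v) \<Rightarrow> (nat \<Rightarrow> 'v) \<Rightarrow> (nat \<Rightarrow> int) \<Rightarrow> 'v \<Rightarrow> int"
  where "frame_norm n e f \<epsilon> v =
    Min ((\<lambda>i. 2 * ord (form v (e i)) - \<epsilon> i) ` {i. i < n \<and> form v (e i) \<noteq> 0} \<union>
         (\<lambda>i. 2 * ord (form v (f i)) - \<epsilon> i) ` {i. i < n \<and> form v (f i) \<noteq> 0})"

lemma frame_norm_le:
  assumes "i < n"
  shows "form v (e i) \<noteq> 0 \<Longrightarrow> frame_norm n e f \<epsilon> v \<le> 2 * ord (form v (e i)) - \<epsilon> i"
    and "form v (f i) \<noteq> 0 \<Longrightarrow> frame_norm n e f \<epsilon> v \<le> 2 * ord (form v (f i)) - \<epsilon> i"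
  unfolding frame_norm_def using assms by (auto intro!: Min_le)

lemma frame_norm_attained:
  assumes fr: "frame n e f \<epsilon>" and v: "v \<in> Qspan n e f" "v \<noteq> 0"
  obtains i w where "i < n" "w = e i \<or> w = f i" "form v w \<noteq> 0"
    "frame_norm n e f \<epsilon> v = 2 * ord (form v w) - \<epsilon> i"
proof -
  let ?S = "(\<lambda>i. 2 * ord (form v (e i)) - \<epsilon> i) ` {i. i < n \<and> form v (e i) \<noteq> 0} \<union>
         (\<lambda>i. 2 * ord (form v (f i)) - \<epsilon> i) ` {i. i < n \<and> form v (f i) \<noteq> 0}"
  have "?S \<noteq> {}"
  proof
    assume "?S = {}"
    then have "\<forall>i<n. form v (e i) = 0 \<and> form v (f i) = 0" by auto
    then have "\<forall>i<n. form (e i) v = 0 \<and> form v (f i) = 0" by (metis form_swap neg_equal_0_iff_equal)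
    then have "v = comb n e f (\<lambda>_. 0) (\<lambda>_. 0)"
      by (subst comb_coordinates[OF fr v(1)], intro comb_cong) auto
    with v(2) comb_zero show False by simp
  qed
  then have "Min ?S \<in> ?S" by (intro Min_in) auto
  then show thesis using that unfolding frame_norm_def by blast
qed

lemma frame_norm_basis:
  assumes "frame n e f \<epsilon>" "i < n"
  shows "frame_norm n e f \<epsilon> (e i) = \<epsilon> i" "frame_norm n e f \<epsilon> (f i) = \<epsilon> i"
proof -
  have *: "{j. j < n \<and> form (e i) (e j) \<noteq> 0} = {}" "{j. j < n \<and> form (e i) (f j) \<noteq> 0} = {i}"
    "{j. j < n \<and> form (f i) (e j) \<noteq> 0} = {i}" "{j. j < n \<and> form (f i) (f j) \<noteq> 0} = {}"
    using assms by (auto simp: frameD[OF assms(1)] split: if_splits)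
  show "frame_norm n e f \<epsilon> (e i) = \<epsilon> i" "frame_norm n e f \<epsilon> (f i) = \<epsilon> i"
    unfolding frame_norm_def * using assms(2) by (simp_all add: frameD[OF assms(1)])
qed

text \<open>The minimum defining the norm of x is attained at the pairing with some basis vector,
  and that vector is the partner of x required by self-duality. The bound on the form comes from its
  expansion in coordinates.\<close>

lemma selfdual_frame_norm:
  assumes fr: "frame n e f \<epsilon>"
  shows "selfdual (Qspan n e f) (frame_norm n e f \<epsilon>)"
proof -
  let ?W = "Qspan n e f" and ?\<alpha> = "frame_norm n e f \<epsilon>"
  have le: "?\<alpha> v \<le> 2 * ord (form v w) - \<epsilon> i"
    if "i < n" "w = e i \<or> w = f i" "form v w \<noteq> 0" for i v w
    using that frame_norm_le by auto
  have vle: "vge (?\<alpha> v + \<epsilon> i) (form v w)" if "i < n" "w = e i \<or> w = f i" for i v w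
    using le[OF that, of v] by (cases "form v w = 0") (auto simp: vge_def)
  have sc: "?\<alpha> (scale c x) \<ge> 2 * ord c + ?\<alpha> x" if "x \<in> ?W" "x \<noteq> 0" "c \<noteq> 0" for c x
  proof -
    have "scale c x \<in> ?W" "scale c x \<noteq> 0" using that subspace_scale[OF subspace_Qspan] by auto
    then obtain i w where w: "i < n" "w = e i \<or> w = f i" "form (scale c x) w \<noteq> 0"
      "?\<alpha> (scale c x) = 2 * ord (form (scale c x) w) - \<epsilon> i"
      using frame_norm_attained[OF fr] by metis
    then show ?thesis
      using le[OF w(1,2), of x] by (simp add: form_scale_left ord_mult)
  qed
  \<comment> \<open>The inequality \<open>sc\<close> for \<open>inverse c\<close> and
    \<open>scale c x\<close> is the reverse of the one for \<open>c\<close> and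
    \<open>x\<close>.\<close>
  have 1: "?\<alpha> (scale c x) = 2 * ord c + ?\<alpha> x" if "x \<in> ?W" "x \<noteq> 0" "c \<noteq> 0" for c x
  proof -
    have "scale c x \<in> ?W" "scale c x \<noteq> 0"
      using that subspace_scale[OF subspace_Qspan that(1)] by auto
    moreover have "scale (inverse c) (scale c x) = x" using that(3) by simp
    ultimately have "?\<alpha> x \<ge> 2 * ord (inverse c) + ?\<alpha> (scale c x)"
      using sc[of "scale c x" "inverse c"] that(3) by simp
    with sc[OF that] that(3) show ?thesis by (simp add: ord_inverse)
  qed
  have 2: "vge (?\<alpha> x + ?\<alpha> y) (form x y)" if "x \<in> ?W" "y \<in> ?W" for x y
  proof -
    have coord: "vge (?\<alpha> v - \<epsilon> i) (form v (f i) * pp powi (- \<epsilon> i))"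
      "vge (?\<alpha> v - \<epsilon> i) (form (e i) v * pp powi (- \<epsilon> i))" if "i < n" for i v
    proof -
      have "vge (?\<alpha> v + \<epsilon> i) (form v (f i))" "vge (?\<alpha> v + \<epsilon> i) (form (e i) v)"
        using vle[OF that, of "f i" v] vle[OF that, of "e i" v] form_swap[of "e i" v]
        by (simp_all add: vge_uminus)
      then show "vge (?\<alpha> v - \<epsilon> i) (form v (f i) * pp powi (- \<epsilon> i))"
        "vge (?\<alpha> v - \<epsilon> i) (form (e i) v * pp powi (- \<epsilon> i))"
        unfolding vge_mult_powi_right by (simp_all add: add.commute)
    qed
    have step: "vge (?\<alpha> x + ?\<alpha> y) ((c * d - c' * d') * pp powi \<epsilon> i)"
      if "vge (?\<alpha> x - \<epsilon> i) c" "vge (?\<alpha> x - \<epsilon> i) c'"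
        "vge (?\<alpha> y - \<epsilon> i) d" "vge (?\<alpha> y - \<epsilon> i) d'" for i c d c' d'
    proof -
      have "?\<alpha> x + ?\<alpha> y - 2 * \<epsilon> i = (?\<alpha> x - \<epsilon> i) + (?\<alpha> y - \<epsilon> i)" by simp
      then show ?thesis
        unfolding vge_mult_powi_right
        using vge_diff[OF vge_mult[OF that(1,3)] vge_mult[OF that(2,4)]] by simp
    qed
    show ?thesis
      unfolding arg_cong2[of _ _ _ _ form, OF comb_coordinates[OF fr that(1)]
          comb_coordinates[OF fr that(2)]] form_comb(3)[OF fr]
      by (intro vge_sum step) (simp_all add: coord)
  qed
  have 3: "\<exists>y\<in>?W. form x y \<noteq> 0 \<and> 2 * ord (form x y) = ?\<alpha> x + ?\<alpha> y" if x: "x \<in> ?W" "x \<noteq> 0" for x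
  proof -
    obtain i w where w: "i < n" "w = e i \<or> w = f i" "form x w \<noteq> 0"
      "?\<alpha> x = 2 * ord (form x w) - \<epsilon> i"
      using frame_norm_attained[OF fr x] .
    have "w \<in> ?W" "?\<alpha> w = \<epsilon> i"
      using w(1,2) frame_norm_basis[OF fr w(1)] basis_in_Qspan[OF w(1)] by metis+
    with w show ?thesis by (intro bexI[of _ w]) simp_all
  qed
  show ?thesis unfolding selfdual_def
    by (intro conjI ballI allI impI) (fact 1, fact 2, fact 3)
qed

section \<open>Splitting off hyperbolic planes, for one norm and for two norms at once\<close>

lemma vge_divide: "vge m c \<Longrightarrow> d \<noteq> 0 \<Longrightarrow> vge (m - 2 * ord d) (c / d)"
  by (cases "c = 0") (auto simp: vge_def ord_divide)

text \<open>A partner z of w found in W is projected to the complement of the plane. The pairing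
  with w does not change, and because x and y are dual to each other the projection does not lower
  \<alpha> z. As \<alpha> w + \<alpha> z is already the largest value allowed, the projection is
  again a partner of w.\<close>

lemma selfdual_complement:
  assumes sd: "selfdual W \<alpha>" and W: "subspace W" and x: "x \<in> W" and y: "y \<in> W"
    and xy: "form x y \<noteq> 0" "2 * ord (form x y) = \<alpha> x + \<alpha> y"
  shows "selfdual {w \<in> W. form w x = 0 \<and> form w y = 0} \<alpha>"
proof -
  have 3: "\<exists>z'\<in>{w \<in> W. form w x = 0 \<and> form w y = 0}. form w z' \<noteq> 0 \<and> 2 * ord (form w z') = \<alpha> w + \<alpha> z'"
    if w: "w \<in> W" "form w x = 0" "form w y = 0" "w \<noteq> 0" for w
  proof -
    obtain z where z: "z \<in> W" "form w z \<noteq> 0" "2 * ord (form w z) = \<alpha> w + \<alpha> z"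
      using selfdual_attained[OF sd w(1,4)] .
    \<comment> \<open>The coordinates of the component of z in the plane spanned by x and y.\<close>
    define c d where "c = form z y / form x y" and "d = form x z / form x y"
    define z' where "z' = z - (scale c x + scale d y)"
    have in_W: "scale c x \<in> W" "scale d y \<in> W"
      using subspace_scale[OF W] x y by blast+
    then have z'_W: "z' \<in> W"
      unfolding z'_def using z(1) by (intro subspace_diff[OF W] subspace_add[OF W])
    have z'_x: "form z' x = 0"
      using xy(1) by (simp add: z'_def d_def form_diff form_add_left form_scale_left
          form_swap[of y x] form_swap[of x z])
    have z'_y: "form z' y = 0"
      using xy(1) by (simp add: z'_def c_def form_diff form_add_left form_scale_left)
    have w_z': "form w z' = form w z"
      by (simp add: z'_def form_diff form_add_right form_scale_right w)
    have "vge (\<alpha> z + \<alpha> y - 2 * ord (form x y)) c" "vge (\<alpha> x + \<alpha> z - 2 * ord (form x y)) d"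
      unfolding c_def d_def using x y z(1) xy(1) by (auto intro!: vge_divide selfdual_vge[OF sd])
    then have "vge (\<alpha> z - \<alpha> x) (- c)" "vge (\<alpha> z - \<alpha> y) (- d)"
      by (simp_all add: xy(2) vge_uminus)
    then have "nge \<alpha> (\<alpha> z) (scale (- c) x)" "nge \<alpha> (\<alpha> z) (scale (- d) y)"
      using nge_scale[OF sd x, of "\<alpha> x"] nge_scale[OF sd y, of "\<alpha> y"] by (fastforce simp: nge_def)+
    then have "nge \<alpha> (\<alpha> z) (z + (scale (- c) x + scale (- d) y))"
      using in_W z(1) by (intro nge_add[OF sd W] subspace_add[OF W] subspace_scale[OF W] x y)
        (auto simp: nge_def)
    also have "z + (scale (- c) x + scale (- d) y) = z'" by (simp add: z'_def)
    finally have "\<alpha> z \<le> \<alpha> z'" using w_z' z(2) by (auto simp: nge_def)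
    moreover have "vge (\<alpha> w + \<alpha> z') (form w z)"
      using selfdual_vge[OF sd w(1) z'_W] by (simp add: w_z')
    ultimately have "2 * ord (form w z) = \<alpha> w + \<alpha> z'"
      using z(2,3) by (simp add: vge_def)
    with z'_W z'_x z'_y w_z' z(2) show ?thesis by (intro bexI[of _ z']) auto
  qed
  show ?thesis
    unfolding selfdual_def
  proof (intro conjI ballI allI impI)
    fix w assume w: "w \<in> {w \<in> W. form w x = 0 \<and> form w y = 0}" 
    then have "w \<in> W" by simp
    then show "\<alpha> (scale c w) = 2 * ord c + \<alpha> w" if "w \<noteq> 0" "c \<noteq> 0" for c
      using that by (rule selfdual_scale[OF sd])
    show "vge (\<alpha> w + \<alpha> z) (form w z)" if "z \<in> {w \<in> W. form w x = 0 \<and> form w y = 0}" for z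
      using that \<open>w \<in> W\<close> by (intro selfdual_vge[OF sd]) simp_all
    show "\<exists>z'\<in>{w \<in> W. form w x = 0 \<and> form w y = 0}. form w z' \<noteq> 0 \<and> 2 * ord (form w z') = \<alpha> w + \<alpha> z'"
      if "w \<noteq> 0" using w that by (intro 3) simp_all
  qed
qed

text \<open>Let x maximize \<beta> - \<alpha>, let y be dual to x for \<alpha> and z dual to y for
  \<beta>. Then \<beta> y + \<beta> z = 2 ord <y,z> \<ge> \<alpha> y + \<alpha> z, and \<beta> z -
  \<alpha> z \<le> \<beta> x - \<alpha> x. Together, \<beta> x + \<beta> y \<ge> \<alpha> x +
  \<alpha> y = 2 ord <x,y>; the opposite inequality holds for every pair with nonzero
  pairing.\<close>

lemma ex_common_hyperbolic_pair:
  assumes \<alpha>: "selfdual W \<alpha>" and \<beta>: "selfdual W \<beta>"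
    and C: "\<And>x. x \<in> W \<Longrightarrow> x \<noteq> 0 \<Longrightarrow> \<beta> x - \<alpha> x \<le> C" and v: "v \<in> W" "v \<noteq> 0"
  obtains x y where "x \<in> W" "y \<in> W" "form x y \<noteq> 0" "2 * ord (form x y) = \<alpha> x + \<alpha> y"
    "2 * ord (form x y) = \<beta> x + \<beta> y"
proof -
  \<comment> \<open>The bound \<open>C\<close> turns maximizing an integer into minimizing a natural
    number.\<close>
  obtain x where x: "x \<in> W" "x \<noteq> 0"
    and min: "\<And>z. z \<in> W \<and> z \<noteq> 0 \<Longrightarrow> nat (C - (\<beta> x - \<alpha> x)) \<le> nat (C - (\<beta> z - \<alpha> z))"
    using ex_has_least_nat[of "\<lambda>x. x \<in> W \<and> x \<noteq> 0" v "\<lambda>x. nat (C - (\<beta> x - \<alpha> x))"] v by blast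
  have max: "\<beta> z - \<alpha> z \<le> \<beta> x - \<alpha> x" if "z \<in> W" "z \<noteq> 0" for z
    using min[of z] C[of z] C[of x] x that by linarith
  obtain y where y: "y \<in> W" "form x y \<noteq> 0" "2 * ord (form x y) = \<alpha> x + \<alpha> y"
    using selfdual_attained[OF \<alpha> x] .
  have "y \<noteq> 0" using y(2) by auto
  obtain z where z: "z \<in> W" "form y z \<noteq> 0" "2 * ord (form y z) = \<beta> y + \<beta> z"
    using selfdual_attained[OF \<beta> y(1) \<open>y \<noteq> 0\<close>] .
  have "z \<noteq> 0" using z(2) by auto
  have "\<beta> z - \<alpha> z \<le> \<beta> x - \<alpha> x" using max[OF z(1) \<open>z \<noteq> 0\<close>] .
  moreover have "\<alpha> y + \<alpha> z \<le> 2 * ord (form y z)"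
    using selfdual_vge[OF \<alpha> y(1) z(1)] z(2) by (simp add: vge_def)
  moreover have "\<beta> x + \<beta> y \<le> 2 * ord (form x y)"
    using selfdual_vge[OF \<beta> x(1) y(1)] y(2) by (simp add: vge_def)
  ultimately have "2 * ord (form x y) = \<beta> x + \<beta> y" using z(3) y(3) by linarith
  with x y that show thesis by blast
qed

text \<open>The pairings are still arbitrary nonzero numbers here; scaling to powers of p is left to
  \<open>common_frame\<close>.\<close>

definition adapted_pairs :: "nat \<Rightarrow> (nat \<Rightarrow> 'v) \<Rightarrow> (nat \<Rightarrow> 'v) \<Rightarrow> ('v \<Rightarrow> int) \<Rightarrow> bool"
  where "adapted_pairs k x y \<alpha> \<longleftrightarrow>
    (\<forall>i<k. form (x i) (y i) \<noteq> 0 \<and> 2 * ord (form (x i) (y i)) = \<alpha> (x i) + \<alpha> (y i)) \<and>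
    (\<forall>i<k. \<forall>j<k. form (x i) (x j) = 0 \<and> form (y i) (y j) = 0 \<and> (i \<noteq> j \<longrightarrow> form (x i) (y j) = 0))"

text \<open>Induction on a bound for the size of independent subsets of W, which serves as
  dimension. The bound \<open>C\<close> on \<beta> - \<alpha> is inherited by the complement, so a
  maximizing vector exists at every stage.\<close>

lemma ex_adapted_pairs:
  assumes "subspace W" "\<And>B. B \<subseteq> W \<Longrightarrow> independent B \<Longrightarrow> finite B \<and> card B \<le> m"
    and "selfdual W \<alpha>" "selfdual W \<beta>"
    and C: "\<And>x. x \<in> W \<Longrightarrow> x \<noteq> 0 \<Longrightarrow> \<beta> x - \<alpha> x \<le> C"
  shows "\<exists>k x y. adapted_pairs k x y \<alpha> \<and> adapted_pairs k x y \<beta> \<and> Qspan k x y = W"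
  using assms
proof (induction m arbitrary: W)
  case 0
  have "W = {0}"
  proof (rule ccontr)
    assume "W \<noteq> {0}"
    then obtain w where "w \<in> W" "w \<noteq> 0" using subspace_0[OF "0.prems"(1)] by blast
    then show False using "0.prems"(2)[of "{w}"] by simp
  qed
  then show ?case
    by (intro exI[of _ 0] exI) (auto simp: adapted_pairs_def Qspan_def comb_def)
next
  case (Suc m)
  note W = Suc.prems(1) and \<alpha> = Suc.prems(3) and \<beta> = Suc.prems(4)
  show ?case
  proof (cases "W = {0}")
    case True
    then show ?thesis
      by (intro exI[of _ 0] exI) (auto simp: adapted_pairs_def Qspan_def comb_def)
  next
    case False
    then obtain v where "v \<in> W" "v \<noteq> 0" using subspace_0[OF W] by blast
    then obtain x y where x: "x \<in> W" and y: "y \<in> W" and xy: "form x y \<noteq> 0"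
      and xy_\<alpha>: "2 * ord (form x y) = \<alpha> x + \<alpha> y" and xy_\<beta>: "2 * ord (form x y) = \<beta> x + \<beta> y"
      using ex_common_hyperbolic_pair[OF \<alpha> \<beta> Suc.prems(5)] by blast
    define W' where "W' = {w \<in> W. form w x = 0 \<and> form w y = 0}"
    have W': "subspace W'"
      unfolding W'_def using W
      by (auto simp: subspace_def form_add_left form_scale_left)
    \<comment> \<open>x pairs nontrivially with y and so lies outside W' and outside the span of B.
      Adding it to B shows that the bound drops by at least one, which is all the induction
      needs.\<close>
    have "finite B \<and> card B \<le> m" if B: "B \<subseteq> W'" "independent B" for B
    proof -
      have "x \<notin> W'" using xy by (simp add: W'_def)
      moreover have "span B \<subseteq> W'" using B(1) W' by (rule span_minimal)
      ultimately have "x \<notin> span B" by blast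
      then have ind: "independent (insert x B)" and "x \<notin> B"
        using independent_insertI[OF _ B(2)] span_base[of x B] by blast+
      have "insert x B \<subseteq> W" using x B(1) by (auto simp: W'_def)
      from Suc.prems(2)[OF this ind] \<open>x \<notin> B\<close> show ?thesis by auto
    qed
    moreover have "selfdual W' \<alpha>" "selfdual W' \<beta>"
      unfolding W'_def using selfdual_complement[OF \<alpha> W x y xy xy_\<alpha>]
        selfdual_complement[OF \<beta> W x y xy xy_\<beta>] .
    moreover have "\<beta> z - \<alpha> z \<le> C" if "z \<in> W'" "z \<noteq> 0" for z
      using Suc.prems(5) that by (simp add: W'_def)
    ultimately obtain k x' y' where \<alpha>': "adapted_pairs k x' y' \<alpha>" and \<beta>': "adapted_pairs k x' y' \<beta>"
      and span: "Qspan k x' y' = W'"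
      using Suc.IH[OF W'] by blast
    define X Y where "X = x'(k := x)" and "Y = y'(k := y)"
    have in_W': "x' i \<in> W'" "y' i \<in> W'" if "i < k" for i
      using basis_in_Qspan[OF that] span by auto
    have ad: "adapted_pairs (Suc k) X Y \<gamma>"
      if "adapted_pairs k x' y' \<gamma>" "2 * ord (form x y) = \<gamma> x + \<gamma> y" for \<gamma>
    proof -
      have orth: "form (x' i) x = 0" "form (x' i) y = 0" "form (y' i) x = 0" "form (y' i) y = 0"
        "form x (x' i) = 0" "form y (x' i) = 0" "form x (y' i) = 0" "form y (y' i) = 0" if "i < k" for i
        using in_W'[OF that] form_swap[of x "x' i"] form_swap[of y "x' i"] form_swap[of x "y' i"]
          form_swap[of y "y' i"] by (simp_all add: W'_def)
      show ?thesis
        unfolding adapted_pairs_def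
      proof (intro conjI allI impI)
        fix i assume "i < Suc k"
        then show "form (X i) (Y i) \<noteq> 0" "2 * ord (form (X i) (Y i)) = \<gamma> (X i) + \<gamma> (Y i)"
          using that xy by (auto simp: adapted_pairs_def X_def Y_def less_Suc_eq)
        fix j assume "j < Suc k"
        with \<open>i < Suc k\<close> show "form (X i) (X j) = 0" "form (Y i) (Y j) = 0"
          using that(1) by (auto simp: adapted_pairs_def X_def Y_def less_Suc_eq orth)
        assume "i \<noteq> j"
        with \<open>i < Suc k\<close> \<open>j < Suc k\<close> show "form (X i) (Y j) = 0"
          using that(1) by (auto simp: adapted_pairs_def X_def Y_def less_Suc_eq orth)
      qed
    qed
    have "Qspan (Suc k) X Y = W"
    proof
      have "x' i \<in> W \<and> y' i \<in> W" if "i < k" for i using in_W'[OF that] by (simp add: W'_def)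
      then show "Qspan (Suc k) X Y \<subseteq> W"
        by (intro Qspan_subset[OF W]) (auto simp: X_def Y_def x y less_Suc_eq)
      show "W \<subseteq> Qspan (Suc k) X Y"
      proof
        fix w assume w: "w \<in> W"
        define c d where "c = form w y / form x y" and "d = form x w / form x y"
        define w' where "w' = w - (scale c x + scale d y)"
        have "w' \<in> W"
          unfolding w'_def using w x y by (intro subspace_diff[OF W] subspace_add[OF W] subspace_scale[OF W])
        moreover have "form w' x = 0"
          using xy by (simp add: w'_def d_def form_diff form_add_left form_scale_left
              form_swap[of y x] form_swap[of x w])
        moreover have "form w' y = 0"
          using xy by (simp add: w'_def c_def form_diff form_add_left form_scale_left)
        ultimately have "w' \<in> W'" by (simp add: W'_def)
        then obtain p q where pq: "w' = comb k x' y' p q" using span by (auto elim: QspanE)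
        have "w = w' + (scale c x + scale d y)" by (simp add: w'_def)
        also have "\<dots> = comb (Suc k) X Y (p(k := c)) (q(k := d))"
          by (simp add: pq comb_def X_def Y_def)
        finally show "w \<in> Qspan (Suc k) X Y" by simp
      qed
    qed
    then show ?thesis using ad[OF \<alpha>' xy_\<alpha>] ad[OF \<beta>' xy_\<beta>] by blast
  qed
qed

section \<open>Independence and rank of frames, and a common frame for two lattices\<close>

lemma Qspan_eq_span: "Qspan n e f = span (e ` {..<n} \<union> f ` {..<n})"
proof
  show "Qspan n e f \<subseteq> span (e ` {..<n} \<union> f ` {..<n})"
    by (intro Qspan_subset subspace_span span_base) auto
  show "span (e ` {..<n} \<union> f ` {..<n}) \<subseteq> Qspan n e f"
    by (intro span_minimal subspace_Qspan) (auto intro: basis_in_Qspan)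
qed

lemma frame_inj:
  assumes fr: "frame n e f \<epsilon>"
  shows "inj_on e {..<n}" "inj_on f {..<n}" "e ` {..<n} \<inter> f ` {..<n} = {}"
proof -
  have *: "pp powi \<epsilon> i \<noteq> 0" for i by simp
  show "inj_on e {..<n}"
  proof (rule inj_onI)
    fix i j assume "i \<in> {..<n}" "j \<in> {..<n}" and eq: "e i = e j"
    then have ij: "i < n" "j < n" by simp_all
    show "i = j"
      using frameD(3)[OF fr ij] frameD(3)[OF fr ij(2,2)] * unfolding eq by metis
  qed
  show "inj_on f {..<n}"
  proof (rule inj_onI)
    fix i j assume "i \<in> {..<n}" "j \<in> {..<n}" and eq: "f i = f j"
    then have ij: "i < n" "j < n" by simp_all
    show "i = j"
      using frameD(3)[OF fr ij] frameD(3)[OF fr ij(1,1)] * unfolding eq by metis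
  qed
  show "e ` {..<n} \<inter> f ` {..<n} = {}"
  proof (intro equals0I, elim IntE imageE)
    fix v i j assume "v = e i" "v = f j" "i \<in> {..<n}" "j \<in> {..<n}"
    then have eq: "e i = f j" and ij: "i < n" "j < n" by simp_all
    show False
      using frameD(3)[OF fr ij(1,1)] frameD(2)[OF fr ij(2,1)] * unfolding eq by metis
  qed
qed

lemma independent_frame:
  assumes fr: "frame n e f \<epsilon>"
  shows "independent (e ` {..<n} \<union> f ` {..<n})"
proof
  assume "dependent (e ` {..<n} \<union> f ` {..<n})"
  then obtain u v where v: "v \<in> e ` {..<n} \<union> f ` {..<n}" "u v \<noteq> 0"
    and 0: "(\<Sum>v\<in>e ` {..<n} \<union> f ` {..<n}. scale (u v) v) = 0"
    by (subst (asm) dependent_finite) auto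
  have "comb n e f (\<lambda>i. u (e i)) (\<lambda>i. u (f i)) = comb n e f (\<lambda>_. 0) (\<lambda>_. 0)"
    using 0 unfolding comb_def
    by (simp add: sum.union_disjoint frame_inj[OF fr] sum.reindex sum.distrib)
  from comb_eqD[OF fr this] v show False by auto
qed

lemma card_frame:
  assumes "frame n e f \<epsilon>"
  shows "card (e ` {..<n} \<union> f ` {..<n}) = 2 * n"
  using frame_inj[OF assms] by (simp add: card_Un_disjoint card_image)

lemma frame_rank_unique:
  assumes "frame n e f \<epsilon>" "frame n' e' f' \<epsilon>'" "Qspan n e f = Qspan n' e' f'"
  shows "n = n'"
proof -
  have le: "n \<le> n'" if "frame n e f \<epsilon>" "frame n' e' f' \<epsilon>'" "Qspan n e f = Qspan n' e' f'"
    for n e f \<epsilon> n' e' f' \<epsilon>'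
  proof -
    have "e ` {..<n} \<union> f ` {..<n} \<subseteq> span (e' ` {..<n'} \<union> f' ` {..<n'})"
      unfolding that(3)[unfolded Qspan_eq_span, symmetric] by (rule span_superset)
    from independent_span_bound[OF _ independent_frame[OF that(1)] this]
    show ?thesis unfolding card_frame[OF that(1)] card_frame[OF that(2)] by simp
  qed
  show ?thesis using le[OF assms] le[OF assms(2,1) assms(3)[symmetric]] by simp
qed

text \<open>If the basis vector w realizes the frame norm of x, self-duality bounds \<beta> x by 2
  ord <x,w> - \<beta> w. Only finitely many w occur, so finitely many constants are to be
  compared.\<close>

lemma frame_norm_diff_bounded:
  assumes fr: "frame n e f \<epsilon>" and sd: "selfdual (Qspan n e f) \<beta>"
  obtains C where "\<And>x. x \<in> Qspan n e f \<Longrightarrow> x \<noteq> 0 \<Longrightarrow> \<beta> x - frame_norm n e f \<epsilon> x \<le> C"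
proof
  define S where "S = (\<lambda>i. \<epsilon> i - \<beta> (e i)) ` {..<n} \<union> (\<lambda>i. \<epsilon> i - \<beta> (f i)) ` {..<n}"
  fix x assume x: "x \<in> Qspan n e f" "x \<noteq> 0"
  obtain i w where w: "i < n" "w = e i \<or> w = f i" "form x w \<noteq> 0"
    "frame_norm n e f \<epsilon> x = 2 * ord (form x w) - \<epsilon> i"
    using frame_norm_attained[OF fr x] .
  have "w \<in> Qspan n e f" using w(2) basis_in_Qspan[OF w(1)] by metis
  then have "\<beta> x + \<beta> w \<le> 2 * ord (form x w)"
    using selfdual_vge[OF sd x(1)] w(3) by (auto simp: vge_def)
  moreover have "\<epsilon> i - \<beta> w \<le> Max S"
    using w(1,2) by (intro Max_ge) (auto simp: S_def)
  ultimately show "\<beta> x - frame_norm n e f \<epsilon> x \<le> Max S" using w(4) by linarith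
qed

text \<open>The common pairs of the two frame norms need only be scaled: by powers of p and units to
  a frame of the first lattice, from there by powers of p alone to one of the second. Both lattices
  are then identified as unit balls.\<close>

lemma common_frame:
  assumes fr: "frame n e f \<epsilon>" and fr': "frame n' e' f' \<epsilon>'"
    and span: "Qspan n e f = Qspan n' e' f'"
    and \<epsilon>: "\<And>i. i < n \<Longrightarrow> \<epsilon> i \<in> {0, 1}" and \<epsilon>': "\<And>i. i < n' \<Longrightarrow> \<epsilon>' i \<in> {0, 1}"
  obtains x y \<eta> \<mu> \<nu> where "frame n x y \<eta>" "Qspan n x y = Qspan n e f"
    "\<forall>i<n. \<eta> i \<in> {0, 1}" "\<forall>i<n. \<eta> i + \<mu> i + \<nu> i \<in> {0, 1}"
    "Zspan n x y = Zspan n e f"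
    "Zspan n (scaled \<mu> x) (scaled \<nu> y) = Zspan n' e' f'"
proof -
  define W \<alpha> \<beta> where "W = Qspan n e f" and "\<alpha> = frame_norm n e f \<epsilon>" and "\<beta> = frame_norm n' e' f' \<epsilon>'"
  have W': "W = Qspan n' e' f'" using span W_def by simp
  have \<alpha>: "selfdual W \<alpha>" unfolding W_def \<alpha>_def by (rule selfdual_frame_norm[OF fr])
  have \<beta>: "selfdual W \<beta>" unfolding W' \<beta>_def by (rule selfdual_frame_norm[OF fr'])
  have ball: "Zspan n e f = {v \<in> W. nge \<alpha> 0 v}"
    unfolding W_def using \<alpha>[unfolded W_def] fr by (rule Zspan_eq_ball) (use \<epsilon> frame_norm_basis[OF fr] \<alpha>_def in auto)
  have ball': "Zspan n' e' f' = {v \<in> W. nge \<beta> 0 v}"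
    unfolding W' using \<beta>[unfolded W'] fr' by (rule Zspan_eq_ball) (use \<epsilon>' frame_norm_basis[OF fr'] \<beta>_def in auto)
  obtain C where C: "\<And>x. x \<in> W \<Longrightarrow> x \<noteq> 0 \<Longrightarrow> \<beta> x - \<alpha> x \<le> C"
    using frame_norm_diff_bounded[OF fr \<beta>[unfolded W_def]] unfolding W_def \<alpha>_def by blast
  have "finite B \<and> card B \<le> 2 * n" if "B \<subseteq> W" "independent B" for B
    using independent_span_bound[of "e ` {..<n} \<union> f ` {..<n}" B] that card_frame[OF fr]
    unfolding W_def Qspan_eq_span by simp
  then obtain k x y where ad: "adapted_pairs k x y \<alpha>" "adapted_pairs k x y \<beta>" and xy: "Qspan k x y = W"
    using ex_adapted_pairs[OF _ _ \<alpha> \<beta> C, of "2 * n"] subspace_Qspan[of n e f] unfolding W_def by blast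
  define d where "d i = ord (form (x i) (y i))" for i
  have "\<exists>u. i < k \<longrightarrow> form (x i) (y i) = pp powi d i * u \<and> Zp_unit u" for i
    using ord_decomposition[of "form (x i) (y i)"] ad(1)
    unfolding d_def adapted_pairs_def by metis
  then obtain u where u: "\<And>i. i < k \<Longrightarrow> form (x i) (y i) = pp powi d i * u i"
    and unit: "\<And>i. i < k \<Longrightarrow> Zp_unit (u i)"
    by metis
  \<comment> \<open>Halving with rounding down brings the \<alpha>-norms of x i and y i to 0 or 1.
    They sum to the even number 2 * d i, hence have equal parity and end at the same value \<eta>
    i.\<close>
  define s t where "s i = - (\<alpha> (x i) div 2)" and "t i = - (\<alpha> (y i) div 2)" for i
  \<comment> \<open>The unit part of the pairing is moved into \<open>Y i\<close>; no norm changes,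
    and the pairing becomes an exact power of p.\<close>
  define X Y where "X i = scale (pp powi s i) (x i)" and "Y i = scale (pp powi t i * inverse (u i)) (y i)" for i
  define \<eta> where "\<eta> i = \<alpha> (x i) mod 2" for i
  \<comment> \<open>The same rounding for \<beta>: the norms of X i and Y i sum to 2 * \<eta> i, so
    again their parities agree.\<close>
  define \<mu> \<nu> where "\<mu> i = - (\<beta> (X i) div 2)" and "\<nu> i = - (\<beta> (Y i) div 2)" for i
  have in_W: "x i \<in> W" "y i \<in> W" "X i \<in> W" "Y i \<in> W" if "i < k" for i
    using basis_in_Qspan(1)[OF that, of x y] basis_in_Qspan(2)[OF that, of y x] xy
      subspace_scale[OF subspace_Qspan[of n e f]]
    by (auto simp: X_def Y_def W_def)
  have scaled: "\<gamma> (X i) = 2 * s i + \<gamma> (x i)" "\<gamma> (Y i) = 2 * t i + \<gamma> (y i)"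
    if i: "i < k" and \<gamma>: "selfdual W \<gamma>" for i \<gamma>
  proof -
    have "x i \<noteq> 0" "y i \<noteq> 0" using ad(1) i by (auto simp: adapted_pairs_def)
    moreover have "ord (inverse (u i)) = 0" "u i \<noteq> 0"
      using ord_eqI[OF Zp_unit_inverse[OF unit[OF i]], of 0] unit[OF i] by (simp_all add: Zp_unit_def)
    ultimately show "\<gamma> (X i) = 2 * s i + \<gamma> (x i)" "\<gamma> (Y i) = 2 * t i + \<gamma> (y i)"
      using in_W[OF i] by (simp_all add: X_def Y_def selfdual_scale[OF \<gamma>] ord_mult)
  qed
  have \<eta>: "\<alpha> (X i) = \<eta> i" "\<alpha> (Y i) = \<eta> i" "s i + t i + d i = \<eta> i" "\<eta> i \<in> {0, 1}"
    if i: "i < k" for i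
  proof -
    have "2 * d i = \<alpha> (x i) + \<alpha> (y i)" using ad(1) i by (simp add: adapted_pairs_def d_def)
    then show "\<alpha> (X i) = \<eta> i" "\<alpha> (Y i) = \<eta> i" "s i + t i + d i = \<eta> i" "\<eta> i \<in> {0, 1}"
      unfolding scaled[OF i \<alpha>] s_def t_def \<eta>_def insert_iff empty_iff by presburger+
  qed
  have frXY: "frame k X Y \<eta>"
    unfolding frame_def
  proof (intro allI impI conjI)
    fix i j assume i: "i < k" and j: "j < k"
    show "form (X i) (X j) = 0" "form (Y i) (Y j) = 0"
      using ad(1) i j by (simp_all add: adapted_pairs_def X_def Y_def form_scale_left form_scale_right)
    show "form (X i) (Y j) = (if i = j then pp powi \<eta> i else 0)"
    proof (cases "i = j")
      case False
      then show ?thesis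
        using ad(1) i j by (simp add: adapted_pairs_def X_def Y_def form_scale_left form_scale_right)
    next
      case True
      have "form (X i) (Y i) = pp powi s i * pp powi t i * pp powi d i * (u i * inverse (u i))"
        by (simp add: X_def Y_def form_scale_left form_scale_right u[OF i])
      also have "\<dots> = pp powi (s i + t i + d i)"
        using unit[OF i] by (simp add: power_int_add Zp_unit_def)
      finally show ?thesis using True \<eta>(3)[OF i] by simp
    qed
  qed
  have spanXY: "Qspan k X Y = W"
    unfolding X_def Y_def xy[symmetric]
    by (rule Qspan_scale) (use unit in \<open>auto simp: Zp_unit_def\<close>)
  then have k: "k = n" using frame_rank_unique[OF frXY fr] by (simp add: W_def)
  have Z\<alpha>: "Zspan k X Y = {v \<in> W. nge \<alpha> 0 v}"
    unfolding spanXY[symmetric]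
    by (rule Zspan_eq_ball[OF \<alpha>[folded spanXY] frXY]) (use \<eta>(1,2,4) in blast)
  define X' Y' where "X' i = scale (pp powi \<mu> i) (X i)" and "Y' i = scale (pp powi \<nu> i) (Y i)" for i
  have frXY': "frame k X' Y' (\<lambda>i. \<eta> i + \<mu> i + \<nu> i)"
    unfolding X'_def Y'_def by (rule frame_scale[OF frXY])
  have spanXY': "Qspan k X' Y' = W"
    unfolding X'_def Y'_def spanXY[symmetric] by (rule Qspan_scale) simp_all
  have \<beta>': "\<beta> (X' i) = \<eta> i + \<mu> i + \<nu> i \<and> \<beta> (Y' i) = \<eta> i + \<mu> i + \<nu> i \<and> \<eta> i + \<mu> i + \<nu> i \<in> {0, 1}"
    if i: "i < k" for i
  proof -
    have "X i \<noteq> 0" "Y i \<noteq> 0" using frameD(3)[OF frXY i i] by auto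
    then have "\<beta> (X' i) = 2 * \<mu> i + \<beta> (X i)" "\<beta> (Y' i) = 2 * \<nu> i + \<beta> (Y i)"
      using in_W[OF i] by (simp_all add: X'_def Y'_def selfdual_scale[OF \<beta>])
    moreover have "2 * d i = \<beta> (x i) + \<beta> (y i)" using ad(2) i by (simp add: adapted_pairs_def d_def)
    then have "2 * \<eta> i = \<beta> (X i) + \<beta> (Y i)" using \<eta>(3)[OF i] scaled[OF i \<beta>] by simp
    ultimately show ?thesis unfolding \<mu>_def \<nu>_def insert_iff empty_iff by presburger
  qed
  have Z\<beta>: "Zspan k X' Y' = {v \<in> W. nge \<beta> 0 v}"
    unfolding spanXY'[symmetric]
    by (rule Zspan_eq_ball[OF \<beta>[folded spanXY'] frXY' \<beta>'])
  show thesis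
  proof (rule that)
    show "frame n X Y \<eta>" "Qspan n X Y = Qspan n e f" "Zspan n X Y = Zspan n e f"
      using frXY spanXY Z\<alpha> ball k by (simp_all add: W_def)
    show "Zspan n (scaled \<mu> X) (scaled \<nu> Y) = Zspan n' e' f'"
      using Z\<beta> ball' k unfolding X'_def Y'_def by simp
    show "\<forall>i<n. \<eta> i \<in> {0, 1}" "\<forall>i<n. \<eta> i + \<mu> i + \<nu> i \<in> {0, 1}"
      using \<eta>(4) \<beta>' k by blast+
  qed
qed

section \<open>Uniqueness of elementary divisors\<close>

interpretation zp: Modules.module "zp_scale scale"
  by (rule module_zp_scale) (rule vector_space_axioms)

lemma zp_span_eq_Zspan: "zp_span scale (e ` {..<n} \<union> f ` {..<n}) = Zspan n e f"
  unfolding zp_span_def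
proof (rule subset_antisym)
  show "zp.span (e ` {..<n} \<union> f ` {..<n}) \<subseteq> Zspan n e f"
  proof (rule zp.span_minimal)
    show "zp.subspace (Zspan n e f)"
      by (rule zp.subspaceI) (simp_all add: zp_scale_def Zspan_add Zspan_scale Zp_def)
  qed (auto intro: basis_in_Zspan)
  show "Zspan n e f \<subseteq> zp.span (e ` {..<n} \<union> f ` {..<n})"
  proof
    fix v assume "v \<in> Zspan n e f"
    then obtain c d where v: "v = comb n e f c d" and "\<forall>i<n. c i \<in> Zp \<and> d i \<in> Zp"
      unfolding Zspan_def by blast
    moreover have "scale x w \<in> zp.span (e ` {..<n} \<union> f ` {..<n})"
      if "x \<in> Zp" "w \<in> e ` {..<n} \<union> f ` {..<n}" for x w
    proof -
      obtain y where "x = to_fract y" using \<open>x \<in> Zp\<close> unfolding Zp_def by blast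
      then show ?thesis
        using zp.span_scale[OF zp.span_base[OF that(2)], of y] by (simp add: zp_scale_def)
    qed
    ultimately show "v \<in> zp.span (e ` {..<n} \<union> f ` {..<n})"
      unfolding v comb_def by (intro zp.span_sum zp.span_add) auto
  qed
qed

text \<open>A rational relation becomes integral after multiplication by a common power of
  p.\<close>

lemma zp_dependent_iff:
  assumes "finite S"
  shows "zp.dependent S \<longleftrightarrow> dependent S"
proof
  assume "zp.dependent S"
  then obtain u v where "v \<in> S" "u v \<noteq> 0" "(\<Sum>v\<in>S. scale (to_fract (u v)) v) = 0"
    unfolding zp.dependent_finite[OF assms] zp_scale_def by blast
  then show "dependent S"
    unfolding dependent_finite[OF assms] by (intro exI[of _ "\<lambda>v. to_fract (u v)"]) auto
next
  assume "dependent S"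
  then obtain u v where v: "v \<in> S" "u v \<noteq> 0" and 0: "(\<Sum>v\<in>S. scale (u v) v) = 0"
    unfolding dependent_finite[OF assms] by blast
  obtain m where m: "\<And>v. v \<in> S \<Longrightarrow> pp powi m * u v \<in> Zp"
    using common_denominator[OF assms, of u] by blast
  have "\<exists>w. v \<in> S \<longrightarrow> pp powi m * u v = to_fract w" for v
    using m[of v] unfolding Zp_def by blast
  then obtain w where w: "\<And>v. v \<in> S \<Longrightarrow> pp powi m * u v = to_fract (w v)" by metis
  have "(\<Sum>v\<in>S. zp_scale scale (w v) v) = scale (pp powi m) (\<Sum>v\<in>S. scale (u v) v)"
    unfolding scale_sum_right zp_scale_def by (rule sum.cong) (simp_all add: w)
  moreover have "w v \<noteq> 0" using w[OF v(1)] v(2) by force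
  ultimately show "zp.dependent S"
    unfolding zp.dependent_finite[OF assms] using v(1) 0 by auto
qed

lemma zp_basis_iff:
  "zp_basis scale xs L \<longleftrightarrow> distinct xs \<and> independent (set xs) \<and> L = zp_span scale (set xs)"
  unfolding zp_basis_def by (simp add: zp_dependent_iff)

lemma sum_set_conv_nth: "distinct xs \<Longrightarrow> (\<Sum>v\<in>set xs. g v) = (\<Sum>i<length xs. g (xs ! i))"
  using sum.reindex_bij_betw[OF bij_betw_nth[OF _ refl refl], of xs g] by simp

lemma zp_basis_mem_iff:
  assumes "zp_basis scale xs L"
  shows "v \<in> L \<longleftrightarrow> (\<exists>c. (\<forall>i<length xs. c i \<in> Zp) \<and> v = (\<Sum>i<length xs. scale (c i) (xs ! i)))"
proof -
  have d: "distinct xs" and L: "L = zp.span (set xs)"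
    using assms by (auto simp: zp_basis_iff zp_span_def)
  show ?thesis
  proof
    assume "v \<in> L"
    then obtain u where "v = (\<Sum>w\<in>set xs. zp_scale scale (u w) w)"
      unfolding L zp.span_finite[OF finite_set] by blast
    then show "\<exists>c. (\<forall>i<length xs. c i \<in> Zp) \<and> v = (\<Sum>i<length xs. scale (c i) (xs ! i))"
      by (intro exI[of _ "\<lambda>i. to_fract (u (xs ! i))"]) (auto simp: sum_set_conv_nth[OF d] zp_scale_def Zp_def)
  next
    assume "\<exists>c. (\<forall>i<length xs. c i \<in> Zp) \<and> v = (\<Sum>i<length xs. scale (c i) (xs ! i))"
    then obtain c where c: "\<And>i. i < length xs \<Longrightarrow> c i \<in> Zp" and v: "v = (\<Sum>i<length xs. scale (c i) (xs ! i))"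
      by blast
    have "scale (c i) (xs ! i) \<in> zp.span (set xs)" if "i < length xs" for i
    proof -
      obtain y where "c i = to_fract y" using c[OF \<open>i < length xs\<close>] unfolding Zp_def by blast
      then show ?thesis
        using zp.span_scale[OF zp.span_base[OF nth_mem[OF \<open>i < length xs\<close>]], of y] by (simp add: zp_scale_def)
    qed
    then show "v \<in> L" unfolding L v by (intro zp.span_sum) simp
  qed
qed

lemma zp_basis_unique:
  assumes "zp_basis scale xs L" "(\<Sum>i<length xs. scale (c i) (xs ! i)) = (\<Sum>i<length xs. scale (d i) (xs ! i))"
    and "i < length xs"
  shows "c i = d i"
proof -
  have xs: "distinct xs" "independent (set xs)" using assms(1) by (auto simp: zp_basis_iff)
  define g where "g v = c (the_inv_into {..<length xs} ((!) xs) v) - d (the_inv_into {..<length xs} ((!) xs) v)" for v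
  have g: "g (xs ! i) = c i - d i" if "i < length xs" for i
    unfolding g_def using the_inv_into_f_f[of "(!) xs" "{..<length xs}" i] inj_on_nth[OF xs(1), of "{..<length xs}"] that
    by simp
  have "(\<Sum>v\<in>set xs. scale (g v) v) = (\<Sum>i<length xs. scale (c i - d i) (xs ! i))"
    unfolding sum_set_conv_nth[OF xs(1)] by (rule sum.cong) (simp_all add: g)
  also have "\<dots> = 0" using assms(2) by (simp add: scale_left_diff_distrib sum_subtractf)
  finally have "\<forall>v\<in>set xs. g v = 0"
    using xs(2) unfolding dependent_finite[OF finite_set] by blast
  then show ?thesis using g[OF assms(3)] nth_mem[OF assms(3)] by simp
qed

lemma zp_basis_length_unique:
  assumes "zp_basis scale xs M" "zp_basis scale ys M"
  shows "length xs = length ys"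
proof -
  have "length xs \<le> length ys" if "zp_basis scale xs M" "zp_basis scale ys M" for xs ys
  proof -
    have "x \<in> span (set ys)" if "x \<in> set xs" for x
    proof -
      have "x \<in> M"
        using zp.span_base[OF that] \<open>zp_basis scale xs M\<close> by (simp add: zp_basis_iff zp_span_def)
      then obtain c where "x = (\<Sum>i<length ys. scale (c i) (ys ! i))"
        using zp_basis_mem_iff[OF \<open>zp_basis scale ys M\<close>] by blast
      then show ?thesis by (simp, intro span_sum span_scale span_base) simp
    qed
    then have "card (set xs) \<le> card (set ys)"
      using independent_span_bound[of "set ys" "set xs"] that by (auto simp: zp_basis_iff)
    then show ?thesis using that by (simp add: zp_basis_iff distinct_card)
  qed
  from this[OF assms] this[OF assms(2,1)] show ?thesis by simp
qed

text \<open>Stated for families rather than sets, since the vectors x_i and y_j to which it is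
  applied may coincide; a repeated vector is itself a relation.\<close>

lemma ex_linear_relation:
  assumes "finite I" "finite S" "card S < card I" "\<And>i. i \<in> I \<Longrightarrow> u i \<in> span S"
  shows "\<exists>c. (\<exists>i\<in>I. c i \<noteq> 0) \<and> (\<Sum>i\<in>I. scale (c i) (u i)) = 0"
proof (cases "inj_on u I")
  case True
  have "dependent (u ` I)"
    using independent_span_bound[OF assms(2), of "u ` I"] assms(3,4) card_image[OF True] by fastforce
  then obtain g i where "i \<in> I" "g (u i) \<noteq> 0" "(\<Sum>v\<in>u ` I. scale (g v) v) = 0"
    using dependent_finite[of "u ` I"] assms(1) by auto
  then show ?thesis by (intro exI[of _ "g \<circ> u"]) (auto simp: sum.reindex[OF True])
next
  case False
  then obtain i j where ij: "i \<in> I" "j \<in> I" "i \<noteq> j" "u i = u j" by (auto simp: inj_on_def)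
  define c where "c k = (if k = i then 1 else 0) - (if k = j then 1 else 0 :: 'p padic)" for k
  have "(\<Sum>k\<in>I. scale (c k) (u k)) = (\<Sum>k\<in>I. if k = i then u k else 0) - (\<Sum>k\<in>I. if k = j then u k else 0)"
    unfolding sum_subtractf[symmetric] c_def by (rule sum.cong) auto
  also have "\<dots> = 0" using ij assms(1) by (simp add: sum.delta)
  finally show ?thesis using ij(1,3) by (intro exI[of _ c]) (auto simp: c_def)
qed

lemma zp_basis_scaled_mem_iff:
  assumes "length cs = length xs" "zp_basis scale (map2 (\<lambda>c x. scale (pp powi c) x) cs xs) L"
  shows "v \<in> L \<longleftrightarrow> (\<exists>t. (\<forall>i<length xs. t i \<in> Zp) \<and> v = (\<Sum>i<length xs. scale (t i * pp powi (cs ! i)) (xs ! i)))"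
  unfolding zp_basis_mem_iff[OF assms(2)] using assms(1) by simp

text \<open>
  Otherwise the span of the x_i with c_i \<le> k and the span of the y_j with d_j > k meet in a vector
  z which is primitive in M; but p^k z lies in L, so its coordinates with respect to the y_j are
  divisible by p.
\<close>

lemma card_elementary_divisors_le:
  assumes xs: "zp_basis scale xs M" and ys: "zp_basis scale ys M"
    and cs: "length cs = length xs" "zp_basis scale (map2 (\<lambda>c x. scale (pp powi c) x) cs xs) L"
    and ds: "length ds = length ys" "zp_basis scale (map2 (\<lambda>c x. scale (pp powi c) x) ds ys) L"
  shows "card {i. i < length cs \<and> cs ! i \<le> k} \<le> card {j. j < length ds \<and> ds ! j \<le> k}"
proof (rule ccontr)
  define N where "N = length xs"
  have N: "length ys = N" using zp_basis_length_unique[OF xs ys] by (simp add: N_def)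
  define C R where "C = {i. i < N \<and> cs ! i \<le> k}" and "R = {j. j < N \<and> \<not> ds ! j \<le> k}"
  assume "\<not> ?thesis"
  then have "card {j. j < N \<and> ds ! j \<le> k} < card C"
    using cs ds by (simp add: C_def N N_def[symmetric])
  moreover have "card {j. j < N \<and> ds ! j \<le> k} + card R = N"
  proof -
    have "card ({j. j < N \<and> ds ! j \<le> k} \<union> R) = card {j. j < N \<and> ds ! j \<le> k} + card R"
      by (rule card_Un_disjoint) (auto simp: R_def)
    also have "{j. j < N \<and> ds ! j \<le> k} \<union> R = {..<N}" by (auto simp: R_def)
    finally show ?thesis by simp
  qed
  \<comment> \<open>By the negated claim, the x_i with c_i \<le> k and the y_j with d_j > k are
    together more than N vectors in a space of dimension N.\<close>
  ultimately have card: "card (set xs) < card (Sum_Type.Plus C R)"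
    using xs by (simp add: card_Plus C_def R_def N_def zp_basis_iff distinct_card)
  have fin: "finite C" "finite R" by (simp_all add: C_def R_def)
  \<comment> \<open>The sign turns a relation into an equality between a combination of the x_i and
    one of the y_j.\<close>
  have in_span: "case_sum (\<lambda>i. xs ! i) (\<lambda>j. - ys ! j) i \<in> span (set xs)" if "i \<in> Sum_Type.Plus C R" for i
  proof (cases i)
    case (Inl i)
    then show ?thesis using that by (auto simp: C_def N_def intro: span_base)
  next
    case (Inr j)
    then have "ys ! j \<in> M"
      using that zp.span_base[of "ys ! j" "set ys"] ys by (auto simp: R_def N[symmetric] zp_basis_iff zp_span_def)
    then obtain c where "ys ! j = (\<Sum>i<length xs. scale (c i) (xs ! i))"
      using zp_basis_mem_iff[OF xs] by blast
    then show ?thesis unfolding Inr by (simp, intro span_neg span_sum span_scale span_base) simp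
  qed
  obtain g where g: "\<exists>i\<in>Sum_Type.Plus C R. g i \<noteq> 0"
    and rel: "(\<Sum>i\<in>Sum_Type.Plus C R. scale (g i) (case_sum (\<lambda>i. xs ! i) (\<lambda>j. - ys ! j) i)) = 0"
    using ex_linear_relation[where u = "case_sum (\<lambda>i. xs ! i) (\<lambda>j. - ys ! j)",
        OF finite_Plus[OF fin] finite_set card in_span]
    by (metis (lifting))
  define a b where "a i = (if i \<in> C then g (Inl i) else 0)" and "b j = (if j \<in> R then g (Inr j) else 0)" for i j
  have ab: "(\<Sum>i<N. scale (a i) (xs ! i)) = (\<Sum>j<N. scale (b j) (ys ! j))"
  proof -
    have "(\<Sum>i<N. scale (a i) (xs ! i)) = (\<Sum>i\<in>C. scale (g (Inl i)) (xs ! i))"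
      by (rule sum.mono_neutral_cong_right) (auto simp: a_def C_def)
    moreover have "(\<Sum>j<N. scale (b j) (ys ! j)) = (\<Sum>j\<in>R. scale (g (Inr j)) (ys ! j))"
      by (rule sum.mono_neutral_cong_right) (auto simp: b_def R_def)
    ultimately show ?thesis using rel fin by (simp add: sum.Plus sum_negf)
  qed
  have "\<exists>i\<in>C. a i \<noteq> 0"
  proof (rule ccontr)
    assume *: "\<not> ?thesis"
    then have "(\<Sum>j<N. scale (b j) (ys ! j)) = (\<Sum>j<N. scale 0 (ys ! j))"
      unfolding ab[symmetric] by (auto simp: a_def intro!: sum.neutral)
    then have b0: "b j = 0" if "j < N" for j
      using zp_basis_unique[OF ys, of b "\<lambda>_. 0" j] that by (simp add: N)
    have "g (Inr j) = 0" if "j \<in> R" for j using b0[of j] that by (simp add: b_def R_def)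
    moreover have "g (Inl i) = 0" if "i \<in> C" for i using * that by (auto simp: a_def)
    ultimately show False using g by auto
  qed
  then have "Min ((\<lambda>i. ord (a i)) ` {i \<in> C. a i \<noteq> 0}) \<in> (\<lambda>i. ord (a i)) ` {i \<in> C. a i \<noteq> 0}"
    using fin by (intro Min_in) auto
  then obtain i0 where i0: "i0 \<in> C" "a i0 \<noteq> 0"
    and i0_min: "ord (a i0) = Min ((\<lambda>i. ord (a i)) ` {i \<in> C. a i \<noteq> 0})"
    by force
  have min: "ord (a i0) \<le> ord (a i)" if "i \<in> C" "a i \<noteq> 0" for i
    unfolding i0_min using that fin by (intro Min_le) auto
  \<comment> \<open>Dividing the common vector by p^m makes its x-coordinates integral with a unit
    at \<open>i0\<close>: this is the primitive vector z.\<close>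
  define m where "m = ord (a i0)"
  have aZ: "vge (2 * m) (a i)" for i
  proof (cases "i \<in> C \<and> a i \<noteq> 0")
    case True
    with min[of i] show ?thesis by (simp add: vge_def m_def)
  qed (auto simp: a_def)
  have "scale (pp powi (k - m)) (\<Sum>i<N. scale (a i) (xs ! i)) \<in> L"
    unfolding zp_basis_scaled_mem_iff[OF cs]
  proof (intro exI conjI allI impI)
    show "pp powi (k - m - cs ! i) * a i \<in> Zp" for i
      unfolding Zp_iff_vge vge_mult_powi using aZ[of i] by (auto simp: vge_def a_def C_def)
    show "scale (pp powi (k - m)) (\<Sum>i<N. scale (a i) (xs ! i)) =
        (\<Sum>i<length xs. scale (pp powi (k - m - cs ! i) * a i * pp powi (cs ! i)) (xs ! i))"
      unfolding scale_sum_right N_def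
      by (rule sum.cong) (simp_all add: power_int_diff)
  qed
  then obtain t where t: "\<And>j. j < N \<Longrightarrow> t j \<in> Zp"
    and eq: "scale (pp powi (k - m)) (\<Sum>i<N. scale (a i) (xs ! i)) = (\<Sum>j<N. scale (t j * pp powi (ds ! j)) (ys ! j))"
    unfolding zp_basis_scaled_mem_iff[OF ds] N by blast
  have bt: "pp powi (k - m) * b j = t j * pp powi (ds ! j)" if "j < N" for j
  proof (rule zp_basis_unique[OF ys])
    show "(\<Sum>i<length ys. scale (pp powi (k - m) * b i) (ys ! i)) =
        (\<Sum>i<length ys. scale (t i * pp powi (ds ! i)) (ys ! i))"
      using eq unfolding ab scale_sum_right N by simp
  qed (simp add: N that)
  \<comment> \<open>Since d_j \<ge> k + 1 for j in \<open>R\<close>, each b j is divisible by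
    p^(m+1). So even p^(-m-1) times the common vector lies in M, although its coordinate at
    \<open>i0\<close> has valuation -1.\<close>
  have "scale (pp powi (- m - 1)) (\<Sum>i<N. scale (a i) (xs ! i)) \<in> M"
    unfolding zp_basis_mem_iff[OF ys]
  proof (intro exI conjI allI impI)
    show "pp powi (- m - 1) * b j \<in> Zp" if "j < length ys" for j
    proof (cases "j \<in> R")
      case True
      have "vge 0 (t j)" using t[of j] that by (simp add: N Zp_iff_vge)
      then have "vge (2 * (ds ! j)) (t j * pp powi (ds ! j))" by (simp add: vge_mult_powi_right)
      then have "vge (2 * (ds ! j)) (pp powi (k - m) * b j)" using that bt[of j] by (simp add: N)
      then have "vge (2 * (ds ! j) - 2 * (k - m)) (b j)" unfolding vge_mult_powi .
      then show ?thesis unfolding Zp_iff_vge vge_mult_powi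
        by (rule vge_mono) (use True in \<open>auto simp: R_def\<close>)
    qed (simp add: b_def)
    show "scale (pp powi (- m - 1)) (\<Sum>i<N. scale (a i) (xs ! i)) =
        (\<Sum>j<length ys. scale (pp powi (- m - 1) * b j) (ys ! j))"
      unfolding ab scale_sum_right N by simp
  qed
  then obtain c where c: "\<And>i. i < N \<Longrightarrow> c i \<in> Zp"
    and "scale (pp powi (- m - 1)) (\<Sum>i<N. scale (a i) (xs ! i)) = (\<Sum>i<N. scale (c i) (xs ! i))"
    unfolding zp_basis_mem_iff[OF xs] N_def by blast
  then have "pp powi (- m - 1) * a i0 = c i0"
    using zp_basis_unique[OF xs, of "\<lambda>i. pp powi (- m - 1) * a i" c i0] i0
    by (simp add: scale_sum_right N_def C_def)
  with c[of i0] i0 have "vge 0 (pp powi (- m - 1) * a i0)" by (simp add: Zp_iff_vge C_def)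
  with i0(2) show False unfolding vge_mult_powi by (simp add: vge_def m_def)
qed

lemma has_elementary_divisors_unique:
  assumes "has_elementary_divisors scale L M D" "has_elementary_divisors scale L M D'"
  shows "D = D'"
proof -
  obtain xs cs where xs: "zp_basis scale xs M"
    and cs: "length cs = length xs" "zp_basis scale (map2 (\<lambda>c x. scale (pp powi c) x) cs xs) L"
    and D: "D = mset (map (\<lambda>c. pp powi c) cs)"
    using assms(1) unfolding has_elementary_divisors_def by blast
  obtain ys ds where ys: "zp_basis scale ys M"
    and ds: "length ds = length ys" "zp_basis scale (map2 (\<lambda>c x. scale (pp powi c) x) ds ys) L"
    and D': "D' = mset (map (\<lambda>c. pp powi c) ds)"
    using assms(2) unfolding has_elementary_divisors_def by blast
  have "mset cs = mset ds"
    using card_elementary_divisors_le[OF xs ys cs ds] card_elementary_divisors_le[OF ys xs ds cs]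
    by (intro mset_eqI_card_le le_antisym)
  then show ?thesis unfolding D D' by simp
qed

lemma elementary_divisors_eqI:
  "has_elementary_divisors scale L M D \<Longrightarrow> elementary_divisors scale L M = D"
  unfolding elementary_divisors_def
  by (rule the_equality) (auto intro: has_elementary_divisors_unique)

lemma zp_basis_frame:
  assumes "frame n e f \<epsilon>"
  shows "zp_basis scale (map e [0..<n] @ map f [0..<n]) (Zspan n e f)"
  unfolding zp_basis_iff
  using independent_frame[OF assms] frame_inj[OF assms] zp_span_eq_Zspan[of e n f]
  by (simp add: distinct_map atLeast0LessThan)

lemma has_elementary_divisors_frame:
  assumes "frame n e f \<epsilon>"
  shows "has_elementary_divisors scale (Zspan n (scaled \<mu> e) (scaled \<nu> f))
    (Zspan n e f) (mset (map (\<lambda>c. pp powi c) (map \<mu> [0..<n] @ map \<nu> [0..<n])))"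
  unfolding has_elementary_divisors_def
proof (intro exI conjI)
  show "zp_basis scale (map e [0..<n] @ map f [0..<n]) (Zspan n e f)"
    by (rule zp_basis_frame[OF assms])
  have *: "map2 (\<lambda>c x. scale (pp powi c) x) (map \<mu> [0..<n] @ map \<nu> [0..<n]) (map e [0..<n] @ map f [0..<n]) =
      map (scaled \<mu> e) [0..<n] @ map (scaled \<nu> f) [0..<n]"
    by (simp add: map2_map_map)
  show "zp_basis scale (map2 (\<lambda>c x. scale (pp powi c) x) (map \<mu> [0..<n] @ map \<nu> [0..<n]) (map e [0..<n] @ map f [0..<n]))
      (Zspan n (scaled \<mu> e) (scaled \<nu> f))"
    unfolding * by (rule zp_basis_frame[OF frame_scale[OF assms]])
qed simp_all

lemma mset_map_powi_eq_iff:
  "mset (map (\<lambda>c. pp powi c :: 'p padic) cs) = mset (map (\<lambda>c. pp powi c) ds) \<longleftrightarrow> mset cs = mset ds"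
proof
  assume "mset (map (\<lambda>c. pp powi c :: 'p padic) cs) = mset (map (\<lambda>c. pp powi c) ds)"
  then have "image_mset ord (mset (map (\<lambda>c. pp powi c :: 'p padic) cs)) =
      image_mset ord (mset (map (\<lambda>c. pp powi c :: 'p padic) ds))" by simp
  then show "mset cs = mset ds" by (simp add: multiset.map_comp o_def)
qed simp

section \<open>Relative position of two lattices\<close>

lemma std_cases: "std a i \<in> {0, 1}"
  by (simp add: std_def)

lemma frame_cong:
  assumes "frame n e f \<epsilon>" "\<And>i. i < n \<Longrightarrow> \<epsilon> i = \<epsilon>' i"
  shows "frame n e f \<epsilon>'"
  using assms unfolding frame_def by auto

lemma Zspan_cong:
  assumes "\<And>i. i < n \<Longrightarrow> e i = e' i" "\<And>i. i < n \<Longrightarrow> f i = f' i"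
  shows "Zspan n e f = Zspan n e' f'"
proof -
  have "comb n e f c d = comb n e' f' c d" for c d by (rule comb_cong) (simp_all add: assms)
  then show ?thesis unfolding Zspan_def by simp
qed

lemma frame_permute:
  assumes fr: "frame n e f \<epsilon>" and \<sigma>: "bij_betw \<sigma> {..<n} {..<n}"
  shows "frame n (\<lambda>i. e (\<sigma> i)) (\<lambda>i. f (\<sigma> i)) (\<lambda>i. \<epsilon> (\<sigma> i))"
  unfolding frame_def
proof (intro allI impI)
  fix i j assume "i < n" "j < n"
  then have "\<sigma> i < n" "\<sigma> j < n" "\<sigma> i = \<sigma> j \<longleftrightarrow> i = j"
    using \<sigma> by (auto simp: bij_betw_def inj_on_def)
  then show "form (e (\<sigma> i)) (e (\<sigma> j)) = 0 \<and> form (f (\<sigma> i)) (f (\<sigma> j)) = 0 \<and>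
      form (e (\<sigma> i)) (f (\<sigma> j)) = (if i = j then pp powi \<epsilon> (\<sigma> i) else 0)"
    by (simp add: frameD[OF fr])
qed

lemma span_permute:
  assumes \<sigma>: "bij_betw \<sigma> {..<n} {..<n}"
  shows "Zspan n (\<lambda>i. e (\<sigma> i)) (\<lambda>i. f (\<sigma> i)) = Zspan n e f"
    and "Qspan n (\<lambda>i. e (\<sigma> i)) (\<lambda>i. f (\<sigma> i)) = Qspan n e f"
proof -
  have "(\<lambda>i. g (\<sigma> i)) ` {..<n} = g ` {..<n}" for g :: "nat \<Rightarrow> 'v"
    using \<sigma> by (simp add: bij_betw_def image_image[symmetric])
  then show "Zspan n (\<lambda>i. e (\<sigma> i)) (\<lambda>i. f (\<sigma> i)) = Zspan n e f"
    "Qspan n (\<lambda>i. e (\<sigma> i)) (\<lambda>i. f (\<sigma> i)) = Qspan n e f"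
    by (simp_all only: zp_span_eq_Zspan[symmetric] Qspan_eq_span)
qed

definition swap_l :: "(nat \<Rightarrow> bool) \<Rightarrow> (nat \<Rightarrow> 'v) \<Rightarrow> (nat \<Rightarrow> 'v) \<Rightarrow> nat \<Rightarrow> 'v"
  where "swap_l s e f i = (if s i then f i else e i)"

text \<open>The sign keeps the Gram matrix: the pairing of f i with - e i is that of e i with f
  i.\<close>

definition swap_r :: "(nat \<Rightarrow> bool) \<Rightarrow> (nat \<Rightarrow> 'v) \<Rightarrow> (nat \<Rightarrow> 'v) \<Rightarrow> nat \<Rightarrow> 'v"
  where "swap_r s e f i = (if s i then - e i else f i)"

lemma frame_swap:
  assumes "frame n e f \<epsilon>"
  shows "frame n (swap_l s e f) (swap_r s e f) \<epsilon>"
  unfolding frame_def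
proof (intro allI impI)
  fix i j assume "i < n" "j < n"
  then show "form (swap_l s e f i) (swap_l s e f j) = 0 \<and> form (swap_r s e f i) (swap_r s e f j) = 0 \<and>
      form (swap_l s e f i) (swap_r s e f j) = (if i = j then pp powi \<epsilon> i else 0)"
    by (auto simp: swap_l_def swap_r_def form_uminus frameD[OF assms])
qed

lemma Zspan_uminus: "v \<in> Zspan n e f \<Longrightarrow> - v \<in> Zspan n e f"
  using Zspan_scale[of "- 1" v n e f] by simp

lemma Zspan_swap: "Zspan n (swap_l s e f) (swap_r s e f) = Zspan n e f"
proof (rule subset_antisym)
  show "Zspan n (swap_l s e f) (swap_r s e f) \<subseteq> Zspan n e f"
    by (rule Zspan_subset) (simp_all add: swap_l_def swap_r_def basis_in_Zspan Zspan_uminus)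
  show "Zspan n e f \<subseteq> Zspan n (swap_l s e f) (swap_r s e f)"
  proof (rule Zspan_subset)
    fix i assume i: "i < n"
    note b = basis_in_Zspan(1)[OF i, of "swap_l s e f" "swap_r s e f"]
      basis_in_Zspan(2)[OF i, of "swap_r s e f" "swap_l s e f"]
    show "e i \<in> Zspan n (swap_l s e f) (swap_r s e f)" "f i \<in> Zspan n (swap_l s e f) (swap_r s e f)"
      using b Zspan_uminus[OF b(2)] by (cases "s i"; simp add: swap_l_def swap_r_def)+
  qed
qed

lemma Qspan_swap: "Qspan n (swap_l s e f) (swap_r s e f) = Qspan n e f"
proof (rule subset_antisym)
  show "Qspan n (swap_l s e f) (swap_r s e f) \<subseteq> Qspan n e f"
    by (rule Qspan_subset[OF subspace_Qspan])
      (simp_all add: swap_l_def swap_r_def basis_in_Qspan subspace_neg[OF subspace_Qspan])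
  show "Qspan n e f \<subseteq> Qspan n (swap_l s e f) (swap_r s e f)"
    by (intro Qspan_subset[OF subspace_Qspan] subsetD[OF Zspan_subset_Qspan])
      (simp_all add: Zspan_swap basis_in_Zspan)
qed

text \<open>The coordinates of v in the scaled basis are its pairings with the original one, up to
  sign. The dual is taken inside the span, because in the polynomial model the radical of the form
  would enter it otherwise.\<close>

lemma dual_frame_eq:
  assumes fr: "frame n e f \<epsilon>"
  shows "{v \<in> Qspan n e f. \<forall>w\<in>Zspan n e f. form v w \<in> Zp} =
    Zspan n (scaled (\<lambda>i. - \<epsilon> i) e) (scaled (\<lambda>i. - \<epsilon> i) f)"
    (is "?D = Zspan n ?e ?f")
proof (intro equalityI subsetI)
  have comb: "comb n ?e ?f c d = comb n e f (\<lambda>i. c i * pp powi (- \<epsilon> i)) (\<lambda>i. d i * pp powi (- \<epsilon> i))" for c d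
    by (rule comb_cong) simp_all
  {
    fix v assume "v \<in> ?D"
    then have v: "v \<in> Qspan n e f" and int: "\<And>w. w \<in> Zspan n e f \<Longrightarrow> form v w \<in> Zp" by blast+
    have "form (e i) v \<in> Zp" "form v (f i) \<in> Zp" if "i < n" for i
      using int[OF basis_in_Zspan(1)[OF that]] int[OF basis_in_Zspan(2)[OF that]] form_swap[of "e i" v] by auto
    then have "comb n ?e ?f (\<lambda>i. form v (f i)) (\<lambda>i. form (e i) v) \<in> Zspan n ?e ?f"
      by (intro comb_in_Zspan)
    then show "v \<in> Zspan n ?e ?f" unfolding comb comb_coordinates[OF fr v, symmetric] .
  next
    fix v assume "v \<in> Zspan n ?e ?f"
    then obtain c d where v: "v = comb n ?e ?f c d" and cd: "\<forall>i<n. c i \<in> Zp \<and> d i \<in> Zp"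
      unfolding Zspan_def by blast
    have "form v w \<in> Zp" if w: "w \<in> Zspan n e f" for w
    proof -
      obtain c' d' where w: "w = comb n e f c' d'" and cd': "\<forall>i<n. c' i \<in> Zp \<and> d' i \<in> Zp"
        using w unfolding Zspan_def by blast
      have "form v w = (\<Sum>i<n. c i * d' i - d i * c' i)"
        unfolding v comb w form_comb(3)[OF fr]
        by (intro sum.cong refl) (simp add: power_int_minus field_simps)
      also have "\<dots> \<in> Zp" using cd cd' by (intro Zp_sum) simp
      finally show ?thesis .
    qed
    then show "v \<in> ?D" unfolding v comb by simp
  }
qed

lemma dual_frame_unique:
  assumes "frame n e f \<epsilon>" "frame n' e' f' \<epsilon>'" "Qspan n e f = Qspan n' e' f'" "Zspan n e f = Zspan n' e' f'"
  shows "Zspan n (scaled (\<lambda>i. - \<epsilon> i) e) (scaled (\<lambda>i. - \<epsilon> i) f) =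
    Zspan n' (scaled (\<lambda>i. - \<epsilon>' i) e') (scaled (\<lambda>i. - \<epsilon>' i) f')"
  using dual_frame_eq[OF assms(1)] dual_frame_eq[OF assms(2)] assms(3,4) by simp

lemma has_elementary_divisors_dual:
  assumes "frame n e f \<epsilon>"
  shows "has_elementary_divisors scale
    (Zspan n (scaled \<mu> e) (scaled \<nu> f))
    (Zspan n (scaled (\<lambda>i. - \<epsilon> i) e) (scaled (\<lambda>i. - \<epsilon> i) f))
    (mset (map (\<lambda>c. pp powi c) (map (\<lambda>i. \<mu> i + \<epsilon> i) [0..<n] @ map (\<lambda>i. \<nu> i + \<epsilon> i) [0..<n])))"
  using has_elementary_divisors_frame[OF frame_scale[OF assms, of "\<lambda>i. - \<epsilon> i" "\<lambda>i. - \<epsilon> i"],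
      of "\<lambda>i. \<mu> i + \<epsilon> i" "\<lambda>i. \<nu> i + \<epsilon> i"]
  by (simp flip: power_int_add)

text \<open>The elementary divisors of the lattice relative to its dual are the p^(\<epsilon> i),
  each occurring twice, and these do not depend on the frame.\<close>

lemma unimodular_rank_unique:
  assumes "frame n e f \<epsilon>" "frame n' e' f' \<epsilon>'" "Qspan n e f = Qspan n' e' f'" "Zspan n e f = Zspan n' e' f'"
  shows "card {i. i < n \<and> \<epsilon> i = 0} = card {i. i < n' \<and> \<epsilon>' i = 0}"
proof -
  have ed: "has_elementary_divisors scale (Zspan n e f)
      (Zspan n (scaled (\<lambda>i. - \<epsilon> i) e) (scaled (\<lambda>i. - \<epsilon> i) f))
      (mset (map (\<lambda>c. pp powi c) (map \<epsilon> [0..<n] @ map \<epsilon> [0..<n])))" if "frame n e f \<epsilon>" for n e f \<epsilon>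
    using has_elementary_divisors_dual[OF that, of "\<lambda>_. 0" "\<lambda>_. 0"] by simp
  have "mset (map \<epsilon> [0..<n] @ map \<epsilon> [0..<n]) = mset (map \<epsilon>' [0..<n'] @ map \<epsilon>' [0..<n'])"
    using has_elementary_divisors_unique[OF ed[OF assms(1)]
        ed[OF assms(2), folded assms(4) dual_frame_unique[OF assms]]]
    unfolding mset_map_powi_eq_iff .
  moreover have "count (mset (map g [0..<k] @ map g [0..<k])) (0::int) = 2 * card {i. i < k \<and> g i = 0}" for g k
  proof -
    have "count (mset (map g [0..<k])) 0 = card {i. i < k \<and> g i = 0}"
    proof (induction k)
      case (Suc k)
      have "{i. i < Suc k \<and> g i = 0} =
          (if g k = 0 then insert k {i. i < k \<and> g i = 0} else {i. i < k \<and> g i = 0})"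
        by (auto simp: less_Suc_eq)
      with Suc show ?case by simp
    qed simp
    then show ?thesis by simp
  qed
  ultimately have "2 * card {i. i < n \<and> \<epsilon> i = 0} = 2 * card {i. i < n' \<and> \<epsilon>' i = 0}" by metis
  then show ?thesis by simp
qed

lemma rep_lattice_eq_Zspan:
  "rep_lattice scale e f n a t = Zspan n (scaled ((!) (snd (snd t))) e) (scaled (nu a t) f)"
  unfolding zp_span_eq_Zspan[symmetric] by (cases t) (simp add: rep_lattice_def nu_def)

theorem relative_position:
  assumes fr: "frame n e f (std a)" and fr': "frame n' e' f' (std a')"
    and span: "Qspan n e f = Qspan n' e' f'" and ab: "a + b = n" "a' + b' = n'"
  obtains x y t where "frame n x y (std a)" "Qspan n x y = Qspan n e f" "Zspan n x y = Zspan n e f"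
    "t \<in> params n a b a' b'" "rep_lattice scale x y n a t = Zspan n' e' f'"
proof -
  obtain x y \<eta> \<mu> \<nu> where xy: "frame n x y \<eta>" "Qspan n x y = Qspan n e f"
    and \<eta>': "\<forall>i<n. \<eta> i \<in> {0, 1}" "\<forall>i<n. \<eta> i + \<mu> i + \<nu> i \<in> {0, 1}"
    and Z: "Zspan n x y = Zspan n e f"
    and Z': "Zspan n (scaled \<mu> x) (scaled \<nu> y) = Zspan n' e' f'"
    using common_frame[OF fr fr' span std_cases std_cases] .
  have \<eta>: "\<eta> i \<in> {0, 1}" "\<eta> i + \<mu> i + \<nu> i \<in> {0, 1}" if "i < n" for i
    using \<eta>' that by blast+
  \<comment> \<open>Swapping the vectors of a plane makes M the larger exponent. With \<eta> and
    \<eta> + M + N in {0, 1}, the sum M + N is 1 if the plane is unimodular in the first and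
    p-modular in the second lattice, and 0 or -1 otherwise. Hence M \<ge> 1 in the first case and M
    \<ge> 0 in the others: these are the lower bounds in \<open>params\<close>.\<close>
  define s where "s i \<longleftrightarrow> \<mu> i < \<nu> i" for i
  define X Y where "X = swap_l s x y" and "Y = swap_r s x y"
  define M N where "M i = max (\<mu> i) (\<nu> i)" and "N i = min (\<mu> i) (\<nu> i)" for i
  have XY: "frame n X Y \<eta>" "Qspan n X Y = Qspan n e f" "Zspan n X Y = Zspan n e f"
    unfolding X_def Y_def using frame_swap[OF xy(1)] xy(2) Z by (simp_all add: Zspan_swap Qspan_swap)
  have "(scaled M X) = swap_l s (scaled \<mu> x) (scaled \<nu> y)"
    "(scaled N Y) = swap_r s (scaled \<mu> x) (scaled \<nu> y)"
    by (auto simp: fun_eq_iff X_def Y_def M_def N_def swap_l_def swap_r_def s_def)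
  then have XY': "Zspan n (scaled M X) (scaled N Y) = Zspan n' e' f'"
    using Z' by (simp add: Zspan_swap)
  have MN: "M i \<ge> N i" "\<eta> i + M i + N i \<in> {0, 1}" if "i < n" for i
    using \<eta>(2)[OF that] by (auto simp: M_def N_def max_def min_def)
  have n: "n = n'" using frame_rank_unique[OF fr fr' span] .
  \<comment> \<open>The planes of type p in the first and type q in the second lattice, by
    increasing M. The four lists are joined in the order used by \<open>blocks\<close>.\<close>
  define sel where "sel p q = sort_key M (filter (\<lambda>i. \<eta> i = p \<and> \<eta> i + M i + N i = q) [0..<n])" for p q
  define idx where "idx = sel 0 1 @ sel 0 0 @ sel 1 0 @ sel 1 1"
  have sel: "set (sel p q) = {i. i < n \<and> \<eta> i = p \<and> \<eta> i + M i + N i = q}" "distinct (sel p q)" for p q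
    by (auto simp: sel_def)
  have idx: "distinct idx" "set idx = {..<n}"
    using \<eta>(1) MN(2) by (auto simp: idx_def sel)
  then have len: "length idx = n" using distinct_card[OF idx(1)] by simp
  define \<sigma> where "\<sigma> i = idx ! i" for i
  have \<sigma>: "bij_betw \<sigma> {..<n} {..<n}"
    unfolding \<sigma>_def by (rule bij_betw_nth[OF idx(1)]) (simp_all add: len idx)
  define t where "t = blocks (map M (sel 0 1)) (map M (sel 0 0)) (map M (sel 1 0)) (map M (sel 1 1))"
  have card_sel: "length (sel p 0) + length (sel p 1) = card {i. i < n \<and> \<eta> i = p}"
    "length (sel 0 q) + length (sel 1 q) = card {i. i < n \<and> \<eta> i + M i + N i = q}" for p q
  proof -
    have l: "length (sel p q) = card (set (sel p q))" for p q using distinct_card[OF sel(2)] by simp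
    have "card (set (sel p 0) \<union> set (sel p 1)) = card (set (sel p 0)) + card (set (sel p 1))"
      "card (set (sel 0 q) \<union> set (sel 1 q)) = card (set (sel 0 q)) + card (set (sel 1 q))"
      by (rule card_Un_disjoint; auto simp: sel)+
    moreover have "set (sel p 0) \<union> set (sel p 1) = {i. i < n \<and> \<eta> i = p}"
      "set (sel 0 q) \<union> set (sel 1 q) = {i. i < n \<and> \<eta> i + M i + N i = q}"
      unfolding sel using \<eta>(1) MN(2) by auto
    ultimately show "length (sel p 0) + length (sel p 1) = card {i. i < n \<and> \<eta> i = p}"
      "length (sel 0 q) + length (sel 1 q) = card {i. i < n \<and> \<eta> i + M i + N i = q}"
      unfolding l by simp_all
  qed
  have card_std: "card {i. i < k \<and> std c i = 0} = c" if "c \<le> k" for c k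
  proof -
    have "{i. i < k \<and> std c i = 0} = {..<c}" using that by (auto simp: std_def)
    then show ?thesis by simp
  qed
  \<comment> \<open>The number of unimodular planes is an invariant of each lattice, so it can be
    counted in the common frame instead of the given one.\<close>
  have A: "length (sel 0 1) + length (sel 0 0) = a"
    using unimodular_rank_unique[OF XY(1) fr XY(2,3)] card_std[of a n] card_sel(1)[of 0] ab by simp
  have "Qspan n (scaled M X) (scaled N Y) = Qspan n' e' f'"
    using XY(2) span by (simp add: Qspan_scale)
  then have A': "length (sel 0 0) + length (sel 1 0) = a'"
    using unimodular_rank_unique[OF frame_scale[OF XY(1)] fr' _ XY'] card_std[of a' n'] card_sel(2)[of 0] ab by simp
  have B: "length (sel 1 0) + length (sel 1 1) = b" "length (sel 0 1) + length (sel 1 1) = b'"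
    using A A' len ab n by (simp_all add: idx_def)
  have sge: "sorted_ge c (map M (sel p q))"
    if "\<And>i. i < n \<Longrightarrow> \<eta> i = p \<Longrightarrow> \<eta> i + M i + N i = q \<Longrightarrow> c \<le> M i" for c p q
    using that sel(1)[of p q] by (auto simp: sorted_ge_def sel_def)
  have "t \<in> params n a b a' b'"
    unfolding params_iff_blocks[OF ab(1)]
  proof (intro exI conjI)
    show "t = blocks (map M (sel 0 1)) (map M (sel 0 0)) (map M (sel 1 0)) (map M (sel 1 1))" by (fact t_def)
    show "sorted_ge 1 (map M (sel 0 1))" "sorted_ge 0 (map M (sel 0 0))" "sorted_ge 0 (map M (sel 1 0))"
      "sorted_ge 0 (map M (sel 1 1))"
      by (rule sge, use MN(1) in force)+
  qed (simp_all add: A A' B)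
  have \<eta>\<sigma>: "\<eta> (\<sigma> i) = std a i" if "i < n" for i
  proof -
    define P Q where "P = sel 0 1 @ sel 0 0" and "Q = sel 1 0 @ sel 1 1"
    have P: "length P = a" "\<And>j. j \<in> set P \<Longrightarrow> \<eta> j = 0" and Q: "length Q = b" "\<And>j. j \<in> set Q \<Longrightarrow> \<eta> j = 1"
      using A B(1) by (auto simp: P_def Q_def sel)
    have "idx = P @ Q" by (simp add: idx_def P_def Q_def)
    then have \<sigma>i: "\<sigma> i = (if i < a then P ! i else Q ! (i - a))"
      by (simp add: \<sigma>_def nth_append P(1))
    show ?thesis
    proof (cases "i < a")
      case True
      then have "P ! i \<in> set P" using P(1) by simp
      then show ?thesis using P(2) True \<sigma>i by (simp add: std_def)
    next
      case False
      then have "Q ! (i - a) \<in> set Q" using Q(1) ab(1) \<open>i < n\<close> by simp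
      then show ?thesis using Q(2) False \<sigma>i by (simp add: std_def)
    qed
  qed
  have t_mu: "snd (snd t) ! i = M (\<sigma> i)" if "i < n" for i
  proof -
    have "snd (snd t) = map M idx" by (simp add: t_def blocks_def idx_def)
    then show ?thesis using that len by (simp add: \<sigma>_def)
  qed
  have t_nu: "nu a t i = N (\<sigma> i)" if "i < n" for i
  proof -
    have "map (nu a t) [0..<n] = map N idx"
      unfolding t_def idx_def by (subst nu_blocks(1)[where b = b]) (auto simp: A B ab sel)
    then have "map (nu a t) [0..<n] ! i = map N idx ! i" by simp
    then show ?thesis using that len by (simp add: \<sigma>_def)
  qed
  show thesis
  proof (rule that)
    show "frame n (\<lambda>i. X (\<sigma> i)) (\<lambda>i. Y (\<sigma> i)) (std a)"
      using frame_permute[OF XY(1) \<sigma>] by (rule frame_cong) (rule \<eta>\<sigma>)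
    show "Qspan n (\<lambda>i. X (\<sigma> i)) (\<lambda>i. Y (\<sigma> i)) = Qspan n e f" "Zspan n (\<lambda>i. X (\<sigma> i)) (\<lambda>i. Y (\<sigma> i)) = Zspan n e f"
      using span_permute[OF \<sigma>] XY(2,3) by simp_all
    show "t \<in> params n a b a' b'" by fact
    have "rep_lattice scale (\<lambda>i. X (\<sigma> i)) (\<lambda>i. Y (\<sigma> i)) n a t =
        Zspan n (\<lambda>i. scale (pp powi M (\<sigma> i)) (X (\<sigma> i))) (\<lambda>i. scale (pp powi N (\<sigma> i)) (Y (\<sigma> i)))"
      unfolding rep_lattice_eq_Zspan by (rule Zspan_cong) (simp_all add: t_mu t_nu)
    also have "\<dots> = Zspan n' e' f'" unfolding XY'[symmetric] by (rule span_permute(1)[OF \<sigma>])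
    finally show "rep_lattice scale (\<lambda>i. X (\<sigma> i)) (\<lambda>i. Y (\<sigma> i)) n a t = Zspan n' e' f'" .
  qed
qed

lemma has_elementary_divisors_rep_lattice:
  assumes "frame n e f (std a)"
  shows "has_elementary_divisors scale (rep_lattice scale e f n a t) (Zspan n e f)
      (mset (map (\<lambda>c. pp powi c) (exponents n a t)))"
    and "has_elementary_divisors scale (rep_lattice scale e f n a t)
      (Zspan n (scaled (\<lambda>i. - std a i) e) (scaled (\<lambda>i. - std a i) f))
      (mset (map (\<lambda>c. pp powi c) (dual_exponents n a t)))"
  unfolding rep_lattice_eq_Zspan exponents_def dual_exponents_def
  by (rule has_elementary_divisors_frame[OF assms], rule has_elementary_divisors_dual[OF assms])

text \<open>Two different frames of the same lattice are allowed, as both lists of elementary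
  divisors depend only on that lattice and its dual. In this form the result applies to the image of
  a frame under a stabilizing isometry or matrix.\<close>

theorem rep_lattice_inj:
  assumes fr: "frame n e f (std a)" and fr': "frame n x y (std a)"
    and span: "Qspan n e f = Qspan n x y" "Zspan n e f = Zspan n x y" and ab: "a + b = n"
    and t: "t \<in> params n a b c d" "t' \<in> params n a b c' d'"
    and eq: "rep_lattice scale e f n a t = rep_lattice scale x y n a t'"
  shows "t = t'"
proof (rule params_unique[OF ab t])
  note ed = has_elementary_divisors_rep_lattice
  show "mset (exponents n a t) = mset (exponents n a t')"
    using has_elementary_divisors_unique[OF ed(1)[OF fr, of t] ed(1)[OF fr', of t', folded eq span(2)]]
    unfolding mset_map_powi_eq_iff .
  show "mset (dual_exponents n a t) = mset (dual_exponents n a t')"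
    using has_elementary_divisors_unique[OF ed(2)[OF fr, of t]
        ed(2)[OF fr', of t', folded eq dual_frame_unique[OF fr fr' span]]]
    unfolding mset_map_powi_eq_iff .
qed

section \<open>Linear images of lattices, and the type of the representatives\<close>

lemma linear_image_comb:
  assumes "Vector_Spaces.linear scale scale g"
  shows "g (comb n e f c d) = comb n (\<lambda>i. g (e i)) (\<lambda>i. g (f i)) c d"
proof -
  have add: "g (u + v) = g u + g v" and sc: "g (scale k u) = scale k (g u)" for u v k
    using assms by (simp_all add: Vector_Spaces.linear_iff)
  have "g 0 = 0" using sc[of 0 0] by simp
  then have "g (sum h I) = (\<Sum>i\<in>I. g (h i))" for h :: "nat \<Rightarrow> 'v" and I
    by (induction I rule: infinite_finite_induct) (simp_all add: add)
  then show ?thesis unfolding comb_def by (simp add: add sc)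
qed

lemma linear_image_Zspan:
  assumes "Vector_Spaces.linear scale scale g"
  shows "g ` Zspan n e f = Zspan n (\<lambda>i. g (e i)) (\<lambda>i. g (f i))"
proof (intro equalityI subsetI)
  fix v assume "v \<in> g ` Zspan n e f"
  then obtain c d where "v = g (comb n e f c d)" "\<forall>i<n. c i \<in> Zp \<and> d i \<in> Zp"
    unfolding Zspan_def by blast
  then show "v \<in> Zspan n (\<lambda>i. g (e i)) (\<lambda>i. g (f i))"
    by (simp add: linear_image_comb[OF assms] comb_in_Zspan)
next
  fix v assume "v \<in> Zspan n (\<lambda>i. g (e i)) (\<lambda>i. g (f i))"
  then obtain c d where "v = g (comb n e f c d)" "\<forall>i<n. c i \<in> Zp \<and> d i \<in> Zp"
    unfolding Zspan_def linear_image_comb[OF assms, symmetric] by blast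
  then show "v \<in> g ` Zspan n e f" by (simp add: comb_in_Zspan)
qed

lemma linear_image_rep_lattice:
  assumes "Vector_Spaces.linear scale scale g"
  shows "g ` rep_lattice scale e f n a t = rep_lattice scale (\<lambda>i. g (e i)) (\<lambda>i. g (f i)) n a t"
  using assms unfolding rep_lattice_eq_Zspan linear_image_Zspan[OF assms]
  by (simp add: Vector_Spaces.linear_iff)

lemma ex_std_frame:
  assumes fr: "frame n e f \<epsilon>" and \<epsilon>: "\<And>i. i < n \<Longrightarrow> \<epsilon> i \<in> {0, 1}"
    and card: "card {i. i < n \<and> \<epsilon> i = 0} = a"
  obtains x y where "frame n x y (std a)" "Zspan n x y = Zspan n e f" "Qspan n x y = Qspan n e f"
proof -
  define P Q where "P = filter (\<lambda>i. \<epsilon> i = 0) [0..<n]" and "Q = filter (\<lambda>i. \<epsilon> i = 1) [0..<n]"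
  have PQ: "distinct (P @ Q)" "set (P @ Q) = {..<n}"
    using \<epsilon> by (auto simp: P_def Q_def)
  have len: "length (P @ Q) = n" using distinct_card[OF PQ(1)] unfolding PQ(2) by simp
  have "length P = card (set P)" using PQ(1) by (simp add: distinct_card)
  also have "set P = {i. i < n \<and> \<epsilon> i = 0}" by (auto simp: P_def)
  finally have P: "length P = a" using card by simp
  define \<sigma> where "\<sigma> i = (P @ Q) ! i" for i
  have \<sigma>: "bij_betw \<sigma> {..<n} {..<n}"
    unfolding \<sigma>_def by (rule bij_betw_nth[OF PQ(1)]) (simp_all only: len PQ(2))
  have "\<epsilon> (\<sigma> i) = std a i" if "i < n" for i
  proof (cases "i < a")
    case True
    then have "P ! i \<in> set P" using P by simp
    then show ?thesis using True P by (simp add: \<sigma>_def nth_append std_def P_def)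
  next
    case False
    then have "Q ! (i - a) \<in> set Q" using len P that by simp
    then show ?thesis using False P by (simp add: \<sigma>_def nth_append std_def Q_def)
  qed
  then have "frame n (\<lambda>i. e (\<sigma> i)) (\<lambda>i. f (\<sigma> i)) (std a)"
    by (rule frame_cong[OF frame_permute[OF fr \<sigma>]])
  with span_permute[OF \<sigma>] that show thesis by blast
qed

lemma frame_rep_lattice:
  assumes fr: "frame n e f (std a)" and ab: "a + b = n" and t: "t \<in> params n a b a' b'"
  obtains x y where "frame n x y (std a')" "Zspan n x y = rep_lattice scale e f n a t"
    "Qspan n x y = Qspan n e f"
proof -
  obtain rm rp \<mu> where t_eq: "t = (rm, rp, \<mu>)" by (cases t)
  \<comment> \<open>The type of the i-th plane in L: 0 exactly on the two middle blocks, an interval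
    of length a - r_- + r_+ = a'.\<close>
  define \<eta> where "\<eta> i = std a i + \<mu> ! i + nu a t i" for i
  have rp: "rm \<le> a" "rp \<le> b" "a' + rm = a + rp" using t by (auto simp: t_eq params_def)
  have \<eta>: "\<eta> i = (if i < rm then 1 else if i < a + rp then 0 else 1)" for i
    using rp by (simp add: \<eta>_def std_def nu_def t_eq)
  have "{i. i < n \<and> \<eta> i = 0} = {rm..<a + rp}" using rp ab by (auto simp: \<eta>)
  then have card: "card {i. i < n \<and> \<eta> i = 0} = a'" using rp by simp
  have fr': "frame n (\<lambda>i. scale (pp powi (\<mu> ! i)) (e i)) (scaled (nu a t) f) \<eta>"
    unfolding \<eta>_def by (rule frame_scale[OF fr])
  have "\<eta> i \<in> {0, 1}" for i by (simp add: \<eta>)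
  from ex_std_frame[OF fr' this card] obtain x y where "frame n x y (std a')"
    "Zspan n x y = Zspan n (\<lambda>i. scale (pp powi (\<mu> ! i)) (e i)) (scaled (nu a t) f)"
    "Qspan n x y = Qspan n (\<lambda>i. scale (pp powi (\<mu> ! i)) (e i)) (scaled (nu a t) f)" .
  then show thesis using that by (simp add: rep_lattice_eq_Zspan t_eq Qspan_scale)
qed

section \<open>Hyperbolic sums as lattices of standard frames\<close>

lemma hyperbolic_sum_frame:
  assumes fr: "frame n e f (std a)" and ab: "a + b = n"
  shows "hyperbolic_sum scale form a b (Zspan n e f)"
proof -
  define P where "P i = Zspan 1 (\<lambda>_. e i) (\<lambda>_. f i)" for i
  have plane: "hyperbolic_plane scale form (pp powi (std a i)) (P i)" if i: "i < n" for i
    unfolding hyperbolic_plane_def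
  proof (intro exI conjI)
    have "frame 1 (\<lambda>_. e i) (\<lambda>_. f i) (\<lambda>_. std a i)"
      unfolding frame_def using frameD[OF fr i i] by simp
    from zp_basis_frame[OF this] show "zp_basis scale [e i, f i] (P i)" by (simp add: P_def)
    show "form (e i) (f i) = pp powi (std a i)" using frameD(3)[OF fr i i] by simp
  qed
  have orth: "form u v = 0" if "i < n" "j < n" "i \<noteq> j" "u \<in> P i" "v \<in> P j" for i j u v
    using that(4,5) unfolding P_def
    by (elim ZspanE) (simp add: comb_def form_add_left form_add_right form_scale_left form_scale_right
        frameD[OF fr that(1,2)] that(3))
  have "Zspan n e f = zp_span scale (\<Union>i<n. P i)"
    unfolding zp_span_def
  proof (rule subset_antisym)
    have "e ` {..<n} \<union> f ` {..<n} \<subseteq> (\<Union>i<n. P i)"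
      using basis_in_Zspan[of 0 1 "\<lambda>_. _" "\<lambda>_. _"] by (auto simp: P_def)
    then show "Zspan n e f \<subseteq> zp.span (\<Union>i<n. P i)"
      unfolding zp_span_eq_Zspan[symmetric] zp_span_def by (rule zp.span_mono)
    show "zp.span (\<Union>i<n. P i) \<subseteq> Zspan n e f"
    proof (rule zp.span_minimal)
      show "(\<Union>i<n. P i) \<subseteq> Zspan n e f"
        unfolding P_def by (intro UN_least Zspan_subset) (simp_all add: basis_in_Zspan)
      show "zp.subspace (Zspan n e f)"
        by (rule zp.subspaceI) (simp_all add: zp_scale_def Zspan_add Zspan_scale Zp_def)
    qed
  qed
  moreover have "hyperbolic_plane scale form 1 (P i)" if "i < a" for i
    using plane[of i] that ab by (simp add: std_def)
  moreover have "hyperbolic_plane scale form pp (P i)" if "a \<le> i" "i < a + b" for i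
    using plane[of i] that ab by (simp add: std_def)
  moreover have "\<forall>i<a + b. \<forall>j<a + b. i \<noteq> j \<longrightarrow> (\<forall>u\<in>P i. \<forall>v\<in>P j. form u v = 0)"
    using orth ab by blast
  ultimately show ?thesis
    unfolding hyperbolic_sum_def using ab by (intro exI[of _ P]) simp
qed

lemma zp_span_pair: "zp_span scale {u, v} = Zspan 1 (\<lambda>_. u) (\<lambda>_. v)"
proof -
  have "(\<lambda>_. u) ` {..<1::nat} \<union> (\<lambda>_. v) ` {..<1::nat} = {u, v}" by auto
  then show ?thesis using zp_span_eq_Zspan[of "\<lambda>_. u" 1 "\<lambda>_. v"] by metis
qed

lemma hyperbolic_sumE:
  assumes "hyperbolic_sum scale form a b L"
  obtains e f where "frame (a + b) e f (std a)" "L = Zspan (a + b) e f"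
proof -
  obtain P where 1: "\<And>i. i < a \<Longrightarrow> hyperbolic_plane scale form 1 (P i)"
    and p: "\<And>i. a \<le> i \<Longrightarrow> i < a + b \<Longrightarrow> hyperbolic_plane scale form pp (P i)"
    and orth: "\<And>i j u v. i < a + b \<Longrightarrow> j < a + b \<Longrightarrow> i \<noteq> j \<Longrightarrow> u \<in> P i \<Longrightarrow> v \<in> P j \<Longrightarrow> form u v = 0"
    and L: "L = zp.span (\<Union>i<a + b. P i)"
    using assms unfolding hyperbolic_sum_def zp_span_def by blast
  have "\<exists>e f. i < a + b \<longrightarrow> zp_basis scale [e, f] (P i) \<and> form e f = pp powi (std a i)" for i
  proof (cases "i < a")
    case True
    then show ?thesis using 1[OF True] unfolding hyperbolic_plane_def by (auto simp: std_def)
  next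
    case False
    then show ?thesis using p[of i] unfolding hyperbolic_plane_def by (auto simp: std_def)
  qed
  then obtain e f where b: "\<And>i. i < a + b \<Longrightarrow> zp_basis scale [e i, f i] (P i)"
    and ef: "\<And>i. i < a + b \<Longrightarrow> form (e i) (f i) = pp powi (std a i)" by metis
  have P: "P i = Zspan 1 (\<lambda>_. e i) (\<lambda>_. f i)" if "i < a + b" for i
    using b[OF that] by (simp add: zp_basis_iff zp_span_pair)
  have in_P: "e i \<in> P i" "f i \<in> P i" if "i < a + b" for i
    unfolding P[OF that] using basis_in_Zspan[of 0 1 "\<lambda>_. e i" "\<lambda>_. f i"] basis_in_Zspan[of 0 1 "\<lambda>_. f i" "\<lambda>_. e i"] by auto
  have fr: "frame (a + b) e f (std a)"
    unfolding frame_def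
  proof (intro allI impI)
    fix i j assume "i < a + b" "j < a + b"
    then show "form (e i) (e j) = 0 \<and> form (f i) (f j) = 0 \<and>
        form (e i) (f j) = (if i = j then pp powi std a i else 0)"
      using orth[of i j] in_P[of i] in_P[of j] ef[of i] by (cases "i = j") simp_all
  qed
  have "L = Zspan (a + b) e f"
  proof (rule subset_antisym)
    show "L \<subseteq> Zspan (a + b) e f"
      unfolding L
    proof (rule zp.span_minimal)
      show "(\<Union>i<a + b. P i) \<subseteq> Zspan (a + b) e f"
      proof (rule UN_least)
        fix i assume "i \<in> {..<a + b}"
        then have "i < a + b" by simp
        then show "P i \<subseteq> Zspan (a + b) e f"
          unfolding P[OF \<open>i < a + b\<close>] by (intro Zspan_subset) (simp_all add: basis_in_Zspan)
      qed
      show "zp.subspace (Zspan (a + b) e f)"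
        by (rule zp.subspaceI) (simp_all add: zp_scale_def Zspan_add Zspan_scale Zp_def)
    qed
    have "e ` {..<a + b} \<union> f ` {..<a + b} \<subseteq> (\<Union>i<a + b. P i)" using in_P by auto
    then show "Zspan (a + b) e f \<subseteq> L"
      unfolding L zp_span_eq_Zspan[symmetric] zp_span_def by (rule zp.span_mono)
  qed
  with fr that show thesis by blast
qed

lemma lattice_on_frame_iff:
  assumes "frame n e f \<epsilon>"
  shows "lattice_on scale (Zspan n e f) \<longleftrightarrow> Qspan n e f = UNIV"
proof
  assume "lattice_on scale (Zspan n e f)"
  then obtain xs where xs: "zp_basis scale xs (Zspan n e f)" "span (set xs) = UNIV"
    unfolding lattice_on_def by blast
  have "set xs \<subseteq> Zspan n e f" using xs(1) zp.span_superset[of "set xs"] by (simp add: zp_basis_iff zp_span_def)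
  then have "span (set xs) \<subseteq> Qspan n e f"
    using Zspan_subset_Qspan by (intro span_minimal subspace_Qspan) blast
  with xs(2) show "Qspan n e f = UNIV" by blast
next
  assume "Qspan n e f = UNIV"
  then show "lattice_on scale (Zspan n e f)"
    unfolding lattice_on_def using zp_basis_frame[OF assms]
    by (intro exI[of _ "map e [0..<n] @ map f [0..<n]"]) (simp add: Qspan_eq_span atLeast0LessThan)
qed

lemma dual_lattice_frame:
  assumes "frame n e f \<epsilon>" "Qspan n e f = UNIV"
  shows "dual_lattice form (Zspan n e f) =
    Zspan n (scaled (\<lambda>i. - \<epsilon> i) e) (scaled (\<lambda>i. - \<epsilon> i) f)"
  using dual_frame_eq[OF assms(1)] assms(2) by (simp add: dual_lattice_def)

lemma p_elementary_frame:
  assumes fr: "frame n e f (std a)" and UNIV: "Qspan n e f = UNIV"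
  shows "p_elementary scale form (Zspan n e f)"
  unfolding p_elementary_def dual_lattice_frame[OF assms]
proof (intro conjI ballI subsetI)
  fix u v assume "u \<in> Zspan n e f" "v \<in> Zspan n e f"
  then obtain c d c' d' where u: "u = comb n e f c d" and v: "v = comb n e f c' d'"
    and int: "\<forall>i<n. c i \<in> Zp \<and> d i \<in> Zp" "\<forall>i<n. c' i \<in> Zp \<and> d' i \<in> Zp"
    unfolding Zspan_def by blast
  show "form u v \<in> Zp"
    unfolding u v form_comb(3)[OF fr] using int by (intro Zp_sum) (auto simp: std_def)
next
  fix v assume "v \<in> scale pp ` Zspan n (scaled (\<lambda>i. - std a i) e) (scaled (\<lambda>i. - std a i) f)"
  then obtain c d where v: "v = scale pp (comb n (scaled (\<lambda>i. - std a i) e) (scaled (\<lambda>i. - std a i) f) c d)"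
    and int: "\<forall>i<n. c i \<in> Zp \<and> d i \<in> Zp"
    unfolding Zspan_def by blast
  have "v = comb n e f (\<lambda>i. pp * c i * pp powi (- std a i)) (\<lambda>i. pp * d i * pp powi (- std a i))"
    unfolding v comb_scale by (rule comb_cong) simp_all
  also have "\<dots> \<in> Zspan n e f"
  proof (rule comb_in_Zspan)
    have *: "pp * x * pp powi (- std a i) \<in> Zp" if "x \<in> Zp" for x :: "'p padic" and i
      using that by (auto simp: std_def power_int_minus field_simps)
    fix i assume "i < n"
    with int show "pp * c i * pp powi (- std a i) \<in> Zp" "pp * d i * pp powi (- std a i) \<in> Zp"
      by (simp_all only: *)
  qed
  finally show "v \<in> Zspan n e f" .
qed

section \<open>Isometries, stabilizers and orbits\<close>

lemma isometriesI:
  assumes "Vector_Spaces.linear scale scale g" "\<And>u v. form (g u) (g v) = form u v"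
    "\<And>v. h (g v) = v" "\<And>v. g (h v) = v"
  shows "g \<in> isometries scale form"
  unfolding isometries_def using assms by (auto intro!: bij_betw_byWitness[of _ h])

lemma isometries_inv:
  assumes "g \<in> isometries scale form"
  shows "inv_into UNIV g \<in> isometries scale form"
proof -
  have g: "Vector_Spaces.linear scale scale g" "bij g" "\<And>u v. form (g u) (g v) = form u v"
    using assms by (auto simp: isometries_def)
  have inv: "g (inv_into UNIV g v) = v" "inv_into UNIV g (g v) = v" for v
    using g(2) by (simp_all add: bij_is_surj surj_f_inv_f bij_is_inj)
  show ?thesis
  proof (rule isometriesI)
    have lin: "g (u + v) = g u + g v" "g (scale c u) = scale c (g u)" for u v c
      using g(1) by (simp_all add: Vector_Spaces.linear_iff)
    have "inv_into UNIV g (u + v) = inv_into UNIV g (g (inv_into UNIV g u + inv_into UNIV g v))"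
      "inv_into UNIV g (scale c u) = inv_into UNIV g (g (scale c (inv_into UNIV g u)))" for u v c
      by (simp_all only: lin inv(1))
    then show "Vector_Spaces.linear scale scale (inv_into UNIV g)"
      unfolding inv(2) by (simp add: Vector_Spaces.linear_iff vector_space_axioms)
    show "form (inv_into UNIV g u) (inv_into UNIV g v) = form u v" for u v
      using g(3)[of "inv_into UNIV g u" "inv_into UNIV g v"] by (simp only: inv(1))
  qed (fact inv)+
qed

lemma isometries_comp:
  assumes "g \<in> isometries scale form" "h \<in> isometries scale form"
  shows "g \<circ> h \<in> isometries scale form"
  using assms by (auto simp: isometries_def Vector_Spaces.linear_iff bij_comp)

lemma Sp_orbit_image:
  assumes g: "g \<in> Sp_lattice scale form \<Lambda>"
  shows "Sp_orbit scale form \<Lambda> (g ` L) = Sp_orbit scale form \<Lambda> L"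
proof -
  have g': "g \<in> isometries scale form" "g ` \<Lambda> = \<Lambda>" using g by (auto simp: Sp_lattice_def)
  then have inj: "inj g" by (simp add: isometries_def bij_is_inj)
  have inv: "inv_into UNIV g ` g ` S = S" for S using inj by (simp add: image_image)
  have comp: "(p \<circ> q) ` S = p ` q ` S" for p q :: "'v \<Rightarrow> 'v" and S by (simp only: image_comp)
  have "inv_into UNIV g ` \<Lambda> = \<Lambda>" using inv[of \<Lambda>] g'(2) by simp
  then have 1: "h \<circ> inv_into UNIV g \<in> Sp_lattice scale form \<Lambda>" if "h \<in> Sp_lattice scale form \<Lambda>" for h
    using that isometries_comp[OF _ isometries_inv[OF g'(1)], of h] comp[of h "inv_into UNIV g" \<Lambda>]
    unfolding Sp_lattice_def \<open>inv_into UNIV g ` \<Lambda> = \<Lambda>\<close> by blast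
  have 2: "h \<circ> g \<in> Sp_lattice scale form \<Lambda>" if "h \<in> Sp_lattice scale form \<Lambda>" for h
    using that isometries_comp[OF _ g'(1), of h] comp[of h g \<Lambda>] unfolding Sp_lattice_def g'(2) by blast
  show ?thesis
  proof (intro equalityI subsetI)
    fix M assume "M \<in> Sp_orbit scale form \<Lambda> (g ` L)"
    then obtain h where "h \<in> Sp_lattice scale form \<Lambda>" "M = h ` g ` L" unfolding Sp_orbit_def by blast
    then show "M \<in> Sp_orbit scale form \<Lambda> L" using 2 unfolding Sp_orbit_def image_comp by blast
  next
    fix M assume "M \<in> Sp_orbit scale form \<Lambda> L"
    then obtain h where h: "h \<in> Sp_lattice scale form \<Lambda>" "M = h ` L" unfolding Sp_orbit_def by blast
    have "M = (h \<circ> inv_into UNIV g) ` g ` L" unfolding comp inv by (rule h(2))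
    then show "M \<in> Sp_orbit scale form \<Lambda> (g ` L)" using 1[OF h(1)] unfolding Sp_orbit_def by blast
  qed
qed

lemma self_in_Sp_orbit: "L \<in> Sp_orbit scale form \<Lambda> L"
proof -
  have "id \<in> isometries scale form"
    by (rule isometriesI[of _ id]) (simp_all add: Vector_Spaces.linear_iff vector_space_axioms)
  then have "id \<in> Sp_lattice scale form \<Lambda>" by (simp add: Sp_lattice_def)
  then show ?thesis unfolding Sp_orbit_def by (auto intro!: exI[of _ id])
qed

lemma ex_isometry_frames:
  assumes fr: "frame n e f \<epsilon>" "Qspan n e f = UNIV" and fr': "frame n x y \<epsilon>" "Qspan n x y = UNIV"
  obtains g where "g \<in> isometries scale form" "\<forall>i<n. g (e i) = x i \<and> g (f i) = y i"
proof -
  \<comment> \<open>The linear map taking p i to r i and q i to s i, written with the coordinate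
    formula so that exchanging the two frames gives its inverse.\<close>
  define G where "G p q r s v = comb n r s (\<lambda>i. form v (q i) * pp powi (- \<epsilon> i)) (\<lambda>i. form (p i) v * pp powi (- \<epsilon> i))"
    for p q r s :: "nat \<Rightarrow> 'v" and v
  have G_comb: "G p q r s (comb n p q c d) = comb n r s c d" if "frame n p q \<epsilon>" for p q r s c d
    unfolding G_def by (rule comb_cong) (simp_all add: form_comb(1,2)[OF that] power_int_minus)
  have inv: "G r s p q (G p q r s v) = v"
    if pq: "frame n p q \<epsilon>" "Qspan n p q = UNIV" and rs: "frame n r s \<epsilon>" for p q r s v
  proof -
    obtain c d where "v = comb n p q c d" using pq(2) by (metis QspanE UNIV_I)
    then show ?thesis by (simp add: G_comb[OF pq(1)] G_comb[OF rs])
  qed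
  let ?g = "G e f x y"
  have "?g \<in> isometries scale form"
  proof (rule isometriesI)
    show "Vector_Spaces.linear scale scale ?g"
      unfolding Vector_Spaces.linear_iff G_def
      by (simp add: vector_space_axioms comb_add comb_scale form_add_left form_add_right form_scale_left
          form_scale_right distrib_right mult.assoc)
    show "form (?g u) (?g v) = form u v" for u v
    proof -
      obtain c d where "u = comb n e f c d" using fr(2) by (metis QspanE UNIV_I)
      moreover obtain c' d' where "v = comb n e f c' d'" using fr(2) by (metis QspanE UNIV_I)
      ultimately show ?thesis by (simp add: G_comb[OF fr(1)] form_comb(3)[OF fr(1)] form_comb(3)[OF fr'(1)])
    qed
    show "G x y e f (?g v) = v" for v by (rule inv[OF fr fr'(1)])
    show "?g (G x y e f v) = v" for v by (rule inv[OF fr' fr(1)])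
  qed
  moreover have "?g (e i) = x i" "?g (f i) = y i" if "i < n" for i
    using G_comb[OF fr(1), of x y "\<lambda>j. if j = i then 1 else 0" "\<lambda>_. 0"]
      G_comb[OF fr(1), of x y "\<lambda>_. 0" "\<lambda>j. if j = i then 1 else 0"] by (simp_all only: comb_unit[OF that])
  ultimately show thesis using that by blast
qed

lemma frame_isometry:
  assumes "frame n e f \<epsilon>" "g \<in> isometries scale form"
  shows "frame n (\<lambda>i. g (e i)) (\<lambda>i. g (f i)) \<epsilon>"
  using assms by (simp add: frame_def isometries_def)

text \<open>The isometry matching two standard frames of one lattice stabilizes that lattice and
  carries representative to representative with the same parameters.\<close>

lemma rep_lattice_in_orbit:
  assumes fr: "frame n e f (std a)" "Qspan n e f = UNIV" and fr': "frame n x y (std a)" "Qspan n x y = UNIV"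
    and Z: "Zspan n x y = Zspan n e f"
  obtains g where "g \<in> Sp_lattice scale form (Zspan n e f)"
    "g ` rep_lattice scale e f n a t = rep_lattice scale x y n a t"
proof -
  obtain g where g: "g \<in> isometries scale form" "\<forall>i<n. g (e i) = x i \<and> g (f i) = y i"
    using ex_isometry_frames[OF fr fr'] .
  have lin: "Vector_Spaces.linear scale scale g" using g(1) by (simp add: isometries_def)
  have "g ` Zspan n e f = Zspan n x y"
    unfolding linear_image_Zspan[OF lin] by (rule Zspan_cong) (simp_all add: g)
  then have "g ` Zspan n e f = Zspan n e f" unfolding Z .
  moreover have "rep_lattice scale (\<lambda>i. g (e i)) (\<lambda>i. g (f i)) n a t = rep_lattice scale x y n a t"
    unfolding rep_lattice_eq_Zspan by (rule Zspan_cong) (simp_all add: g)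
  then have "g ` rep_lattice scale e f n a t = rep_lattice scale x y n a t"
    unfolding linear_image_rep_lattice[OF lin] .
  ultimately show thesis using that g(1) by (simp add: Sp_lattice_def)
qed

text \<open>A stabilizing isometry maps the frame e, f to another frame of the same lattice, and
  \<open>rep_lattice_inj\<close> compares the two.\<close>

theorem rep_lattice_orbit_unique:
  assumes fr: "frame n e f (std a)" "Qspan n e f = UNIV" and fr': "frame n x y (std a)" "Qspan n x y = UNIV"
    and Z: "Zspan n x y = Zspan n e f" and ab: "a + b = n"
    and t: "t \<in> params n a b c d" "t' \<in> params n a b c' d'"
    and orbit: "rep_lattice scale x y n a t' \<in> Sp_orbit scale form (Zspan n e f) (rep_lattice scale e f n a t)"
  shows "t = t'"
proof -
  obtain g where g: "g \<in> isometries scale form" "g ` Zspan n e f = Zspan n e f"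
    and eq: "rep_lattice scale x y n a t' = g ` rep_lattice scale e f n a t"
    using orbit unfolding Sp_orbit_def Sp_lattice_def by blast
  have lin: "Vector_Spaces.linear scale scale g" using g(1) by (simp add: isometries_def)
  note frg = frame_isometry[OF fr(1) g(1)]
  have Zg: "Zspan n (\<lambda>i. g (e i)) (\<lambda>i. g (f i)) = Zspan n e f"
    using g(2) linear_image_Zspan[OF lin] by simp
  have Qg: "Qspan n (\<lambda>i. g (e i)) (\<lambda>i. g (f i)) = UNIV"
  proof -
    have "v \<in> Qspan n (\<lambda>i. g (e i)) (\<lambda>i. g (f i))" for v
    proof -
      have "surj g" using g(1) by (simp add: isometries_def bij_is_surj)
      then obtain w where "v = g w" by (metis surjD)
      moreover obtain c d where "w = comb n e f c d" using fr(2) by (metis QspanE UNIV_I)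
      ultimately show ?thesis by (simp add: linear_image_comb[OF lin])
    qed
    then show ?thesis by blast
  qed
  show ?thesis
  proof (rule rep_lattice_inj[OF frg fr'(1) _ _ ab t])
    show "Qspan n (\<lambda>i. g (e i)) (\<lambda>i. g (f i)) = Qspan n x y" using Qg fr'(2) by simp
    show "Zspan n (\<lambda>i. g (e i)) (\<lambda>i. g (f i)) = Zspan n x y" using Zg Z by simp
    show "rep_lattice scale (\<lambda>i. g (e i)) (\<lambda>i. g (f i)) n a t = rep_lattice scale x y n a t'"
      unfolding eq by (rule linear_image_rep_lattice[OF lin, symmetric])
  qed
qed

text \<open>Replaces a comparison of volumes. In relative position the inclusion makes all exponents
  nonnegative, while on each plane they sum to 1, 0 or -1. Equal types force r_+ = r_-, so if the
  sum -1 is excluded the sum 1 does not occur either, and all exponents vanish.\<close>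

lemma sublattice_eq:
  assumes fr: "frame n e f (std a)" and fr': "frame n x y (std a)" and span: "Qspan n x y = Qspan n e f"
    and sub: "Zspan n x y \<subseteq> Zspan n e f" and an: "a \<le> n"
  shows "Zspan n x y = Zspan n e f"
proof -
  define b where "b = n - a"
  have ab: "a + b = n" using an by (simp add: b_def)
  obtain p q t where pq: "frame n p q (std a)" "Qspan n p q = Qspan n e f" "Zspan n p q = Zspan n e f"
    and t: "t \<in> params n a b a b" and rep: "rep_lattice scale p q n a t = Zspan n x y"
    using relative_position[OF fr fr' span[symmetric] ab ab] .
  have nonneg: "0 \<le> snd (snd t) ! i" "0 \<le> nu a t i" if "i < n" for i
  proof -
    have "scale (pp powi (snd (snd t) ! i)) (p i) \<in> Zspan n p q" "scale (pp powi (nu a t i)) (q i) \<in> Zspan n p q"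
      using sub unfolding pq(3)[symmetric] rep[symmetric] rep_lattice_eq_Zspan
      using basis_in_Zspan[OF that] by blast+
    moreover have "scale c (p i) = comb n p q (\<lambda>j. if j = i then c else 0) (\<lambda>_. 0)"
      "scale c (q i) = comb n p q (\<lambda>_. 0) (\<lambda>j. if j = i then c else 0)" for c
    proof -
      have "scale c (p i) = scale c (comb n p q (\<lambda>j. if j = i then 1 else 0) (\<lambda>_. 0))"
        "scale c (q i) = scale c (comb n p q (\<lambda>_. 0) (\<lambda>j. if j = i then 1 else 0))"
        by (simp_all only: comb_unit[OF that])
      then show "scale c (p i) = comb n p q (\<lambda>j. if j = i then c else 0) (\<lambda>_. 0)"
        "scale c (q i) = comb n p q (\<lambda>_. 0) (\<lambda>j. if j = i then c else 0)"
        unfolding comb_scale by (simp_all add: if_distrib cong: if_cong)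
    qed
    ultimately have "(pp powi (snd (snd t) ! i) :: 'p padic) \<in> Zp" "(pp powi (nu a t i) :: 'p padic) \<in> Zp"
      using that by (auto simp: comb_in_Zspan_iff[OF pq(1)] split: if_splits)
    then show "0 \<le> snd (snd t) ! i" "0 \<le> nu a t i" by (simp_all add: Zp_iff_ord)
  qed
  obtain rm rp \<mu> where t_eq: "t = (rm, rp, \<mu>)" by (cases t)
  have rmrp: "rm = rp" "rm \<le> a" "rp \<le> b"
  proof -
    have "b + rp = b + rm" "rm \<le> min a b" "rp \<le> min a b"
      using t unfolding t_eq params_def by blast+
    then show "rm = rp" "rm \<le> a" "rp \<le> b" by simp_all
  qed
  \<comment> \<open>A plane in the r_+ block has exponents \<mu> and -\<mu> - 1, which cannot both
    be nonnegative; index \<open>a\<close> is the first of that block.\<close>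
  have "rp = 0"
  proof (rule ccontr)
    assume "rp \<noteq> 0"
    then have "nu a t a = - \<mu> ! a - 1" "a < n" using rmrp ab by (simp_all add: nu_def t_eq)
    with nonneg[of a] show False by (simp add: t_eq)
  qed
  have "snd (snd t) ! i = 0" "nu a t i = 0" if "i < n" for i
    using nonneg[OF that] \<open>rp = 0\<close> rmrp by (auto simp: nu_def t_eq split: if_splits)
  then have "rep_lattice scale p q n a t = Zspan n p q"
    unfolding rep_lattice_eq_Zspan by (intro Zspan_cong) simp_all
  with rep pq(3) show ?thesis by simp
qed

section \<open>Orbits of lattices\<close>

lemma hyperbolic_latticeE:
  assumes "lattice_on scale L" "hyperbolic_sum scale form a b L"
  obtains e f where "frame (a + b) e f (std a)" "L = Zspan (a + b) e f" "Qspan (a + b) e f = UNIV"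
  using hyperbolic_sumE[OF assms(2)] assms(1) lattice_on_frame_iff by metis

text \<open>L and L' are brought to normal form, each with its own frame of \<Lambda>. Lying in one
  orbit and having the same elementary divisors both amount to equality of the parameters.\<close>

theorem orbit_iff_elementary_divisors:
  assumes \<Lambda>: "lattice_on scale \<Lambda>" "hyperbolic_sum scale form a b \<Lambda>"
    and L: "lattice_on scale L" "hyperbolic_sum scale form a' b' L"
    and L': "lattice_on scale L'" "hyperbolic_sum scale form a' b' L'"
  shows "L' \<in> Sp_orbit scale form \<Lambda> L \<longleftrightarrow>
    elementary_divisors scale L \<Lambda> = elementary_divisors scale L' \<Lambda> \<and>
    elementary_divisors scale L (dual_lattice form \<Lambda>) = elementary_divisors scale L' (dual_lattice form \<Lambda>)"
proof -
  define n where "n = a + b"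
  obtain e f where fr: "frame n e f (std a)" and Z: "\<Lambda> = Zspan n e f" and Q: "Qspan n e f = UNIV"
    unfolding n_def using hyperbolic_latticeE[OF \<Lambda>] .
  have pos: "\<exists>x y t. frame n x y (std a) \<and> Qspan n x y = UNIV \<and> Zspan n x y = \<Lambda> \<and>
      t \<in> params n a b a' b' \<and> rep_lattice scale x y n a t = M"
    if "lattice_on scale M" "hyperbolic_sum scale form a' b' M" for M
  proof -
    obtain e' f' where "frame (a' + b') e' f' (std a')" "M = Zspan (a' + b') e' f'" "Qspan (a' + b') e' f' = UNIV"
      using hyperbolic_latticeE[OF \<open>lattice_on scale M\<close> \<open>hyperbolic_sum scale form a' b' M\<close>] .
    then show ?thesis
      using relative_position[OF fr, of "a' + b'" e' f' a' b b'] n_def Q Z by metis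
  qed
  obtain x y t where fr1: "frame n x y (std a)" "Qspan n x y = UNIV" "Zspan n x y = \<Lambda>"
    and t: "t \<in> params n a b a' b'" and L_eq: "rep_lattice scale x y n a t = L"
    using pos[OF L] by blast
  obtain x' y' t' where fr2: "frame n x' y' (std a)" "Qspan n x' y' = UNIV" "Zspan n x' y' = \<Lambda>"
    and t': "t' \<in> params n a b a' b'" and L'_eq: "rep_lattice scale x' y' n a t' = L'"
    using pos[OF L'] by blast
  have ed: "has_elementary_divisors scale (rep_lattice scale p q n a s) \<Lambda>
      (mset (map (\<lambda>c. pp powi c) (exponents n a s)))"
    "has_elementary_divisors scale (rep_lattice scale p q n a s) (dual_lattice form \<Lambda>)
      (mset (map (\<lambda>c. pp powi c) (dual_exponents n a s)))"
    if "frame n p q (std a)" "Qspan n p q = UNIV" "Zspan n p q = \<Lambda>" for p q s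
    using has_elementary_divisors_rep_lattice[OF that(1), of s] dual_lattice_frame[OF that(1,2)] that(3)
    by simp_all
  note eds = ed[THEN elementary_divisors_eqI]
  show ?thesis
  proof
    assume "L' \<in> Sp_orbit scale form \<Lambda> L"
    then have "rep_lattice scale x' y' n a t' \<in> Sp_orbit scale form (Zspan n x y) (rep_lattice scale x y n a t)"
      unfolding L_eq L'_eq fr1(3) .
    then have "t = t'"
      using rep_lattice_orbit_unique[OF fr1(1,2) fr2(1,2) _ n_def[symmetric] t t'] fr1(3) fr2(3) by simp
    then show "elementary_divisors scale L \<Lambda> = elementary_divisors scale L' \<Lambda> \<and>
        elementary_divisors scale L (dual_lattice form \<Lambda>) = elementary_divisors scale L' (dual_lattice form \<Lambda>)"
      unfolding L_eq[symmetric] L'_eq[symmetric] using eds[OF fr1] eds[OF fr2] by simp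
  next
    assume eq: "elementary_divisors scale L \<Lambda> = elementary_divisors scale L' \<Lambda> \<and>
        elementary_divisors scale L (dual_lattice form \<Lambda>) = elementary_divisors scale L' (dual_lattice form \<Lambda>)"
    have "t = t'"
    proof (rule params_unique[OF n_def[symmetric] t t'])
      show "mset (exponents n a t) = mset (exponents n a t')"
        using eq unfolding L_eq[symmetric] L'_eq[symmetric] eds(1)[OF fr1] eds(1)[OF fr2] mset_map_powi_eq_iff by blast
      show "mset (dual_exponents n a t) = mset (dual_exponents n a t')"
        using eq unfolding L_eq[symmetric] L'_eq[symmetric] eds(2)[OF fr1] eds(2)[OF fr2] mset_map_powi_eq_iff by blast
    qed
    moreover obtain g where "g \<in> Sp_lattice scale form (Zspan n x y)"
      "g ` rep_lattice scale x y n a t = rep_lattice scale x' y' n a t"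
      using rep_lattice_in_orbit[OF fr1(1,2) fr2(1,2)] fr1(3) fr2(3) by metis
    ultimately show "L' \<in> Sp_orbit scale form \<Lambda> L"
      unfolding Sp_orbit_def L_eq[symmetric] L'_eq[symmetric] fr1(3) by blast
  qed
qed

text \<open>\<open>relative_position\<close> yields a normal form for some frame of \<Lambda>, and
  the isometry between that frame and the given one moves it into the required family without
  leaving the orbit.\<close>

theorem rep_lattice_representatives:
  assumes \<Lambda>: "lattice_on scale \<Lambda>" and ab: "a + b = n"
    and basis: "zp_basis scale (map e [0..<n] @ map f [0..<n]) \<Lambda>"
    and gram: "\<forall>i<n. \<forall>j<n. form (e i) (e j) = 0 \<and> form (f i) (f j) = 0 \<and>
      form (e i) (f j) = (if i = j then (if i < a then 1 else pp) else 0)"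
  shows "representatives (rep_lattice scale e f n a) (params n a b a' b')
    {L. lattice_on scale L \<and> p_elementary scale form L \<and> hyperbolic_sum scale form a' b' L}
    (Sp_orbit scale form \<Lambda>)"
proof -
  have fr: "frame n e f (std a)"
    using gram by (simp add: frame_def std_def)
  have Z: "\<Lambda> = Zspan n e f"
    using basis by (simp add: zp_basis_iff zp_span_eq_Zspan atLeast0LessThan)
  have Q: "Qspan n e f = UNIV" using \<Lambda> unfolding Z lattice_on_frame_iff[OF fr] .
  have unique: "t = t'" if "t \<in> params n a b a' b'" "t' \<in> params n a b a' b'"
    "rep_lattice scale e f n a t' \<in> Sp_orbit scale form \<Lambda> (rep_lattice scale e f n a t)" for t t'
    by (rule rep_lattice_orbit_unique[OF fr Q fr Q refl ab that(1,2)]) (use that(3) Z in simp)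
  show ?thesis
    unfolding representatives_def
  proof (intro conjI ballI)
    show "inj_on (rep_lattice scale e f n a) (params n a b a' b')"
      by (rule inj_onI) (use unique self_in_Sp_orbit in metis)
    show "rep_lattice scale e f n a ` params n a b a' b' \<subseteq>
        {L. lattice_on scale L \<and> p_elementary scale form L \<and> hyperbolic_sum scale form a' b' L}"
    proof (intro image_subsetI CollectI)
      fix t assume t: "t \<in> params n a b a' b'"
      then have n: "a' + b' = n" using ab unfolding params_iff_blocks[OF ab] by auto
      obtain x y where "frame n x y (std a')" "Zspan n x y = rep_lattice scale e f n a t" "Qspan n x y = UNIV"
        using frame_rep_lattice[OF fr ab t] Q by metis
      then show "lattice_on scale (rep_lattice scale e f n a t) \<and> p_elementary scale form (rep_lattice scale e f n a t) \<and>
          hyperbolic_sum scale form a' b' (rep_lattice scale e f n a t)"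
        using lattice_on_frame_iff p_elementary_frame hyperbolic_sum_frame[OF _ n] by metis
    qed
    fix L assume "L \<in> {L. lattice_on scale L \<and> p_elementary scale form L \<and> hyperbolic_sum scale form a' b' L}"
    then have "lattice_on scale L" "hyperbolic_sum scale form a' b' L" by auto
    then obtain e' f' where fr': "frame (a' + b') e' f' (std a')" "L = Zspan (a' + b') e' f'" "Qspan (a' + b') e' f' = UNIV"
      by (rule hyperbolic_latticeE)
    obtain x y t where xy: "frame n x y (std a)" "Qspan n x y = UNIV" "Zspan n x y = Zspan n e f"
      and t: "t \<in> params n a b a' b'" and L: "rep_lattice scale x y n a t = L"
      using relative_position[OF fr fr'(1) _ ab refl] Q fr'(2,3) by metis
    obtain g where g: "g \<in> Sp_lattice scale form \<Lambda>" "g ` rep_lattice scale e f n a t = L"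
      unfolding Z L[symmetric] using rep_lattice_in_orbit[OF fr Q xy] .
    show "\<exists>!r. r \<in> rep_lattice scale e f n a ` params n a b a' b' \<and>
        Sp_orbit scale form \<Lambda> r = Sp_orbit scale form \<Lambda> L"
    proof (rule ex1I)
      show "rep_lattice scale e f n a t \<in> rep_lattice scale e f n a ` params n a b a' b' \<and>
          Sp_orbit scale form \<Lambda> (rep_lattice scale e f n a t) = Sp_orbit scale form \<Lambda> L"
        using t Sp_orbit_image[OF g(1)] g(2) by blast
      fix r assume r: "r \<in> rep_lattice scale e f n a ` params n a b a' b' \<and>
          Sp_orbit scale form \<Lambda> r = Sp_orbit scale form \<Lambda> L"
      then obtain s where s: "s \<in> params n a b a' b'" "r = rep_lattice scale e f n a s" by blast
      have "rep_lattice scale e f n a s \<in> Sp_orbit scale form \<Lambda> (rep_lattice scale e f n a t)"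
        using r s(2) self_in_Sp_orbit[of r \<Lambda>] Sp_orbit_image[OF g(1), of "rep_lattice scale e f n a t"] g(2) by simp
      then show "r = rep_lattice scale e f n a t" using unique[OF t s(1)] s(2) by simp
    qed
  qed
qed

end

lemma alternating_space_symplectic_space:
  assumes "symplectic_space scale form n"
  shows "alternating_space scale form"
proof -
  interpret symplectic_space scale form n by fact
  show ?thesis
  proof
    show "form (u + v) w = form u w + form v w" "form (scale c u) w = c * form u w" for u v w c
      using linear_left[of w] by (simp_all add: Vector_Spaces.linear_iff)
    show "form u (v + w) = form u v + form u w" "form u (scale c v) = c * form u v" for u v w c
      using linear_right[of u] by (simp_all add: Vector_Spaces.linear_iff)
  qed (rule alternating)
qed

section \<open>Symplectic matrices acting on coordinate vectors\<close>

lemma sum_lessThan_add: "(\<Sum>l<n + m. h l) = (\<Sum>l<n. h l) + (\<Sum>l<m. h (n + l :: nat))"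
  for h :: "nat \<Rightarrow> 'a::comm_monoid_add"
  by (induction m) (simp_all add: add.assoc)

text \<open>\<open>mat_inverse\<close> is specified through the units of the matrix ring, so the
  one-sided inverse is first made two-sided; uniqueness of inverses then identifies the computed
  matrix with B.\<close>

lemma minv_eqI:
  assumes "A \<in> carrier_mat n n" "B \<in> carrier_mat n n" "A * B = 1\<^sub>m n"
  shows "minv A = B"
proof -
  have BA: "B * A = 1\<^sub>m n" using mat_mult_left_right_inverse[OF assms] .
  have "A \<in> Units (ring_mat TYPE('a) n ())"
    unfolding Units_def ring_mat_def using assms BA by auto
  then obtain C where C: "mat_inverse A = Some C"
    using mat_inverse(1)[OF assms(1), where b = "()"] by (cases "mat_inverse A") auto
  from mat_inverse(2)[OF assms(1) C] have CA: "C * A = 1\<^sub>m n" "C \<in> carrier_mat n n" by auto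
  have "C = C * (A * B)" unfolding assms(3) by (rule right_mult_one_mat[OF CA(2), symmetric])
  also have "\<dots> = C * A * B" by (rule assoc_mult_mat[OF CA(2) assms(1,2), symmetric])
  also have "\<dots> = B" unfolding CA(1) by (rule left_mult_one_mat[OF assms(2)])
  finally show ?thesis unfolding minv_def C by simp
qed

text \<open>The form with Gram matrix \<open>J_mat n\<close> on the first 2n monomials, the
  coefficients of a polynomial being the entries of a column.\<close>

definition poly_form :: "nat \<Rightarrow> 'p::prime_card padic poly \<Rightarrow> 'p padic poly \<Rightarrow> 'p padic"
  where "poly_form n u v = (\<Sum>i<n. coeff u i * coeff v (n + i) - coeff u (n + i) * coeff v i)"

text \<open>
  Since the dimension 2n is not a type, the column space is modelled by the polynomials of degree
  less than 2n; the form vanishes on the higher monomials.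
\<close>

locale poly_symplectic =
  fixes n :: nat and P :: "'p::prime_card itself"

sublocale poly_symplectic \<subseteq> alternating_space "smult :: 'p padic \<Rightarrow> 'p padic poly \<Rightarrow> 'p padic poly" "poly_form n"
  by unfold_locales
    (simp_all add: poly_form_def smult_add_left smult_add_right algebra_simps sum.distrib sum_subtractf
      sum_distrib_left)

context poly_symplectic
begin

text \<open>Linear on all polynomials but with values in \<open>columns\<close>, hence not an
  isometry of the ambient space. This is why the results on frames, rather than those on
  \<open>isometries\<close>, are used for matrices.\<close>

definition act :: "'p padic mat \<Rightarrow> 'p padic poly \<Rightarrow> 'p padic poly"
  where "act g u = (\<Sum>i<2 * n. monom (\<Sum>j<2 * n. g $$ (i, j) * coeff u j) i)"

definition e0 :: "nat \<Rightarrow> 'p padic poly" where "e0 i = monom 1 i"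

definition f0 :: "nat \<Rightarrow> 'p padic poly" where "f0 i = monom 1 (n + i)"

definition fs :: "nat \<Rightarrow> nat \<Rightarrow> 'p padic poly" where "fs a i = smult (pp powi std a i) (f0 i)"

text \<open>The columns with upper half in Z_p^n and lower half in T Z_p^n, T being
  \<open>T_mat a b\<close>; its stabilizer turns out to be \<open>Gamma a b\<close>.\<close>

definition std_lattice :: "nat \<Rightarrow> 'p padic poly set" where "std_lattice a = Zspan n e0 (fs a)"

definition columns :: "'p padic poly set" where "columns = {u. \<forall>i\<ge>2 * n. coeff u i = 0}"

lemma coeff_act: "coeff (act g u) i = (if i < 2 * n then \<Sum>j<2 * n. g $$ (i, j) * coeff u j else 0)"
  unfolding act_def by (simp add: coeff_sum)

lemma linear_act: "Vector_Spaces.linear smult smult (act g)"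
  unfolding Vector_Spaces.linear_iff
proof (intro conjI allI)
  show "act g (u + v) = act g u + act g v" for u v
    by (rule poly_eqI) (simp add: coeff_act distrib_left sum.distrib)
  show "act g (smult c u) = smult c (act g u)" for c u
    by (rule poly_eqI) (simp add: coeff_act sum_distrib_left mult.left_commute)
qed (rule vector_space_axioms)+

lemma mult_index:
  assumes "g \<in> carrier_mat (2 * n) (2 * n)" "h \<in> carrier_mat (2 * n) (2 * n)" "i < 2 * n" "j < 2 * n"
  shows "(g * h) $$ (i, j) = (\<Sum>k<2 * n. g $$ (i, k) * h $$ (k, j))"
  using assms by (simp add: scalar_prod_def lessThan_atLeast0)

lemma act_mult:
  assumes "g \<in> carrier_mat (2 * n) (2 * n)" "h \<in> carrier_mat (2 * n) (2 * n)"
  shows "act (g * h) u = act g (act h u)"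
proof (rule poly_eqI)
  fix i
  have "(\<Sum>j<2 * n. (g * h) $$ (i, j) * coeff u j) =
      (\<Sum>k<2 * n. g $$ (i, k) * (\<Sum>j<2 * n. h $$ (k, j) * coeff u j))" if "i < 2 * n"
  proof -
    have "(\<Sum>j<2 * n. (g * h) $$ (i, j) * coeff u j) =
        (\<Sum>j<2 * n. \<Sum>k<2 * n. g $$ (i, k) * (h $$ (k, j) * coeff u j))"
      by (rule sum.cong) (simp_all add: mult_index[OF assms that] sum_distrib_right mult.assoc)
    also have "\<dots> = (\<Sum>k<2 * n. \<Sum>j<2 * n. g $$ (i, k) * (h $$ (k, j) * coeff u j))"
      by (rule sum.swap)
    finally show ?thesis by (simp add: sum_distrib_left)
  qed
  then show "coeff (act (g * h) u) i = coeff (act g (act h u)) i"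
    by (simp add: coeff_act)
qed

lemma act_in_columns: "act g u \<in> columns"
  by (simp add: columns_def coeff_act)

lemma act_one: "u \<in> columns \<Longrightarrow> act (1\<^sub>m (2 * n)) u = u"
proof (rule poly_eqI)
  fix i assume u: "u \<in> columns"
  have "(\<Sum>j<2 * n. 1\<^sub>m (2 * n) $$ (i, j) * coeff u j) = (\<Sum>j<2 * n. if j = i then coeff u j else 0)" if "i < 2 * n"
    using that by (intro sum.cong) auto
  then show "coeff (act (1\<^sub>m (2 * n)) u) i = coeff u i"
    using u by (simp add: coeff_act columns_def)
qed

lemma coeff_act_monom: "j < 2 * n \<Longrightarrow> coeff (act g (monom 1 j)) i = (if i < 2 * n then g $$ (i, j) else 0)"
proof -
  assume "j < 2 * n"
  have "(\<Sum>k<2 * n. g $$ (i, k) * coeff (monom 1 j) k) = (\<Sum>k<2 * n. if k = j then g $$ (i, k) else 0)"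
    by (rule sum.cong) auto
  with \<open>j < 2 * n\<close> show ?thesis by (simp add: coeff_act)
qed

lemma coeff_comb:
  "coeff (comb n e0 f0 c d) k = (if k < n then c k else if k < 2 * n then d (k - n) else 0)"
proof -
  have "coeff (comb n e0 f0 c d) k = (\<Sum>i<n. if i = k then c i else 0) + (\<Sum>i<n. if n + i = k then d i else 0)"
    unfolding comb_def coeff_sum sum.distrib[symmetric]
    by (rule sum.cong) (auto simp: e0_def f0_def)
  also have "(\<Sum>i<n. if n + i = k then d i else 0) = (if n \<le> k \<and> k < 2 * n then d (k - n) else 0)"
  proof (cases "n \<le> k")
    case True
    then have "(\<Sum>i<n. if n + i = k then d i else 0) = (\<Sum>i<n. if i = k - n then d i else 0)"
      by (intro sum.cong) auto
    with True show ?thesis by auto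
  next
    case False
    then have "(\<Sum>i<n. if n + i = k then d i else 0) = 0" by (intro sum.neutral) auto
    with False show ?thesis by simp
  qed
  finally show ?thesis by auto
qed

lemma columns_comb: "u \<in> columns \<Longrightarrow> u = comb n e0 f0 (coeff u) (\<lambda>i. coeff u (n + i))"
  by (rule poly_eqI) (auto simp: coeff_comb columns_def)

lemma Qspan_e0_f0: "Qspan n e0 f0 = columns"
proof (intro equalityI subsetI)
  fix u assume "u \<in> Qspan n e0 f0"
  then show "u \<in> columns" by (elim QspanE) (simp add: columns_def coeff_comb)
next
  fix u assume "u \<in> columns"
  then show "u \<in> Qspan n e0 f0" using columns_comb comb_in_Qspan by metis
qed

lemma poly_form_monom:
  assumes "i < n" "j < n"
  shows "poly_form n (e0 i) (e0 j) = 0" "poly_form n (f0 i) (f0 j) = 0"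
    "poly_form n (e0 i) (f0 j) = (if i = j then 1 else 0 :: 'p padic)"
proof -
  show "poly_form n (e0 i) (e0 j) = 0" "poly_form n (f0 i) (f0 j) = 0"
    unfolding poly_form_def e0_def f0_def using assms by (auto intro!: sum.neutral)
  have "poly_form n (e0 i) (f0 j) = (\<Sum>k<n. if k = i then if i = j then 1 else 0 else 0 :: 'p padic)"
    unfolding poly_form_def e0_def f0_def using assms by (intro sum.cong) auto
  then show "poly_form n (e0 i) (f0 j) = (if i = j then 1 else 0 :: 'p padic)"
    using assms by simp
qed

lemma frame_e0_f0: "frame n e0 f0 (\<lambda>_. 0)"
  unfolding frame_def by (simp add: poly_form_monom)

lemma frame_e0_fs: "frame n e0 (fs a) (std a)"
  using frame_scale[OF frame_e0_f0, of "\<lambda>_. 0" "std a"] by (simp add: fs_def[abs_def])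

lemma Qspan_e0_fs: "Qspan n e0 (fs a) = columns"
  using Qspan_scale[of n "\<lambda>_. 1" "\<lambda>i. pp powi std a i" e0 f0] by (simp add: fs_def[abs_def] Qspan_e0_f0)

text \<open>The diagonal of the block matrix diag(1, T) by which \<open>Gamma\<close>
  conjugates.\<close>

definition T_diag :: "nat \<Rightarrow> nat \<Rightarrow> 'p padic" where "T_diag a i = (if i < n then 1 else pp powi std a (i - n))"

lemma T_diag_nonzero [simp]: "T_diag a i \<noteq> 0"
  by (simp add: T_diag_def)

lemma comb_e0_fs: "comb n e0 (fs a) c d = comb n e0 f0 c (\<lambda>i. d i * pp powi std a i)"
  by (rule comb_cong) (simp_all add: fs_def)

lemma std_lattice_iff: "u \<in> std_lattice a \<longleftrightarrow> u \<in> columns \<and> (\<forall>i<2 * n. inverse (T_diag a i) * coeff u i \<in> Zp)"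
proof
  assume "u \<in> std_lattice a"
  then obtain c d where u: "u = comb n e0 (fs a) c d" and cd: "\<forall>i<n. c i \<in> Zp \<and> d i \<in> Zp"
    unfolding std_lattice_def Zspan_def by blast
  show "u \<in> columns \<and> (\<forall>i<2 * n. inverse (T_diag a i) * coeff u i \<in> Zp)"
  proof -
    have *: "inverse (pp powi k) * (x * pp powi k) = x" for x :: "'p padic" and k by (simp add: field_simps)
    show ?thesis
      using cd unfolding u by (auto simp: columns_def comb_e0_fs coeff_comb T_diag_def *)
  qed
next
  assume u: "u \<in> columns \<and> (\<forall>i<2 * n. inverse (T_diag a i) * coeff u i \<in> Zp)"
  have "u = comb n e0 f0 (coeff u) (\<lambda>i. coeff u (n + i))" using u columns_comb by blast
  also have "\<dots> = comb n e0 (fs a) (\<lambda>i. inverse (T_diag a i) * coeff u i) (\<lambda>i. inverse (T_diag a (n + i)) * coeff u (n + i))"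
    unfolding comb_e0_fs by (rule comb_cong) (simp_all add: T_diag_def)
  also have "\<dots> \<in> std_lattice a"
    unfolding std_lattice_def using u by (intro comb_in_Zspan) simp_all
  finally show "u \<in> std_lattice a" .
qed

section \<open>The symplectic group described by frames\<close>

abbreviation J :: "'p padic mat" where "J \<equiv> J_mat n"

abbreviation Sp :: "'p padic mat set" where "Sp \<equiv> Sp_mat n"

lemma J_mat_carrier [simp]: "J \<in> carrier_mat (2 * n) (2 * n)"
  unfolding J_mat_def by (simp add: mult_2)

lemma J_mat_dims [simp]: "dim_row J = 2 * n" "dim_col J = 2 * n"
  using J_mat_carrier by (simp_all only: carrier_matD)

lemma J_mat_index:
  assumes "i < 2 * n" "l < 2 * n"
  shows "J $$ (i, l) = (if i < n then if l = n + i then 1 else 0 else if i = n + l then - 1 else 0)"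
  unfolding J_mat_def using assms by auto

lemma sum_halves: "(\<Sum>i<2 * n. h i) = (\<Sum>i<n. h i) + (\<Sum>i<n. h (n + i))" for h :: "nat \<Rightarrow> 'p padic"
  unfolding mult_2 by (rule sum_lessThan_add)

lemma mult_J_index:
  assumes g: "g \<in> carrier_mat (2 * n) (2 * n)" and j: "j < 2 * n" and l: "l < n"
  shows "(g * J) $$ (j, l) = - (g $$ (j, n + l))" "(g * J) $$ (j, n + l) = g $$ (j, l)"
proof -
  have l2: "l < 2 * n" "n + l < 2 * n" using l by simp_all
  have "(g * J) $$ (j, l) = (\<Sum>i<n. g $$ (j, i) * J $$ (i, l)) + (\<Sum>i<n. g $$ (j, n + i) * J $$ (n + i, l))"
    unfolding mult_index[OF g J_mat_carrier j l2(1)] by (rule sum_halves)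
  also have "(\<Sum>i<n. g $$ (j, i) * J $$ (i, l)) = 0"
    using l by (intro sum.neutral) (auto simp: J_mat_index)
  also have "(\<Sum>i<n. g $$ (j, n + i) * J $$ (n + i, l)) = (\<Sum>i<n. if i = l then - (g $$ (j, n + i)) else 0)"
    using l by (intro sum.cong) (auto simp: J_mat_index)
  finally show "(g * J) $$ (j, l) = - (g $$ (j, n + l))" using l by simp
  have "(g * J) $$ (j, n + l) = (\<Sum>i<n. g $$ (j, i) * J $$ (i, n + l)) + (\<Sum>i<n. g $$ (j, n + i) * J $$ (n + i, n + l))"
    unfolding mult_index[OF g J_mat_carrier j l2(2)] by (rule sum_halves)
  also have "(\<Sum>i<n. g $$ (j, n + i) * J $$ (n + i, n + l)) = 0"
    using l by (intro sum.neutral) (auto simp: J_mat_index)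
  also have "(\<Sum>i<n. g $$ (j, i) * J $$ (i, n + l)) = (\<Sum>i<n. if i = l then g $$ (j, i) else 0)"
    using l by (intro sum.cong) (auto simp: J_mat_index)
  finally show "(g * J) $$ (j, n + l) = g $$ (j, l)" using l by simp
qed

lemma gram_index:
  assumes g: "g \<in> carrier_mat (2 * n) (2 * n)" and jk: "j < 2 * n" "k < 2 * n"
  shows "(transpose_mat g * J * g) $$ (j, k) = poly_form n (act g (monom 1 j)) (act g (monom 1 k))"
proof -
  have gt: "transpose_mat g \<in> carrier_mat (2 * n) (2 * n)" using g by simp
  have gJ: "transpose_mat g * J \<in> carrier_mat (2 * n) (2 * n)"
    using gt J_mat_carrier by (rule mult_carrier_mat)
  have "(transpose_mat g * J * g) $$ (j, k) =
      (\<Sum>l<n. (transpose_mat g * J) $$ (j, l) * g $$ (l, k)) +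
      (\<Sum>l<n. (transpose_mat g * J) $$ (j, n + l) * g $$ (n + l, k))"
    unfolding mult_index[OF gJ g jk] by (rule sum_halves)
  also have "(\<Sum>l<n. (transpose_mat g * J) $$ (j, l) * g $$ (l, k)) = (\<Sum>l<n. - (g $$ (n + l, j)) * g $$ (l, k))"
    by (intro sum.cong refl, subst mult_J_index(1)[OF gt jk(1)]) (use g jk in auto)
  also have "(\<Sum>l<n. (transpose_mat g * J) $$ (j, n + l) * g $$ (n + l, k)) = (\<Sum>l<n. g $$ (l, j) * g $$ (n + l, k))"
    by (intro sum.cong refl, subst mult_J_index(2)[OF gt jk(1)]) (use g jk in auto)
  also have "(\<Sum>l<n. - (g $$ (n + l, j)) * g $$ (l, k)) + (\<Sum>l<n. g $$ (l, j) * g $$ (n + l, k)) =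
      poly_form n (act g (monom 1 j)) (act g (monom 1 k))"
    using jk unfolding poly_form_def sum.distrib[symmetric]
    by (intro sum.cong) (simp_all add: coeff_act_monom)
  finally show ?thesis .
qed

text \<open>The Gram matrix on the left collects the pairings of the columns of g, which are the
  images of the monomials. Matrix identities are thereby replaced by statements on frames.\<close>

lemma symplectic_iff_frame:
  assumes g: "g \<in> carrier_mat (2 * n) (2 * n)"
  shows "transpose_mat g * J * g = J \<longleftrightarrow> frame n (\<lambda>i. act g (e0 i)) (\<lambda>i. act g (f0 i)) (\<lambda>_. 0)"
proof
  assume "transpose_mat g * J * g = J"
  then have *: "poly_form n (act g (monom 1 j)) (act g (monom 1 k)) = J $$ (j, k)" if "j < 2 * n" "k < 2 * n" for j k
    using gram_index[OF g that] by simp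
  show "frame n (\<lambda>i. act g (e0 i)) (\<lambda>i. act g (f0 i)) (\<lambda>_. 0)"
    unfolding frame_def e0_def f0_def by (auto simp: * J_mat_index)
next
  assume fr: "frame n (\<lambda>i. act g (e0 i)) (\<lambda>i. act g (f0 i)) (\<lambda>_. 0)"
  show "transpose_mat g * J * g = J"
  proof (rule eq_matI)
    fix j k assume "j < dim_row J" "k < dim_col J"
    then have jk: "j < 2 * n" "k < 2 * n" by simp_all
    have m: "monom 1 i = (if i < n then e0 i else f0 (i - n))" if "i < 2 * n" for i
      using that by (simp add: e0_def f0_def)
    have "poly_form n (act g (monom 1 j)) (act g (monom 1 k)) = J $$ (j, k)"
      unfolding m[OF jk(1)] m[OF jk(2)] using jk frameD[OF fr]
      by (cases "j < n"; cases "k < n") (auto simp: J_mat_index)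
    then show "(transpose_mat g * J * g) $$ (j, k) = J $$ (j, k)"
      unfolding gram_index[OF g jk] .
  qed (use g in simp_all)
qed

lemma J_mat_square: "J * J = - 1\<^sub>m (2 * n)"
proof (rule eq_matI)
  fix i j assume "i < dim_row (- 1\<^sub>m (2 * n))" "j < dim_col (- 1\<^sub>m (2 * n))"
  then have ij: "i < 2 * n" "j < 2 * n" by simp_all
  show "(J * J) $$ (i, j) = (- 1\<^sub>m (2 * n) :: 'p padic mat) $$ (i, j)"
  proof (cases "j < n")
    case True
    then show ?thesis using mult_J_index(1)[OF J_mat_carrier ij(1) True] ij by (auto simp: J_mat_index)
  next
    case False
    then show ?thesis using mult_J_index(2)[OF J_mat_carrier ij(1), of "j - n"] ij by (auto simp: J_mat_index)
  qed
qed simp_all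

lemma Sp_mat_iff:
  "g \<in> Sp \<longleftrightarrow> g \<in> carrier_mat (2 * n) (2 * n) \<and> frame n (\<lambda>i. act g (e0 i)) (\<lambda>i. act g (f0 i)) (\<lambda>_. 0)"
proof -
  have "invertible_mat g" if g: "g \<in> carrier_mat (2 * n) (2 * n)" and sp: "transpose_mat g * J * g = J"
  proof -
    \<comment> \<open>The left inverse obtained from the symplectic relation by J * J = -1.\<close>
    let ?L = "- J * (transpose_mat g * J)"
    have L: "?L \<in> carrier_mat (2 * n) (2 * n)"
      by (intro mult_carrier_mat[of _ "2 * n" "2 * n"] uminus_carrier_mat J_mat_carrier) (use g in simp)
    have "?L * g = - J * (transpose_mat g * J * g)"
      using g by (intro assoc_mult_mat[of _ "2 * n" "2 * n" _ "2 * n" _ "2 * n"]) simp_all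
    also have "\<dots> = - (J * J)"
      unfolding sp by (rule uminus_mult_left_mat) (use J_mat_carrier in auto)
    also have "\<dots> = 1\<^sub>m (2 * n)" unfolding J_mat_square by simp
    finally have "?L * g = 1\<^sub>m (2 * n)" .
    then show ?thesis
      using mat_mult_left_right_inverse[OF L g] g L carrier_matD[OF L] unfolding invertible_mat_def inverts_mat_def
      by (intro conjI exI[of _ ?L]) (simp_all only: carrier_matD[OF g] square_mat.simps)
  qed
  then show ?thesis unfolding Sp_mat_def using symplectic_iff_frame by blast
qed

lemma Sp_mat_carrier: "g \<in> Sp \<Longrightarrow> g \<in> carrier_mat (2 * n) (2 * n)"
  by (simp add: Sp_mat_def)

lemma Sp_mat_form:
  assumes g: "g \<in> Sp" and uv: "u \<in> columns" "v \<in> columns"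
  shows "poly_form n (act g u) (act g v) = poly_form n u v"
proof -
  have fr: "frame n (\<lambda>i. act g (e0 i)) (\<lambda>i. act g (f0 i)) (\<lambda>_. 0)" using g by (simp add: Sp_mat_iff)
  obtain c d where u: "u = comb n e0 f0 c d" using columns_comb[OF uv(1)] by blast
  obtain c' d' where v: "v = comb n e0 f0 c' d'" using columns_comb[OF uv(2)] by blast
  show ?thesis
    unfolding u v linear_image_comb[OF linear_act] form_comb(3)[OF fr] form_comb(3)[OF frame_e0_f0] ..
qed

lemma e0_f0_in_columns: "i < n \<Longrightarrow> e0 i \<in> columns" "i < n \<Longrightarrow> f0 i \<in> columns"
  unfolding Qspan_e0_f0[symmetric] by (rule basis_in_Qspan; assumption)+

lemma Sp_mat_mult:
  assumes "g \<in> Sp" "h \<in> Sp"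
  shows "g * h \<in> Sp"
  using assms[THEN Sp_mat_carrier] poly_form_monom unfolding Sp_mat_iff frame_def
  by (simp add: act_mult Sp_mat_form[OF assms(1)] Sp_mat_form[OF assms(2)] act_in_columns e0_f0_in_columns)

lemma Sp_mat_inverse:
  assumes g: "g \<in> Sp"
  obtains h where "h \<in> Sp" "g * h = 1\<^sub>m (2 * n)" "h * g = 1\<^sub>m (2 * n)"
proof -
  have gc: "g \<in> carrier_mat (2 * n) (2 * n)" using g by (rule Sp_mat_carrier)
  obtain h where gh: "g * h = 1\<^sub>m (dim_row g)" "h * g = 1\<^sub>m (dim_row h)"
    using g unfolding Sp_mat_def invertible_mat_def inverts_mat_def by blast
  have "dim_col h = 2 * n" using arg_cong[OF gh(1), of dim_col] gc by simp
  moreover have "dim_row h = 2 * n" using arg_cong[OF gh(2), of dim_col] gc by simp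
  ultimately have hc: "h \<in> carrier_mat (2 * n) (2 * n)" by auto
  have gh': "g * h = 1\<^sub>m (2 * n)" "h * g = 1\<^sub>m (2 * n)" using gh gc hc by auto
  have ag: "act g (act h u) = u" if "u \<in> columns" for u
    using act_mult[OF gc hc, of u] act_one[OF that] by (simp add: gh')
  have "poly_form n (act h u) (act h v) = poly_form n u v" if "u \<in> columns" "v \<in> columns" for u v
    using Sp_mat_form[OF g act_in_columns act_in_columns, of h u h v] ag that by simp
  then have "h \<in> Sp"
    unfolding Sp_mat_iff frame_def using hc poly_form_monom by (simp add: e0_f0_in_columns)
  with gh' that show thesis by blast
qed

lemma Sp_mat_frame:
  assumes g: "g \<in> Sp" and fr: "frame n x y \<epsilon>" and W: "Qspan n x y = columns"
  shows "frame n (\<lambda>i. act g (x i)) (\<lambda>i. act g (y i)) \<epsilon>" "Qspan n (\<lambda>i. act g (x i)) (\<lambda>i. act g (y i)) = columns"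
proof -
  have "x i \<in> columns" "y i \<in> columns" if "i < n" for i
    using basis_in_Qspan(1)[OF that, of x y] basis_in_Qspan(2)[OF that, of y x] W by auto
  then show "frame n (\<lambda>i. act g (x i)) (\<lambda>i. act g (y i)) \<epsilon>"
    using fr by (simp add: frame_def Sp_mat_form[OF g])
  obtain h where h: "h \<in> Sp" "g * h = 1\<^sub>m (2 * n)" using Sp_mat_inverse[OF g] by metis
  show "Qspan n (\<lambda>i. act g (x i)) (\<lambda>i. act g (y i)) = columns"
  proof (intro equalityI subsetI)
    fix u assume "u \<in> Qspan n (\<lambda>i. act g (x i)) (\<lambda>i. act g (y i))"
    then show "u \<in> columns"
      by (elim QspanE) (simp add: linear_image_comb[OF linear_act, symmetric] act_in_columns)
  next
    fix u assume "u \<in> columns"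
    then have "u = act g (act h u)"
      using act_mult[OF g[THEN Sp_mat_carrier] h(1)[THEN Sp_mat_carrier], of u] act_one h(2) by simp
    moreover obtain c d where "act h u = comb n x y c d"
      using act_in_columns[of h u] W by (metis QspanE)
    ultimately show "u \<in> Qspan n (\<lambda>i. act g (x i)) (\<lambda>i. act g (y i))"
      by (metis comb_in_Qspan linear_image_comb[OF linear_act])
  qed
qed

section \<open>The standard lattices and the groups \<open>Gamma\<close> as their
  stabilizers\<close>

lemma frame_act: "g \<in> Sp \<Longrightarrow> frame n (\<lambda>i. act g (e0 i)) (\<lambda>i. act g (fs a i)) (std a)"
  "g \<in> Sp \<Longrightarrow> Qspan n (\<lambda>i. act g (e0 i)) (\<lambda>i. act g (fs a i)) = columns"
  by (rule Sp_mat_frame[OF _ frame_e0_fs Qspan_e0_fs], assumption)+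

lemma act_std_lattice: "act g ` std_lattice a = Zspan n (\<lambda>i. act g (e0 i)) (\<lambda>i. act g (fs a i))"
  unfolding std_lattice_def by (rule linear_image_Zspan[OF linear_act])

lemma std_lattice_columns: "std_lattice a \<subseteq> columns"
  using Zspan_subset_Qspan Qspan_e0_fs unfolding std_lattice_def by blast

lemma act_mult_image:
  "g \<in> Sp \<Longrightarrow> h \<in> Sp \<Longrightarrow> act (g * h) ` S = act g ` act h ` S"
  by (simp add: image_image act_mult[OF Sp_mat_carrier Sp_mat_carrier])

lemma act_one_image: "S \<subseteq> columns \<Longrightarrow> act (1\<^sub>m (2 * n)) ` S = S"
  using act_one by (force simp: image_iff)

lemma one_in_Sp: "1\<^sub>m (2 * n) \<in> Sp"
  unfolding Sp_mat_iff frame_def using poly_form_monom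
  by (simp add: act_one e0_f0_in_columns)

text \<open>The monomials scaled by \<open>T_diag\<close> form a basis of
  \<open>std_lattice a\<close>, and the numbers on the left are the entries of g in this
  basis.\<close>

lemma T_diag_integral_iff:
  assumes g: "g \<in> carrier_mat (2 * n) (2 * n)"
  shows "(\<forall>i<2 * n. \<forall>j<2 * n. inverse (T_diag a i) * g $$ (i, j) * T_diag a j \<in> Zp) \<longleftrightarrow> act g ` std_lattice a \<subseteq> std_lattice a"
    (is "?I \<longleftrightarrow> _")
proof
  have basis: "smult (T_diag a j) (monom 1 j) \<in> std_lattice a" if "j < 2 * n" for j
    using that unfolding std_lattice_iff columns_def by (auto simp: coeff_monom)
  have act_basis: "coeff (act g (smult c (monom 1 j))) i = (if i < 2 * n then c * g $$ (i, j) else 0)"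
    if "j < 2 * n" for i j c
    using linear_act[of g] coeff_act_monom[OF that, of g i] by (simp add: Vector_Spaces.linear_iff)
  {
    assume I: ?I
    show "act g ` std_lattice a \<subseteq> std_lattice a"
    proof (rule image_subsetI)
      fix u assume u: "u \<in> std_lattice a"
      show "act g u \<in> std_lattice a"
        unfolding std_lattice_iff
      proof (intro conjI allI impI act_in_columns)
        fix i assume i: "i < 2 * n"
        have "inverse (T_diag a i) * coeff (act g u) i =
            (\<Sum>j<2 * n. (inverse (T_diag a i) * g $$ (i, j) * T_diag a j) * (inverse (T_diag a j) * coeff u j))"
          using i by (auto simp: coeff_act sum_distrib_left field_simps intro!: sum.cong)
        also have "\<dots> \<in> Zp"
        proof (rule Zp_sum)
          fix j assume "j \<in> {..<2 * n}"
          then have "inverse (T_diag a i) * g $$ (i, j) * T_diag a j \<in> Zp" "inverse (T_diag a j) * coeff u j \<in> Zp"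
            using I i u unfolding std_lattice_iff by simp_all
          then show "(inverse (T_diag a i) * g $$ (i, j) * T_diag a j) * (inverse (T_diag a j) * coeff u j) \<in> Zp"
            by (rule Zp_closed(4))
        qed
        finally show "inverse (T_diag a i) * coeff (act g u) i \<in> Zp" .
      qed
    qed
  next
    assume sub: "act g ` std_lattice a \<subseteq> std_lattice a"
    show ?I
    proof (intro allI impI)
      fix i j assume i: "i < 2 * n" and j: "j < 2 * n"
      have "act g (smult (T_diag a j) (monom 1 j)) \<in> std_lattice a" using sub basis[OF j] by blast
      then have "inverse (T_diag a i) * coeff (act g (smult (T_diag a j) (monom 1 j))) i \<in> Zp"
        using i unfolding std_lattice_iff by blast
      then show "inverse (T_diag a i) * g $$ (i, j) * T_diag a j \<in> Zp"
        unfolding act_basis[OF j] using i by (simp add: mult.commute mult.left_commute)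
    qed
  }
qed

text \<open>Integrality of the conjugated matrix says only that g maps the lattice into itself.
  Equality comes from \<open>sublattice_eq\<close>, since g carries the standard frame to a frame of
  the same type and span.\<close>

lemma Gamma_iff:
  assumes ab: "a + b = n"
  shows "g \<in> Gamma a b \<longleftrightarrow> g \<in> Sp \<and> act g ` std_lattice a = std_lattice a"
proof -
  have D: "four_block_mat (1\<^sub>m n) (0\<^sub>m n n) (0\<^sub>m n n) (T_mat a b) = mat_diag (2 * n) (T_diag a)"
    using ab by (intro eq_matI) (auto simp: T_mat_def mat_diag_def T_diag_def std_def)
  have "minv (T_mat a b :: 'p padic mat) = mat_diag n (\<lambda>i. inverse (if i < a then 1 else pp))"
    unfolding T_mat_def ab
    by (rule minv_eqI[of _ n]) (simp_all add: mat_diag_diag mat_diag_one[symmetric] del: mat_diag_one cong: if_cong)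
  then have D': "four_block_mat (1\<^sub>m n) (0\<^sub>m n n) (0\<^sub>m n n) (minv (T_mat a b)) = mat_diag (2 * n) (\<lambda>i. inverse (T_diag a i))"
    by (intro eq_matI) (auto simp: mat_diag_def T_diag_def std_def)
  have conj: "(mat_diag (2 * n) (T_diag a) * M * mat_diag (2 * n) (\<lambda>i. inverse (T_diag a i))) =
      Matrix.mat (2 * n) (2 * n) (\<lambda>(i, j). T_diag a i * M $$ (i, j) * inverse (T_diag a j))"
    if "M \<in> carrier_mat (2 * n) (2 * n)" for M
    unfolding mat_diag_mult_left[OF that] by (subst mat_diag_mult_right[of _ "2 * n"]) (auto intro!: eq_matI)
  have "(\<exists>M. g = mat_diag (2 * n) (T_diag a) * M * mat_diag (2 * n) (\<lambda>i. inverse (T_diag a i)) \<and>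
      M \<in> carrier_mat (2 * n) (2 * n) \<and> elements_mat M \<subseteq> Zp) \<longleftrightarrow>
      (\<forall>i<2 * n. \<forall>j<2 * n. inverse (T_diag a i) * g $$ (i, j) * T_diag a j \<in> Zp)" (is "?L \<longleftrightarrow> ?R")
    if g: "g \<in> carrier_mat (2 * n) (2 * n)"
  proof
    assume ?L
    then obtain M where M: "M \<in> carrier_mat (2 * n) (2 * n)" "elements_mat M \<subseteq> Zp"
      and "g = mat_diag (2 * n) (T_diag a) * M * mat_diag (2 * n) (\<lambda>i. inverse (T_diag a i))"
      by blast
    then have g_eq: "g = Matrix.mat (2 * n) (2 * n) (\<lambda>(i, j). T_diag a i * M $$ (i, j) * inverse (T_diag a j))"
      using conj[OF M(1)] by simp
    have "inverse (T_diag a i) * g $$ (i, j) * T_diag a j = M $$ (i, j)" if "i < 2 * n" "j < 2 * n" for i j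
      using that unfolding g_eq by (simp add: field_simps)
    moreover have "M $$ (i, j) \<in> Zp" if "i < 2 * n" "j < 2 * n" for i j
      using M that by blast
    ultimately show ?R by simp
  next
    assume R: ?R
    define M where "M = Matrix.mat (2 * n) (2 * n) (\<lambda>(i, j). inverse (T_diag a i) * g $$ (i, j) * T_diag a j)"
    have M: "M \<in> carrier_mat (2 * n) (2 * n)" by (simp add: M_def)
    have "elements_mat M \<subseteq> Zp"
    proof
      fix x assume "x \<in> elements_mat M"
      then show "x \<in> Zp" using R by (auto simp: M_def dest!: elements_matD)
    qed
    moreover have "g = mat_diag (2 * n) (T_diag a) * M * mat_diag (2 * n) (\<lambda>i. inverse (T_diag a i))"
      unfolding conj[OF M] by (rule eq_matI) (use g in \<open>auto simp: M_def field_simps\<close>)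
    ultimately show ?L using M by blast
  qed
  then have "g \<in> Gamma a b \<longleftrightarrow> g \<in> Sp \<and> act g ` std_lattice a \<subseteq> std_lattice a"
    unfolding Gamma_def ab Let_def D D' using T_diag_integral_iff Sp_mat_carrier by blast
  moreover have "act g ` std_lattice a = std_lattice a" if "g \<in> Sp" "act g ` std_lattice a \<subseteq> std_lattice a"
    using sublattice_eq[OF frame_e0_fs frame_act(1)[OF that(1)]] frame_act(2)[OF that(1)] Qspan_e0_fs that(2) ab
    unfolding act_std_lattice by (simp add: std_lattice_def)
  ultimately show ?thesis by blast
qed

lemma Gamma_group:
  fixes g h :: "'p padic mat"
  assumes ab: "a + b = n"
  shows "(1\<^sub>m (2 * n) :: 'p padic mat) \<in> Gamma a b" "g \<in> Gamma a b \<Longrightarrow> h \<in> Gamma a b \<Longrightarrow> g * h \<in> Gamma a b"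
    "g \<in> Gamma a b \<Longrightarrow> \<exists>h\<in>Gamma a b. g * h = 1\<^sub>m (2 * n) \<and> h * g = 1\<^sub>m (2 * n)"
proof -
  show "(1\<^sub>m (2 * n) :: 'p padic mat) \<in> Gamma a b"
    unfolding Gamma_iff[OF ab] using one_in_Sp act_one_image[OF std_lattice_columns] by simp
  show "g * h \<in> Gamma a b" if "g \<in> Gamma a b" "h \<in> Gamma a b"
    using that unfolding Gamma_iff[OF ab] by (auto simp: Sp_mat_mult act_mult_image)
  show "\<exists>h\<in>Gamma a b. g * h = 1\<^sub>m (2 * n) \<and> h * g = 1\<^sub>m (2 * n)" if g: "g \<in> Gamma a b"
  proof -
    have g': "g \<in> Sp" "act g ` std_lattice a = std_lattice a" using g unfolding Gamma_iff[OF ab] by auto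
    obtain h where h: "h \<in> Sp" "g * h = 1\<^sub>m (2 * n)" "h * g = 1\<^sub>m (2 * n)" using Sp_mat_inverse[OF g'(1)] .
    have "act h ` std_lattice a = act h ` act g ` std_lattice a" using g'(2) by simp
    also have "\<dots> = std_lattice a"
      unfolding act_mult_image[OF h(1) g'(1), symmetric] h(3) by (rule act_one_image[OF std_lattice_columns])
    finally have "h \<in> Gamma a b" unfolding Gamma_iff[OF ab] using h(1) by simp
    with h(2,3) show ?thesis by blast
  qed
qed

lemma double_coset_eq:
  assumes ab: "a + b = n" "a' + b' = n" and \<alpha>: "\<alpha> \<in> Sp"
    and g: "g \<in> Gamma a b" and h: "h \<in> Gamma a' b'"
  shows "double_coset (Gamma a b) (Gamma a' b') (g * \<alpha> * h) = double_coset (Gamma a b) (Gamma a' b') \<alpha>"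
proof -
  \<comment> \<open>Stated for arbitrary factors, because the reverse inclusion is the same fact for
    the inverses of g and h, applied to g * \<alpha> * h.\<close>
  have sub: "double_coset (Gamma a b) (Gamma a' b') (g * \<alpha> * h) \<subseteq> double_coset (Gamma a b) (Gamma a' b') \<alpha>"
    if \<alpha>: "\<alpha> \<in> Sp" and g: "g \<in> Gamma a b" and h: "h \<in> Gamma a' b'" for g \<alpha> h
  proof
    fix x assume "x \<in> double_coset (Gamma a b) (Gamma a' b') (g * \<alpha> * h)"
    then obtain p q where pq: "p \<in> Gamma a b" "q \<in> Gamma a' b'" and x: "x = p * (g * \<alpha> * h) * q"
      unfolding double_coset_def by blast
    note c = pq(1)[unfolded Gamma_iff[OF ab(1)], THEN conjunct1, THEN Sp_mat_carrier]
      pq(2)[unfolded Gamma_iff[OF ab(2)], THEN conjunct1, THEN Sp_mat_carrier]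
      g[unfolded Gamma_iff[OF ab(1)], THEN conjunct1, THEN Sp_mat_carrier]
      h[unfolded Gamma_iff[OF ab(2)], THEN conjunct1, THEN Sp_mat_carrier] \<alpha>[THEN Sp_mat_carrier]
    have "x = (p * g) * \<alpha> * (h * q)"
      unfolding x using c by (simp add: assoc_mult_mat[of _ "2 * n" "2 * n" _ "2 * n" _ "2 * n"])
    then show "x \<in> double_coset (Gamma a b) (Gamma a' b') \<alpha>"
      unfolding double_coset_def using Gamma_group(2)[OF ab(1) pq(1) g] Gamma_group(2)[OF ab(2) h pq(2)] by blast
  qed
  obtain g' where g': "g' \<in> Gamma a b" "g' * g = 1\<^sub>m (2 * n)" using Gamma_group(3)[OF ab(1) g] by blast
  obtain h' where h': "h' \<in> Gamma a' b'" "h * h' = 1\<^sub>m (2 * n)" using Gamma_group(3)[OF ab(2) h] by blast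
  note c = g[unfolded Gamma_iff[OF ab(1)], THEN conjunct1] h[unfolded Gamma_iff[OF ab(2)], THEN conjunct1]
    g'(1)[unfolded Gamma_iff[OF ab(1)], THEN conjunct1] h'(1)[unfolded Gamma_iff[OF ab(2)], THEN conjunct1] \<alpha>
  have "g' * (g * \<alpha> * h) * h' = (g' * g) * \<alpha> * (h * h')"
    using c[THEN Sp_mat_carrier] by (simp add: assoc_mult_mat[of _ "2 * n" "2 * n" _ "2 * n" _ "2 * n"])
  also have "\<dots> = \<alpha>" unfolding g'(2) h'(2) using \<alpha>[THEN Sp_mat_carrier] by simp
  finally have eq: "g' * (g * \<alpha> * h) * h' = \<alpha>" .
  have "g * \<alpha> * h \<in> Sp" using c by (intro Sp_mat_mult)
  from sub[OF this g'(1) h'(1)] sub[OF \<alpha> g h] show ?thesis unfolding eq by blast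
qed

text \<open>The row of the nonzero entry in column j of the matrix B of the representatives.\<close>

definition col_perm :: "nat \<Rightarrow> nat \<times> nat \<times> int list \<Rightarrow> nat \<Rightarrow> nat"
  where "col_perm a = (\<lambda>(rm, rp, \<mu>) j. if j < rp then a + j else if j < a - rm + rp then rm + (j - rp)
    else if j < a + rp then j - (a - rm + rp) else j)"

lemma bij_betw_col_perm:
  assumes "rm \<le> a" "rp \<le> b" "a + b = n"
  shows "bij_betw (col_perm a (rm, rp, \<mu>)) {..<n} {..<n}"
proof -
  have "inj_on (col_perm a (rm, rp, \<mu>)) {..<n}"
    using assms by (intro inj_onI) (simp add: col_perm_def split: if_splits)
  moreover have "col_perm a (rm, rp, \<mu>) ` {..<n} \<subseteq> {..<n}"
    using assms by (auto simp: col_perm_def)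
  ultimately show ?thesis by (simp add: bij_betw_def endo_inj_surj)
qed

lemma B_mat_eq:
  assumes "rm \<le> a" "rp \<le> b" "a + b = n"
  shows "(B_mat a b (rm, rp, \<mu>) :: 'p padic mat) =
    Matrix.mat n n (\<lambda>(i, j). if i = col_perm a (rm, rp, \<mu>) j then pp powi (\<mu> ! i) else 0)"
proof -
  \<comment> \<open>The sizes a - r_- and b - r_+ get names, which removes truncated subtraction
    from the block bounds.\<close>
  obtain k l where k: "a = rm + k" and l: "b = rp + l"
    using assms(1,2) by (auto simp: le_iff_add)
  have n: "n = rm + k + rp + l" using assms(3) k l by simp
  show ?thesis
  proof (rule eq_matI)
    fix i j
    assume "i < dim_row (Matrix.mat n n (\<lambda>(i, j). if i = col_perm a (rm, rp, \<mu>) j then pp powi (\<mu> ! i) else 0 :: 'p padic))"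
      and "j < dim_col (Matrix.mat n n (\<lambda>(i, j). if i = col_perm a (rm, rp, \<mu>) j then pp powi (\<mu> ! i) else 0 :: 'p padic))"
    then have ij: "i < n" "j < n" by simp_all
    have "i < rm \<or> (\<exists>i'<k. i = rm + i') \<or> (\<exists>i'<rp. i = rm + k + i') \<or> (\<exists>i'<l. i = rm + k + rp + i')"
      "j < rp \<or> (\<exists>j'<k. j = rp + j') \<or> (\<exists>j'<rm. j = rp + k + j') \<or> (\<exists>j'<l. j = rp + k + rm + j')"
      using ij unfolding n by presburger+
    then have "(B_mat a b (rm, rp, \<mu>) :: 'p padic mat) $$ (i, j) =
        (if i = col_perm a (rm, rp, \<mu>) j then pp powi (\<mu> ! i) else 0)"
      by (elim disjE exE conjE; simp add: B_mat_def k l col_perm_def mat_diag_def)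
    then show "(B_mat a b (rm, rp, \<mu>) :: 'p padic mat) $$ (i, j) =
        Matrix.mat n n (\<lambda>(i, j). if i = col_perm a (rm, rp, \<mu>) j then pp powi (\<mu> ! i) else 0) $$ (i, j)"
      using ij by simp
  qed (simp_all add: B_mat_def mat_diag_def k l n)
qed

text \<open>The inverse transpose of a monomial matrix has the same pattern with inverted
  entries.\<close>

definition C_mat :: "nat \<Rightarrow> nat \<times> nat \<times> int list \<Rightarrow> 'p padic mat"
  where "C_mat a t = Matrix.mat n n (\<lambda>(i, j). if i = col_perm a t j then pp powi (- (snd (snd t) ! i)) else 0)"

lemma minv_transpose_B_mat:
  assumes "rm \<le> a" "rp \<le> b" "a + b = n"
  shows "minv (transpose_mat (B_mat a b (rm, rp, \<mu>))) = C_mat a (rm, rp, \<mu>)"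
proof (rule minv_eqI)
  let ?B = "B_mat a b (rm, rp, \<mu>) :: 'p padic mat" and ?\<sigma> = "col_perm a (rm, rp, \<mu>)"
  have \<sigma>: "?\<sigma> j < n" "?\<sigma> j = ?\<sigma> k \<longleftrightarrow> j = k" if "j < n" "k < n" for j k
    using bij_betw_col_perm[OF assms, of \<mu>] that by (auto simp: bij_betw_def inj_on_def)
  have B: "?B \<in> carrier_mat n n" by (simp add: B_mat_eq[OF assms])
  show "transpose_mat ?B \<in> carrier_mat n n" using B by simp
  show "C_mat a (rm, rp, \<mu>) \<in> carrier_mat n n" by (simp add: C_mat_def)
  show "transpose_mat ?B * C_mat a (rm, rp, \<mu>) = 1\<^sub>m n"
  proof (rule eq_matI)
    fix j k assume "j < dim_row (1\<^sub>m n :: 'p padic mat)" "k < dim_col (1\<^sub>m n :: 'p padic mat)"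
    then have jk: "j < n" "k < n" by simp_all
    have "(transpose_mat ?B * C_mat a (rm, rp, \<mu>)) $$ (j, k) =
        (\<Sum>i<n. (if i = ?\<sigma> j then pp powi (\<mu> ! i) else 0) * (if i = ?\<sigma> k then pp powi (- (\<mu> ! i)) else 0))"
      using jk by (simp add: B_mat_eq[OF assms] C_mat_def scalar_prod_def lessThan_atLeast0 cong: if_cong)
    also have "\<dots> = (\<Sum>i<n. if i = ?\<sigma> j then if j = k then 1 else 0 else 0)"
      using \<sigma>[OF jk] by (intro sum.cong) (auto simp: power_int_minus)
    also have "\<dots> = (1\<^sub>m n :: 'p padic mat) $$ (j, k)" using \<sigma>(1)[OF jk] jk by simp
    finally show "(transpose_mat ?B * C_mat a (rm, rp, \<mu>)) $$ (j, k) = (1\<^sub>m n :: 'p padic mat) $$ (j, k)" .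
  qed (use B in \<open>auto simp: C_mat_def\<close>)
qed

lemma act_D_mat:
  fixes \<mu> :: "int list"
  assumes "rm \<le> a" "rp \<le> b" "a + b = n" "j < n"
  defines "D \<equiv> D_mat a b (rm, rp, \<mu>)" and "\<sigma> \<equiv> col_perm a (rm, rp, \<mu>)"
  shows "act D (e0 j) = smult (pp powi (\<mu> ! \<sigma> j)) (e0 (\<sigma> j))"
    and "act D (f0 j) = smult (pp powi (- (\<mu> ! \<sigma> j))) (f0 (\<sigma> j))"
proof -
  have \<sigma>: "\<sigma> j < n"
    using bij_betw_col_perm[OF assms(1-3), of \<mu>] assms(4) by (auto simp: bij_betw_def \<sigma>_def)
  have D: "D = four_block_mat (Matrix.mat n n (\<lambda>(i, j). if i = \<sigma> j then pp powi (\<mu> ! i) else 0)) (0\<^sub>m n n)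
      (0\<^sub>m n n) (Matrix.mat n n (\<lambda>(i, j). if i = \<sigma> j then pp powi (- (\<mu> ! i)) else 0))"
    unfolding D_def D_mat_def minv_transpose_B_mat[OF assms(1-3)]
    unfolding B_mat_eq[OF assms(1-3)] assms(3) C_mat_def \<sigma>_def snd_conv ..
  show "act D (e0 j) = smult (pp powi (\<mu> ! \<sigma> j)) (e0 (\<sigma> j))"
  proof (rule poly_eqI)
    fix i
    have "coeff (act D (e0 j)) i = (if i < 2 * n then D $$ (i, j) else 0)"
      unfolding e0_def using assms(4) by (simp add: coeff_act_monom)
    also have "\<dots> = coeff (smult (pp powi (\<mu> ! \<sigma> j)) (e0 (\<sigma> j))) i"
      using \<sigma> assms(4) by (auto simp: D e0_def coeff_monom)
    finally show "coeff (act D (e0 j)) i = coeff (smult (pp powi (\<mu> ! \<sigma> j)) (e0 (\<sigma> j))) i" .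
  qed
  show "act D (f0 j) = smult (pp powi (- (\<mu> ! \<sigma> j))) (f0 (\<sigma> j))"
  proof (rule poly_eqI)
    fix i
    have "coeff (act D (f0 j)) i = (if i < 2 * n then D $$ (i, n + j) else 0)"
      unfolding f0_def using assms(4) by (simp add: coeff_act_monom)
    also have "\<dots> = coeff (smult (pp powi (- (\<mu> ! \<sigma> j))) (f0 (\<sigma> j))) i"
      using \<sigma> assms(4) by (auto simp: D f0_def coeff_monom)
    finally show "coeff (act D (f0 j)) i = coeff (smult (pp powi (- (\<mu> ! \<sigma> j))) (f0 (\<sigma> j))) i" .
  qed
qed

text \<open>\<open>D_mat\<close> permutes and scales the standard basis, so it carries the standard
  lattice of type (a', b') to a lattice spanned by multiples of the same basis.\<close>

lemma D_mat_params:
  assumes ab: "a + b = n" and t: "t \<in> params n a b a' b'"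
  shows "D_mat a b t \<in> Sp" "act (D_mat a b t) ` std_lattice a' = rep_lattice smult e0 (fs a) n a t"
proof -
  obtain rm rp \<mu> where t_eq: "t = (rm, rp, \<mu>)" by (cases t)
  have r: "rm \<le> a" "rp \<le> b" "a' + rm = a + rp"
    using t unfolding t_eq params_def by auto
  let ?D = "D_mat a b t :: 'p padic mat" and ?\<sigma> = "col_perm a t"
  note bij = bij_betw_col_perm[OF r(1,2) ab, of \<mu>, folded t_eq]
  note act = act_D_mat[OF r(1,2) ab, of _ \<mu>, folded t_eq]
  have \<sigma>: "?\<sigma> j < n" "?\<sigma> j = ?\<sigma> k \<longleftrightarrow> j = k" if "j < n" "k < n" for j k
    using bij that by (auto simp: bij_betw_def inj_on_def)
  have "?D \<in> carrier_mat (2 * n) (2 * n)"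
    unfolding t_eq D_mat_def minv_transpose_B_mat[OF r(1,2) ab]
    unfolding B_mat_eq[OF r(1,2) ab] ab C_mat_def by (auto simp: mult_2)
  moreover have "frame n (\<lambda>i. act ?D (e0 i)) (\<lambda>i. act ?D (f0 i)) (\<lambda>_. 0)"
    unfolding frame_def using \<sigma> poly_form_monom
    by (simp add: act form_scale_left form_scale_right power_int_minus)
  ultimately show "?D \<in> Sp" unfolding Sp_mat_iff by blast
  \<comment> \<open>The first a' columns, of block sizes r_+ and a - r_-, go to the places where L
    is unimodular, the remaining b' to those where it is p-modular. This matching of types dictates
    the block shape of B.\<close>
  have nu: "std a' j - \<mu> ! ?\<sigma> j - std a (?\<sigma> j) = nu a t (?\<sigma> j)" if "j < n" for j
    using r that ab by (auto simp: col_perm_def nu_def std_def t_eq)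
  have fs: "act ?D (fs a' j) = smult (pp powi nu a t (?\<sigma> j)) (fs a (?\<sigma> j))" if j: "j < n" for j
  proof -
    have "act ?D (fs a' j) = smult (pp powi std a' j) (act ?D (f0 j))"
      unfolding fs_def using linear_act[of ?D] by (simp add: Vector_Spaces.linear_iff)
    also have "\<dots> = smult (pp powi (std a' j - \<mu> ! ?\<sigma> j)) (f0 (?\<sigma> j))"
      unfolding act(2)[OF j] by (simp add: power_int_diff power_int_minus field_simps)
    also have "\<dots> = smult (pp powi nu a t (?\<sigma> j)) (fs a (?\<sigma> j))"
      unfolding nu[OF j, symmetric] fs_def by (simp add: power_int_diff)
    finally show ?thesis .
  qed
  have "act ?D ` std_lattice a' = Zspan n (\<lambda>j. smult (pp powi (\<mu> ! ?\<sigma> j)) (e0 (?\<sigma> j))) (\<lambda>j. smult (pp powi nu a t (?\<sigma> j)) (fs a (?\<sigma> j)))"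
    unfolding act_std_lattice by (rule Zspan_cong) (simp_all add: act(1) fs)
  also have "\<dots> = Zspan n (\<lambda>j. smult (pp powi (\<mu> ! j)) (e0 j)) (\<lambda>j. smult (pp powi nu a t j) (fs a j))"
    by (rule span_permute(1)[OF bij])
  finally show "act ?D ` std_lattice a' = rep_lattice smult e0 (fs a) n a t"
    unfolding rep_lattice_eq_Zspan by (simp add: t_eq)
qed

section \<open>Double cosets as orbits on lattices of columns\<close>

lemma ex_Sp_mat_frame:
  assumes fr: "frame n x y (std a)" and W: "Qspan n x y = columns"
  obtains g where "g \<in> Sp" "\<forall>i<n. act g (e0 i) = x i \<and> act g (fs a i) = y i"
proof -
  \<comment> \<open>The columns of g are the images of the monomials; p^(-std) converts the image
    prescribed for \<open>fs\<close> into the one for \<open>f0\<close>.\<close>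
  define g where "g = Matrix.mat (2 * n) (2 * n)
    (\<lambda>(i, j). if j < n then coeff (x j) i else pp powi (- std a (j - n)) * coeff (y (j - n)) i)"
  have in_W: "x i \<in> columns" "y i \<in> columns" if "i < n" for i
    using basis_in_Qspan(1)[OF that, of x y] basis_in_Qspan(2)[OF that, of y x] W by auto
  have e: "act g (e0 i) = x i" if "i < n" for i
    using in_W(1)[OF that] that
    by (intro poly_eqI) (auto simp: e0_def coeff_act_monom g_def columns_def)
  have f: "act g (f0 i) = smult (pp powi (- std a i)) (y i)" if "i < n" for i
    using in_W(2)[OF that] that
    by (intro poly_eqI) (auto simp: f0_def coeff_act_monom g_def columns_def)
  have "frame n (\<lambda>i. smult (pp powi 0) (x i)) (\<lambda>i. smult (pp powi (- std a i)) (y i)) (\<lambda>i. std a i + 0 + (- std a i))"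
    by (rule frame_scale[OF fr])
  then have "frame n (\<lambda>i. act g (e0 i)) (\<lambda>i. act g (f0 i)) (\<lambda>_. 0)"
    unfolding frame_def by (simp add: e f)
  then have "g \<in> Sp" unfolding Sp_mat_iff by (simp add: g_def)
  have "act g (fs a i) = y i" if "i < n" for i
    using linear_act[of g] f[OF that]
    by (simp add: Vector_Spaces.linear_iff fs_def power_int_minus)
  with e have "\<forall>i<n. act g (e0 i) = x i \<and> act g (fs a i) = y i" by simp
  with \<open>g \<in> Sp\<close> show thesis by (rule that)
qed

text \<open>With L' = \<open>std_lattice a'\<close>, the cosets \<alpha> \<open>Gamma a' b'\<close>
  correspond to the lattices \<alpha> L', so the double cosets correspond to the orbits of
  \<open>Gamma a b\<close> on these lattices. Existence then comes from
  \<open>relative_position\<close> and uniqueness from \<open>rep_lattice_inj\<close>.\<close>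

theorem D_mat_representatives:
  assumes ab: "a + b = n" "a' + b' = n"
  shows "representatives (D_mat a b) (params n a b a' b') Sp (double_coset (Gamma a b) (Gamma a' b'))"
proof -
  have unique: "t = s"
    if t: "t \<in> params n a b a' b'" "s \<in> params n a b a' b'"
      and D: "(D_mat a b s :: 'p padic mat) \<in> double_coset (Gamma a b) (Gamma a' b') (D_mat a b t)" for t s
  proof -
    obtain g h :: "'p padic mat" where g: "g \<in> Gamma a b" and h: "h \<in> Gamma a' b'" and eq: "D_mat a b s = g * D_mat a b t * h"
      using D unfolding double_coset_def by blast
    have g': "g \<in> Sp" "act g ` std_lattice a = std_lattice a" using g unfolding Gamma_iff[OF ab(1)] by auto
    have h': "h \<in> Sp" "act h ` std_lattice a' = std_lattice a'" using h unfolding Gamma_iff[OF ab(2)] by auto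
    note Dt = D_mat_params[OF ab(1) t(1)] and Ds = D_mat_params[OF ab(1) t(2)]
    have "rep_lattice smult e0 (fs a) n a s = act g ` act (D_mat a b t) ` act h ` std_lattice a'"
      unfolding Ds(2)[symmetric] eq by (simp only: act_mult_image Sp_mat_mult g'(1) h'(1) Dt(1))
    also have "\<dots> = rep_lattice smult (\<lambda>i. act g (e0 i)) (\<lambda>i. act g (fs a i)) n a t"
      unfolding h'(2) Dt(2) by (rule linear_image_rep_lattice[OF linear_act])
    finally have rep: "rep_lattice smult (\<lambda>i. act g (e0 i)) (\<lambda>i. act g (fs a i)) n a t = rep_lattice smult e0 (fs a) n a s" ..
    show ?thesis
    proof (rule rep_lattice_inj[OF frame_act(1)[OF g'(1)] frame_e0_fs _ _ ab(1) t rep])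
      show "Qspan n (\<lambda>i. act g (e0 i)) (\<lambda>i. act g (fs a i)) = Qspan n e0 (fs a)"
        using frame_act(2)[OF g'(1)] Qspan_e0_fs by simp
      show "Zspan n (\<lambda>i. act g (e0 i)) (\<lambda>i. act g (fs a i)) = Zspan n e0 (fs a)"
        using g'(2) unfolding act_std_lattice by (simp add: std_lattice_def)
    qed
  qed
  have self: "\<alpha> \<in> double_coset (Gamma a b) (Gamma a' b') \<alpha>" if "\<alpha> \<in> Sp" for \<alpha>
  proof -
    have "\<alpha> = 1\<^sub>m (2 * n) * \<alpha> * 1\<^sub>m (2 * n)" using Sp_mat_carrier[OF that] by simp
    then show ?thesis
      unfolding double_coset_def using Gamma_group(1)[OF ab(1)] Gamma_group(1)[OF ab(2)] by blast
  qed
  show ?thesis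
    unfolding representatives_def
  proof (intro conjI ballI)
    show "inj_on (D_mat a b :: _ \<Rightarrow> 'p padic mat) (params n a b a' b')"
    proof (rule inj_onI)
      fix t s assume ts: "t \<in> params n a b a' b'" "s \<in> params n a b a' b'"
        and "D_mat a b t = (D_mat a b s :: 'p padic mat)"
      then show "t = s" using unique[OF ts] self[OF D_mat_params(1)[OF ab(1) ts(2)]] by simp
    qed
    show "D_mat a b ` params n a b a' b' \<subseteq> Sp" using D_mat_params(1)[OF ab(1)] by blast
    fix \<alpha> assume \<alpha>: "\<alpha> \<in> Sp"
    obtain x y t where xy: "frame n x y (std a)" "Qspan n x y = columns" "Zspan n x y = std_lattice a"
      and t: "t \<in> params n a b a' b'" and rep: "rep_lattice smult x y n a t = act \<alpha> ` std_lattice a'"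
      using relative_position[OF frame_e0_fs frame_act(1)[OF \<alpha>] _ ab]
      unfolding Qspan_e0_fs frame_act(2)[OF \<alpha>] act_std_lattice[symmetric] std_lattice_def[symmetric] by blast
    obtain g where g: "g \<in> Sp" "\<forall>i<n. act g (e0 i) = x i \<and> act g (fs a i) = y i"
      using ex_Sp_mat_frame[OF xy(1,2)] .
    have "act g ` std_lattice a = Zspan n x y"
      unfolding act_std_lattice by (rule Zspan_cong) (simp_all add: g(2))
    then have "act g ` std_lattice a = std_lattice a" unfolding xy(3) .
    then have gG: "g \<in> Gamma a b" unfolding Gamma_iff[OF ab(1)] using g(1) by blast
    note D = D_mat_params[OF ab(1) t]
    have gD: "g * D_mat a b t \<in> Sp" using g(1) D(1) by (rule Sp_mat_mult)
    have "act g ` rep_lattice smult e0 (fs a) n a t = rep_lattice smult x y n a t"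
      unfolding linear_image_rep_lattice[OF linear_act] unfolding rep_lattice_eq_Zspan
      by (rule Zspan_cong) (simp_all add: g(2))
    then have gD_image: "act (g * D_mat a b t) ` std_lattice a' = act \<alpha> ` std_lattice a'"
      by (simp only: act_mult_image[OF g(1) D(1)] D(2) rep)
    obtain k where k: "k \<in> Sp" "(g * D_mat a b t) * k = 1\<^sub>m (2 * n)" "k * (g * D_mat a b t) = 1\<^sub>m (2 * n)"
      using Sp_mat_inverse[OF gD] .
    \<comment> \<open>The product g * D and \<alpha> carry \<open>std_lattice a'\<close> to the same
      lattice, so their quotient h stabilizes it and \<alpha> = g * D * h.\<close>
    define h where "h = k * \<alpha>"
    have h: "h \<in> Sp" unfolding h_def using k(1) \<alpha> by (rule Sp_mat_mult)
    have "act h ` std_lattice a' = act k ` act (g * D_mat a b t) ` std_lattice a'"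
      unfolding h_def act_mult_image[OF k(1) \<alpha>] gD_image ..
    also have "\<dots> = std_lattice a'"
      unfolding act_mult_image[OF k(1) gD, symmetric] k(3) by (rule act_one_image[OF std_lattice_columns])
    finally have hG: "h \<in> Gamma a' b'" unfolding Gamma_iff[OF ab(2)] using h by blast
    have "g * D_mat a b t * h = (g * D_mat a b t * k) * \<alpha>"
      unfolding h_def using gD k(1) \<alpha>
      by (intro assoc_mult_mat[symmetric, of _ "2 * n" "2 * n" _ "2 * n" _ "2 * n"] Sp_mat_carrier)
    also have "\<dots> = \<alpha>" unfolding k(2) using Sp_mat_carrier[OF \<alpha>] by simp
    finally have eq: "double_coset (Gamma a b) (Gamma a' b') \<alpha> = double_coset (Gamma a b) (Gamma a' b') (D_mat a b t)"
      using double_coset_eq[OF ab D(1) gG hG] by simp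
    show "\<exists>!r. r \<in> D_mat a b ` params n a b a' b' \<and>
        double_coset (Gamma a b) (Gamma a' b') r = double_coset (Gamma a b) (Gamma a' b') \<alpha>"
    proof (rule ex1I)
      show "D_mat a b t \<in> D_mat a b ` params n a b a' b' \<and>
          double_coset (Gamma a b) (Gamma a' b') (D_mat a b t) = double_coset (Gamma a b) (Gamma a' b') \<alpha>"
        using t eq by simp
      fix r assume r: "r \<in> D_mat a b ` params n a b a' b' \<and>
          double_coset (Gamma a b) (Gamma a' b') r = double_coset (Gamma a b) (Gamma a' b') \<alpha>"
      then obtain s where s: "s \<in> params n a b a' b'" "r = D_mat a b s" by blast
      have "(D_mat a b s :: 'p padic mat) \<in> double_coset (Gamma a b) (Gamma a' b') (D_mat a b t)"
        using r s(2) eq self[OF D_mat_params(1)[OF ab(1) s(1)]] by simp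
      then show "r = D_mat a b t" using unique[OF t s(1)] s(2) by simp
    qed
  qed
qed

end

theorem theorem3p1:
  fixes scale :: "'p::prime_card padic \<Rightarrow> 'v::ab_group_add \<Rightarrow> 'v"
    and form :: "'v \<Rightarrow> 'v \<Rightarrow> 'p padic"
    and \<Lambda> :: "'v set"
    and n a b :: nat
  assumes "a + b = n"
  shows
    "(symplectic_space scale form n \<and> lattice_on scale \<Lambda> \<and> p_elementary scale form \<Lambda> \<and>
        hyperbolic_sum scale form a b \<Lambda> \<longrightarrow>
      (\<forall>a' b' L L'.
         lattice_on scale L \<and> p_elementary scale form L \<and> hyperbolic_sum scale form a' b' L \<and>
         lattice_on scale L' \<and> p_elementary scale form L' \<and> hyperbolic_sum scale form a' b' L' \<and>
         isometric scale form L L' \<longrightarrow>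
         (L' \<in> Sp_orbit scale form \<Lambda> L \<longleftrightarrow>
            elementary_divisors scale L \<Lambda> = elementary_divisors scale L' \<Lambda> \<and>
            elementary_divisors scale L (dual_lattice form \<Lambda>) =
              elementary_divisors scale L' (dual_lattice form \<Lambda>))) \<and>
      (\<forall>a' b' e f.
         zp_basis scale (map e [0..<n] @ map f [0..<n]) \<Lambda> \<and>
         (\<forall>i<n. \<forall>j<n. form (e i) (e j) = 0 \<and> form (f i) (f j) = 0 \<and>
            form (e i) (f j) = (if i = j then (if i < a then 1 else pp) else 0)) \<longrightarrow>
         representatives (rep_lattice scale e f n a) (params n a b a' b')
           {L. lattice_on scale L \<and> p_elementary scale form L \<and> hyperbolic_sum scale form a' b' L}
           (Sp_orbit scale form \<Lambda>))) \<and>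
     (\<forall>a' b'. a' + b' = n \<longrightarrow>
        representatives (D_mat a b) (params n a b a' b') (Sp_mat n :: 'p padic mat set)
          (double_coset (Gamma a b) (Gamma a' b')))"
proof (intro conjI impI allI; (elim conjE)?)
  assume sp: "symplectic_space scale form n" and \<Lambda>: "lattice_on scale \<Lambda>" "hyperbolic_sum scale form a b \<Lambda>"
  interpret alternating_space scale form by (rule alternating_space_symplectic_space[OF sp])
  {
    fix a' b' L L'
    assume "lattice_on scale L" "hyperbolic_sum scale form a' b' L"
      "lattice_on scale L'" "hyperbolic_sum scale form a' b' L'"
    then show "L' \<in> Sp_orbit scale form \<Lambda> L \<longleftrightarrow>
        elementary_divisors scale L \<Lambda> = elementary_divisors scale L' \<Lambda> \<and>
        elementary_divisors scale L (dual_lattice form \<Lambda>) = elementary_divisors scale L' (dual_lattice form \<Lambda>)"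
      by (rule orbit_iff_elementary_divisors[OF \<Lambda>])
  next
    fix a' b' e f
    assume "zp_basis scale (map e [0..<n] @ map f [0..<n]) \<Lambda>"
      "\<forall>i<n. \<forall>j<n. form (e i) (e j) = 0 \<and> form (f i) (f j) = 0 \<and>
        form (e i) (f j) = (if i = j then (if i < a then 1 else pp) else 0)"
    then show "representatives (rep_lattice scale e f n a) (params n a b a' b')
        {L. lattice_on scale L \<and> p_elementary scale form L \<and> hyperbolic_sum scale form a' b' L}
        (Sp_orbit scale form \<Lambda>)"
      by (rule rep_lattice_representatives[OF \<Lambda>(1) assms])
  }
next
  fix a' b' assume "a' + b' = n"
  interpret poly_symplectic n "TYPE('p)" .
  show "representatives (D_mat a b) (params n a b a' b') (Sp_mat n :: 'p padic mat set)
      (double_coset (Gamma a b) (Gamma a' b'))"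
    by (rule D_mat_representatives[OF assms \<open>a' + b' = n\<close>])
qed

end
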